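(* Let $k\ge2$ be an odd integer and let $C$ be an extremal Type II code of length $24$ over $\mathbb{Z}_{2k}$. Let $C_2=\{(c_1,\dots,c_{24})\in C\mid c_i\equiv0\pmod k\text{ for all }i\}$, regarded as a binary code, and $m=\dim_{\mathbb{Z}_2}C_2$. Let $(V_L^+)^{\otimes24}\subset V_\Lambda^+\subset V^\natural$ be an embedding as a subVOA such that, as $(V_L^+)^{\otimes24}$-modules, $$V_\Lambda^+\cong\bigoplus_{c\in C_2}M(c)^+\oplus\frac12\bigoplus_{c\in C\setminus C_2}M(c),\qquad V_\Lambda^{T,+}\cong\bigoplus_{c\in C_2^\perp}2^{m-12}M^T(c)^-.$$ For $i\in\{1,\dots,24\}$ let $\sigma_i$ be the automorphism of $V^\natural$ acting on each irreducible $(V_L^+)^{\otimes24}$-submodule isomorphic to $W_1\otimes\cdots\otimes W_{24}$ by multiplication by $\mu_k(W_i)$ (it is a $4A$ element of the Monster). Then the McKay–Thompson series for the $4A$ element $\sigma_i$ is given by $$T_{4A}(q)=q^{-1}\Big\{\frac12\sum_{c\in C}(-1)^{\tau_i(c)}\,\mathrm{ch}(M(c))+\frac12 b^{24}\Big\}.$$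
   Context: All spaces are over $\mathbb{C}$; $\mathbb{Z}_n=\mathbb{Z}/n\mathbb{Z}$. A subVOA shares the vacuum and Virasoro element. For a graded space $V=\bigoplus_nV_n$ (conformal weight grading), $\mathrm{ch}(V)=\sum_n\dim(V_n)q^n$. For $g$ in the Monster $\mathrm{Aut}(V^\natural)$, the McKay–Thompson series is $T_g(q)=q^{-1}\sum_{n\ge0}(\mathrm{Tr}\,g|_{V^\natural_n})q^n$; $T_{4A}$ is $T_g$ for $g$ in class $4A$. $\tau_i:\mathbb{Z}_{2k}^{24}\to\mathbb{Z}_2$ is the projection to the $i$-th coordinate followed by the canonical map $\mathbb{Z}_{2k}\to\mathbb{Z}_2$. $b=\mathrm{ch}V_L^+-\mathrm{ch}V_L^-=\frac{1}{\phi(q)}\sum_{j\in\mathbb{Z}}(-1)^jq^{j^2}$ with $\phi(q)=\prod_{n\ge1}(1-q^n)$. Codes. A code of length $n$ over $\mathbb{Z}_{2k}$ is a submodule of $\mathbb{Z}_{2k}^n$. The Euclidean weight of $(\bar m_1,\dots,\bar m_n)$ with $-k<m_i\le k$ is $\sum m_i^2$. A Type II code is a self-dual code (standard inner product) all of whose codewords have Euclidean weight divisible by $4k$; an extremal Type II code of length 24 is one with minimum (nonzero) Euclidean weight $8k$. $C_2$ is viewed in $\mathbb{Z}_2^{24}$ by replacing $\bar k$ by $1$; $C_2^\perp$ is its dual in $\mathbb{Z}_2^{24}$. The VOA $V_L^+$. $L=\mathbb{Z}\alpha$ with $\langle\alpha,\alpha\rangle=2k$, $H=\mathbb{C}\otimes_{\mathbb{Z}}L$,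 dual lattice $L^\circ=\mathbb{Z}\frac{\alpha}{2k}$. $V_L=S(H\otimes t^{-1}\mathbb{C}[t^{-1}])\otimes\mathbb{C}\{L\}$ is the lattice VOA (the central extension of $L$ by $\langle-1\rangle$ taken trivial, $\mathbb{C}\{L\}$ with basis $e^\mu$, $\mu\in L$); for $\lambda\in L^\circ$, $V_{\lambda+L}=S(H\otimes t^{-1}\mathbb{C}[t^{-1}])\otimes\mathrm{span}\{e^\mu\mid\mu\in\lambda+L\}$ is the corresponding irreducible $V_L$-module. Write $h(n)=h\otimes t^n$. Fix a homomorphism $\rho_L:L\to\mathbb{C}^\times$ with $\rho_L(2\mu)=(-1)^{\langle\mu,\mu\rangle/2}$. $\theta_{V_L}$ is the automorphism of $V_L$ induced by $h(n)\mapsto-h(n)$, $e^\mu\mapsto\rho_L(2\mu)e^{-\mu}$; on $V_{\alpha/2+L}$ it is the linear map with $\theta_{V_L}(Y(v,z)w)=Y(\theta_{V_L}v,z)\theta_{V_L}w$ and $\theta_{V_L}(e^{\alpha/2})=\rho_L(\alpha)e^{-\alpha/2}$. $V_L^\pm,V_{\alpha/2+L}^\pm$ are the $\pm1$-eigenspaces. For $i=0,1$, $T_i=\mathbb{C}$ is the one-dimensional module on which $e^\alpha$ acts by $(-1)^i\rho_L(\alpha)$, $V_L^{T_i}=S(H\otimes t^{-1/2}\mathbb{C}[t^{-1}])\otimes T_i$ is the irreducible $\theta_{V_L}$-twisted $V_L$-module, and $V_L^{T_i,\pm}$ are the $\pm1$-eigenspaces of the map acting by $h(n)\mapsto-h(n)$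 on the symmetric algebra and trivially on $T_i$. The irreducible $V_L^+$-modules are $V_L^\pm$, $V_{\alpha/2+L}^\pm$, $V_L^{T_i,\pm}$ ($i=0,1$), $V_{r\alpha/2k+L}$ ($1\le r\le k-1$). For $k$ odd, $\mu_k$ is: $\mu_k(W)=1$ for $W\in\{V_L^\pm,\ V_{j\alpha/k+L}\mid1\le j\le(k-1)/2\}$; $-1$ for $W\in\{V_{\alpha/2+L}^\pm,\ V_{(2j-1)\alpha/2k+L}\mid1\le j\le(k-1)/2\}$; $\sqrt{-1}$ for $W=V_L^{T_0,\pm}$; $-\sqrt{-1}$ for $W=V_L^{T_1,\pm}$. Modules. For $c\in\mathbb{Z}_{2k}^{24}$, $M(c)=\bigotimes_{i=1}^{24}V_{c_i\alpha/2k+L}$. For $c\in\mathbb{Z}_2^{24}$, $M(c)^+=\bigoplus_{e_i\in\{\pm\},\prod e_i=+}\bigotimes_{i=1}^{24}V_{c_i\alpha/2+L}^{e_i}$ and $M^T(c)^-=\bigoplus_{e_i\in\{\pm\},\prod e_i=-}\bigotimes_{i=1}^{24}V_L^{T_{c_i},e_i}$. Since $M(c)\cong M(-c)$, $\frac12\bigoplus_{c\in C\setminus C_2}M(c)$ means one summand for each pair $\{c,-c\}$. Moonshine module. $\Lambda$ is the Leech lattice, $\mathfrak h=\mathbb{C}\otimes_{\mathbb{Z}}\Lambda$, $\hat\Lambda$ the central extension of $\Lambda$ by $\langle-1\rangle\cong\mathbb{Z}_2$ with commutator map $\langle\beta,\gamma\rangle+2\mathbb{Z}$, $\theta_\Lambda(a)=a^{-1}(-1)^{\langle\bar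 a,\bar a\rangle/2}$, $K_\Lambda=\{\theta_\Lambda(a)a^{-1}\}$, $T$ the unique irreducible $\hat\Lambda/K_\Lambda$-module on which $-K_\Lambda$ acts by $-1$ ($\dim T=2^{12}$). $V_\Lambda$ is the lattice VOA, $V_\Lambda^T=S(\mathfrak h\otimes t^{-1/2}\mathbb{C}[t^{-1}])\otimes T$. $V_\Lambda^+$ is the fixed-point subspace of the automorphism $\theta_{V_\Lambda}$ induced by $h(n)\mapsto-h(n)$ and $\theta_\Lambda$; $V_\Lambda^{T,+}$ is the fixed-point subspace of $\theta_{\mathfrak h}\otimes(-1_T)$, $\theta_{\mathfrak h}$ induced by $h(n)\mapsto-h(n)$. $V^\natural=V_\Lambda^+\oplus V_\Lambda^{T,+}$ is the Frenkel–Lepowsky–Meurman moonshine module. *)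

theory Defs
  imports
    "HOL-Analysis.Analysis"
    "HOL-Library.Function_Algebras"
    "HOL-Library.Groups_Big_Fun"
    "HOL-Library.Multiset"
    "HOL-Library.Z2"
    "HOL-Computational_Algebra.Formal_Laurent_Series"
begin

section \<open>Complex vector spaces of functions\<close>

text \<open>
  All vector spaces are subspaces of \<open>'i \<Rightarrow> complex\<close>, where \<open>'i\<close> indexes a basis of an ambient space;
  vectors have finite support, and \<open>single i\<close> is the basis vector of index \<open>i\<close>.
\<close>

definition cscale :: "complex \<Rightarrow> ('i \<Rightarrow> complex) \<Rightarrow> 'i \<Rightarrow> complex" where
  "cscale a f = (\<lambda>i. a * f i)"

interpretation cfun: vector_space cscale
  by unfold_locales (auto simp: cscale_def fun_eq_iff algebra_simps)

definition single :: "'i \<Rightarrow> 'i \<Rightarrow> complex" where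
  "single i = (\<lambda>j. if j = i then 1 else 0)"

definition lin_ext :: "('i \<Rightarrow> 'j \<Rightarrow> complex) \<Rightarrow> ('i \<Rightarrow> complex) \<Rightarrow> 'j \<Rightarrow> complex" where
  "lin_ext F v = (\<Sum>i | v i \<noteq> 0. cscale (v i) (F i))"

definition lin_on :: "('i \<Rightarrow> complex) set \<Rightarrow> (('i \<Rightarrow> complex) \<Rightarrow> 'j \<Rightarrow> complex) \<Rightarrow> bool" where
  "lin_on W f \<longleftrightarrow> (\<forall>v\<in>W. \<forall>w\<in>W. f (v + w) = f v + f w) \<and> (\<forall>a. \<forall>v\<in>W. f (cscale a v) = cscale a (f v))"

definition trace_on :: "('i \<Rightarrow> complex) set \<Rightarrow> (('i \<Rightarrow> complex) \<Rightarrow> 'i \<Rightarrow> complex) \<Rightarrow> complex" where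
  "trace_on W f =
     (let B = (SOME B. B \<subseteq> W \<and> cfun.independent B \<and> cfun.span B = W)
      in \<Sum>b\<in>B. cfun.representation B (f b) b)"


section \<open>Vertex operator algebras and modules\<close>

text \<open>\<open>vmode V u n\<close> is the coefficient \<open>u\<^sub>n\<close> in \<open>Y(u,z) = \<Sum>\<^sub>n u\<^sub>n z\<^bsup>-n-1\<^esup>\<close>.\<close>

record 'v voa =
  vcarrier :: "'v set"
  vmode :: "'v \<Rightarrow> int \<Rightarrow> 'v \<Rightarrow> 'v"
  vvac :: 'v
  vconf :: 'v

text \<open>The \<open>L(0)\<close>-eigenspaces, \<open>L(0)\<close> being the mode \<open>\<omega>\<^sub>1\<close>.\<close>

definition eigenspace :: "(('i \<Rightarrow> complex) \<Rightarrow> 'i \<Rightarrow> complex) \<Rightarrow> ('i \<Rightarrow> complex) set \<Rightarrow> complex \<Rightarrow> ('i \<Rightarrow> complex) set"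
  where "eigenspace f W a = {w \<in> W. f w = cscale a w}"

abbreviation weight_space :: "('i \<Rightarrow> complex) voa \<Rightarrow> int \<Rightarrow> ('i \<Rightarrow> complex) set" where
  "weight_space V n \<equiv> eigenspace (vmode V (vconf V) 1) (vcarrier V) (of_int n)"

definition is_voa :: "('i \<Rightarrow> complex) voa \<Rightarrow> bool" where
  "is_voa V \<longleftrightarrow>
    (let A = vcarrier V; Y = vmode V; L = (\<lambda>n. Y (vconf V) (n + 1)) in
     cfun.subspace A \<and> vvac V \<in> A \<and> vconf V \<in> A \<and>
     (\<forall>u\<in>A. \<forall>v\<in>A. \<forall>n. Y u n v \<in> A) \<and>
     (\<forall>u\<in>A. \<forall>n. lin_on A (Y u n)) \<and>
     (\<forall>v\<in>A. \<forall>n. lin_on A (\<lambda>u. Y u n v)) \<and>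
     (\<forall>u\<in>A. \<forall>v\<in>A. \<exists>N. \<forall>n\<ge>N. Y u n v = 0) \<and>
     (\<forall>v\<in>A. \<forall>n. Y (vvac V) n v = (if n = -1 then v else 0)) \<and>
     (\<forall>u\<in>A. Y u (-1) (vvac V) = u \<and> (\<forall>n\<ge>0. Y u n (vvac V) = 0)) \<and>
     \<comment> \<open>the Jacobi identity in its component (Borcherds) form\<close>
     (\<forall>u\<in>A. \<forall>v\<in>A. \<forall>w\<in>A. \<forall>l m n.
        Sum_any (\<lambda>i. cscale (of_int m gchoose i) (Y (Y u (l + int i) v) (m + n - int i) w)) =
        Sum_any (\<lambda>i. cscale ((-1) ^ i * (of_int l gchoose i))
          (Y u (l + m - int i) (Y v (n + int i) w)
            - cscale ((-1) powi l) (Y v (l + n - int i) (Y u (m + int i) w))))) \<and>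
     (\<exists>c. \<forall>m n. \<forall>v\<in>A. L m (L n v) - L n (L m v) =
        cscale (of_int (m - n)) (L (m + n) v)
          + (if m + n = 0 then cscale (of_int (m ^ 3 - m) / 12 * c) v else 0)) \<and>
     (\<forall>u\<in>A. \<forall>v\<in>A. \<forall>n. Y (L (-1) u) n v = cscale (- of_int n) (Y u (n - 1) v)) \<and>
     cfun.span (\<Union>n. weight_space V n) = A \<and>
     (\<forall>n. \<exists>B. finite B \<and> cfun.span B = weight_space V n) \<and>
     (\<exists>N. \<forall>n<N. weight_space V n = {0}))"

definition simple_voa :: "('i \<Rightarrow> complex) voa \<Rightarrow> bool" where
  "simple_voa V \<longleftrightarrow>
    (\<forall>I. cfun.subspace I \<and> I \<subseteq> vcarrier V \<and> (\<forall>u\<in>vcarrier V. \<forall>n. \<forall>v\<in>I. vmode V u n v \<in> I)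
       \<longrightarrow> I = {0} \<or> I = vcarrier V)"

text \<open>Vacuum and Virasoro element are preserved.\<close>

definition voa_embedding ::
    "('i \<Rightarrow> complex) voa \<Rightarrow> ('j \<Rightarrow> complex) voa \<Rightarrow> (('i \<Rightarrow> complex) \<Rightarrow> 'j \<Rightarrow> complex) \<Rightarrow> bool" where
  "voa_embedding U V f \<longleftrightarrow>
     lin_on (vcarrier U) f \<and> inj_on f (vcarrier U) \<and> f ` vcarrier U \<subseteq> vcarrier V \<and>
     (\<forall>u\<in>vcarrier U. \<forall>v\<in>vcarrier U. \<forall>n. f (vmode U u n v) = vmode V (f u) n (f v)) \<and>
     f (vvac U) = vvac V \<and> f (vconf U) = vconf V"

definition voa_aut :: "('i \<Rightarrow> complex) voa \<Rightarrow> (('i \<Rightarrow> complex) \<Rightarrow> 'i \<Rightarrow> complex) set" where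
  "voa_aut V = {g. voa_embedding V V g \<and> g ` vcarrier V = vcarrier V}"

definition aut_conj_class ::
    "('i \<Rightarrow> complex) voa \<Rightarrow> (('i \<Rightarrow> complex) \<Rightarrow> 'i \<Rightarrow> complex) \<Rightarrow> (('i \<Rightarrow> complex) \<Rightarrow> 'i \<Rightarrow> complex) set" where
  "aut_conj_class V s = {g \<in> voa_aut V. \<exists>h\<in>voa_aut V. \<forall>v\<in>vcarrier V. g (h v) = h (s v)}"

text \<open>
  Modules for a VOA with carrier \<open>A\<close> are pairs of an action \<open>act\<close> (by modes) and a carrier \<open>W\<close>.
\<close>

definition module_iso ::
    "'v set \<Rightarrow> ('v \<Rightarrow> int \<Rightarrow> ('i \<Rightarrow> complex) \<Rightarrow> 'i \<Rightarrow> complex) \<Rightarrow> ('i \<Rightarrow> complex) set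
      \<Rightarrow> ('v \<Rightarrow> int \<Rightarrow> ('j \<Rightarrow> complex) \<Rightarrow> 'j \<Rightarrow> complex) \<Rightarrow> ('j \<Rightarrow> complex) set \<Rightarrow> bool" where
  "module_iso A act W act' W' \<longleftrightarrow>
     (\<exists>f. lin_on W f \<and> bij_betw f W W' \<and>
          (\<forall>a\<in>A. \<forall>n. \<forall>w\<in>W. f (act a n w) = act' a n (f w)))"

definition submodule ::
    "'v set \<Rightarrow> ('v \<Rightarrow> int \<Rightarrow> ('i \<Rightarrow> complex) \<Rightarrow> 'i \<Rightarrow> complex) \<Rightarrow> ('i \<Rightarrow> complex) set
      \<Rightarrow> ('i \<Rightarrow> complex) set \<Rightarrow> bool" where
  "submodule A act W N \<longleftrightarrow> cfun.subspace N \<and> N \<subseteq> W \<and> (\<forall>a\<in>A. \<forall>n. \<forall>w\<in>N. act a n w \<in> N)"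

text \<open>External direct sum over a finite index set.\<close>

definition dsum :: "'j set \<Rightarrow> ('j \<Rightarrow> ('i \<Rightarrow> complex) set) \<Rightarrow> ('j \<times> 'i \<Rightarrow> complex) set" where
  "dsum J W = {f. \<forall>j. if j \<in> J then (\<lambda>x. f (j, x)) \<in> W j else (\<lambda>x. f (j, x)) = 0}"

definition dsum_act ::
    "('v \<Rightarrow> int \<Rightarrow> ('i \<Rightarrow> complex) \<Rightarrow> 'i \<Rightarrow> complex)
      \<Rightarrow> 'v \<Rightarrow> int \<Rightarrow> ('j \<times> 'i \<Rightarrow> complex) \<Rightarrow> 'j \<times> 'i \<Rightarrow> complex" where
  "dsum_act act a n f = (\<lambda>(j, x). act a n (\<lambda>y. f (j, y)) x)"

text \<open>
  Tensor products of subspaces of \<open>'i \<Rightarrow> complex\<close> are realised inside \<open>('n \<Rightarrow> 'i) \<Rightarrow> complex\<close>.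
  In \<open>tensor_mode\<close> the coefficient of \<open>z\<^bsup>-p-1\<^esup>\<close> in \<open>Y(u\<^sub>1,z) w\<^sub>1 \<otimes> \<dots> \<otimes> Y(u\<^sub>n,z) w\<^sub>n\<close> is extended
  multilinearly from basis vectors.
\<close>

definition pure_tensor :: "('n::finite \<Rightarrow> 'i \<Rightarrow> complex) \<Rightarrow> ('n \<Rightarrow> 'i) \<Rightarrow> complex" where
  "pure_tensor w = (\<lambda>f. \<Prod>i\<in>UNIV. w i (f i))"

definition tensor :: "('n::finite \<Rightarrow> ('i \<Rightarrow> complex) set) \<Rightarrow> (('n \<Rightarrow> 'i) \<Rightarrow> complex) set" where
  "tensor W = cfun.span {pure_tensor w | w. \<forall>i. w i \<in> W i}"

definition tensor_mode ::
    "(('i \<Rightarrow> complex) \<Rightarrow> int \<Rightarrow> ('j \<Rightarrow> complex) \<Rightarrow> 'j \<Rightarrow> complex)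
      \<Rightarrow> (('n::finite \<Rightarrow> 'i) \<Rightarrow> complex) \<Rightarrow> int \<Rightarrow> (('n \<Rightarrow> 'j) \<Rightarrow> complex) \<Rightarrow> ('n \<Rightarrow> 'j) \<Rightarrow> complex" where
  "tensor_mode Y u p w =
     lin_ext (\<lambda>f. lin_ext (\<lambda>g.
       Sum_any (\<lambda>\<nu>. if (\<Sum>i\<in>UNIV. \<nu> i + 1) = p + 1
                    then pure_tensor (\<lambda>i. Y (single (f i)) (\<nu> i) (single (g i))) else 0)) w) u"

definition tensor_power_voa :: "('i \<Rightarrow> complex) voa \<Rightarrow> (('n::finite \<Rightarrow> 'i) \<Rightarrow> complex) voa" where
  "tensor_power_voa V =
     \<lparr>vcarrier = tensor (\<lambda>_. vcarrier V),
      vmode = tensor_mode (vmode V),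
      vvac = pure_tensor (\<lambda>_. vvac V),
      vconf = (\<Sum>i\<in>UNIV. pure_tensor (\<lambda>j. if j = i then vconf V else vvac V))\<rparr>"


section \<open>Lattice vertex operators, untwisted and twisted\<close>

text \<open>
  \<open>'a\<close> is the Euclidean space spanned by the lattice, and \<open>Basis\<close> is used as an orthonormal basis of
  its complexification. A pair \<open>(b, n)\<close> with \<open>n > 0\<close> in a multiset stands for the factor \<open>b(-n)\<close>:
  \<open>Unt M \<gamma>\<close> is the vector \<open>(\<Prod>\<^bsub>(b,n)\<in>M\<^esub> b(-n)) \<otimes> e\<^sup>\<gamma>\<close> and \<open>Tw M t\<close> is the vector
  \<open>(\<Prod>\<^bsub>(b,n)\<in>M\<^esub> b(-n)) \<otimes> t\<close>, with \<open>n\<close> integral in the first and half-integral in the second case;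
  \<open>'t\<close> indexes a basis of the finite-dimensional factor of the twisted module.
\<close>

datatype ('a, 't) fock = Unt "('a \<times> real) multiset" 'a | Tw "('a \<times> real) multiset" 't

type_synonym ('a, 't) fvec = "('a, 't) fock \<Rightarrow> complex"

fun fmodes :: "('a, 't) fock \<Rightarrow> ('a \<times> real) multiset" where
  "fmodes (Unt M _) = M"
| "fmodes (Tw M _) = M"

fun map_modes :: "(('a \<times> real) multiset \<Rightarrow> ('a \<times> real) multiset) \<Rightarrow> ('a, 't) fock \<Rightarrow> ('a, 't) fock" where
  "map_modes f (Unt M \<gamma>) = Unt (f M) \<gamma>"
| "map_modes f (Tw M t) = Tw (f M) t"

text \<open>The oscillator modes lie in \<open>sector x + \<int>\<close>.\<close>

fun sector :: "('a, 't) fock \<Rightarrow> real" where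
  "sector (Unt _ _) = 0"
| "sector (Tw _ _) = 1 / 2"

definition lattice_space :: "'a::euclidean_space set \<Rightarrow> ('a, 't) fvec set" where
  "lattice_space X = {v. finite {x. v x \<noteq> 0} \<and>
     (\<forall>x. v x \<noteq> 0 \<longrightarrow>
       (\<exists>M \<gamma>. x = Unt M \<gamma> \<and> \<gamma> \<in> X \<and> (\<forall>(b, n)\<in>#M. b \<in> Basis \<and> n \<in> \<nat> \<and> n > 0)))}"

definition twisted_space :: "'t set \<Rightarrow> ('a::euclidean_space, 't) fvec set" where
  "twisted_space J = {v. finite {x. v x \<noteq> 0} \<and>
     (\<forall>x. v x \<noteq> 0 \<longrightarrow>
       (\<exists>M t. x = Tw M t \<and> t \<in> J \<and> (\<forall>(b, n)\<in>#M. b \<in> Basis \<and> n - 1 / 2 \<in> \<nat>)))}"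

text \<open>\<open>osc b n\<close> is \<open>b(n)\<close>: multiplication for \<open>n < 0\<close>, \<open>n \<partial>/\<partial>b(-n)\<close> for \<open>n > 0\<close>.\<close>

definition osc :: "'a::euclidean_space \<Rightarrow> real \<Rightarrow> ('a, 't) fvec \<Rightarrow> ('a, 't) fvec" where
  "osc b n = lin_ext (\<lambda>x.
     if n < 0 then single (map_modes (add_mset (b, - n)) x)
     else if n > 0 then
       cscale (of_real (n * real (count (fmodes x) (b, n)))) (single (map_modes (\<lambda>M. M - {#(b, n)#}) x))
     else (case x of Unt M \<gamma> \<Rightarrow> cscale (of_real (b \<bullet> \<gamma>)) (single x) | Tw M t \<Rightarrow> 0))"

definition hosc :: "'a::euclidean_space \<Rightarrow> real \<Rightarrow> ('a, 't) fvec \<Rightarrow> ('a, 't) fvec" where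
  "hosc h n w = (\<Sum>b\<in>Basis. cscale (of_real (h \<bullet> b)) (osc b n w))"

text \<open>
  Power series with operator coefficients. \<open>op_exp F\<close> is \<open>exp F\<close> for a series with \<open>F 0 = 0\<close>,
  for which the \<open>r\<close>-th power has no coefficients below degree \<open>r\<close>.
\<close>

primrec op_pow :: "(nat \<Rightarrow> ('i \<Rightarrow> complex) \<Rightarrow> 'i \<Rightarrow> complex) \<Rightarrow> nat \<Rightarrow> nat \<Rightarrow> ('i \<Rightarrow> complex) \<Rightarrow> 'i \<Rightarrow> complex" where
  "op_pow F 0 j w = (if j = 0 then w else 0)"
| "op_pow F (Suc r) j w = (\<Sum>i\<le>j. F i (op_pow F r (j - i) w))"

definition op_exp :: "(nat \<Rightarrow> ('i \<Rightarrow> complex) \<Rightarrow> 'i \<Rightarrow> complex) \<Rightarrow> nat \<Rightarrow> ('i \<Rightarrow> complex) \<Rightarrow> 'i \<Rightarrow> complex" where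
  "op_exp F j w = (\<Sum>r\<le>j. cscale (1 / fact r) (op_pow F r j w))"

text \<open>
  \<open>exp_minus s \<beta> j\<close> is the coefficient of \<open>z\<^bsup>j/2\<^esup>\<close> in \<open>exp (\<Sum>\<^bsub>n > 0\<^esub> \<beta>(-n) z\<^sup>n / n)\<close> and
  \<open>exp_plus s \<beta> j\<close> that of \<open>z\<^bsup>-j/2\<^esup>\<close> in \<open>exp (- \<Sum>\<^bsub>n > 0\<^esub> \<beta>(n) z\<^bsup>-n\<^esup> / n)\<close>, with \<open>n \<in> s + \<int>\<close>.
\<close>

definition exp_minus :: "real \<Rightarrow> 'a::euclidean_space \<Rightarrow> nat \<Rightarrow> ('a, 't) fvec \<Rightarrow> ('a, 't) fvec" where
  "exp_minus s \<beta> = op_exp (\<lambda>j w.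
     if j > 0 \<and> real j / 2 - s \<in> \<int> then cscale (of_real (2 / real j)) (hosc \<beta> (- (real j / 2)) w) else 0)"

definition exp_plus :: "real \<Rightarrow> 'a::euclidean_space \<Rightarrow> nat \<Rightarrow> ('a, 't) fvec \<Rightarrow> ('a, 't) fvec" where
  "exp_plus s \<beta> = op_exp (\<lambda>j w.
     if j > 0 \<and> real j / 2 - s \<in> \<int> then cscale (of_real (- (2 / real j))) (hosc \<beta> (real j / 2) w) else 0)"

text \<open>
  The parameters \<open>\<epsilon>\<close> and \<open>R\<close> describe the (twisted) group algebra, \<open>e\<^sup>\<beta> e\<^sup>\<gamma> = \<epsilon> \<beta> \<gamma> e\<^bsup>\<beta>+\<gamma>\<^esup>\<close>, and its action
  on the factor \<open>'t \<Rightarrow> complex\<close> of the twisted module. \<open>exp_field \<epsilon> R \<beta> x\<close> is the coefficient of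
  \<open>z\<^sup>x\<close> in the untwisted operator \<open>exp(\<dots>) exp(\<dots>) e\<^sup>\<beta> z\<^sup>\<beta>\<close>, respectively in the twisted operator
  \<open>2\<^bsup>-\<langle>\<beta>,\<beta>\<rangle>\<^esup> exp(\<dots>) exp(\<dots>) e\<^sup>\<beta> z\<^bsup>-\<langle>\<beta>,\<beta>\<rangle>/2\<^esup>\<close>.
\<close>

definition group_act ::
    "('a::euclidean_space \<Rightarrow> 'a \<Rightarrow> complex) \<Rightarrow> ('a \<Rightarrow> ('t \<Rightarrow> complex) \<Rightarrow> 't \<Rightarrow> complex)
      \<Rightarrow> 'a \<Rightarrow> ('a, 't) fock \<Rightarrow> ('a, 't) fvec" where
  "group_act \<epsilon> R \<beta> x = (case x of
      Unt M \<gamma> \<Rightarrow> cscale (\<epsilon> \<beta> \<gamma>) (single (Unt M (\<beta> + \<gamma>)))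
    | Tw M t \<Rightarrow> cscale (of_real (2 powr (- (\<beta> \<bullet> \<beta>)))) (lin_ext (\<lambda>t'. single (Tw M t')) (R \<beta> (single t))))"

definition zpower :: "'a::euclidean_space \<Rightarrow> ('a, 't) fock \<Rightarrow> real" where
  "zpower \<beta> x = (case x of Unt M \<gamma> \<Rightarrow> \<beta> \<bullet> \<gamma> | Tw M t \<Rightarrow> - (\<beta> \<bullet> \<beta>) / 2)"

definition exp_field ::
    "('a::euclidean_space \<Rightarrow> 'a \<Rightarrow> complex) \<Rightarrow> ('a \<Rightarrow> ('t \<Rightarrow> complex) \<Rightarrow> 't \<Rightarrow> complex)
      \<Rightarrow> 'a \<Rightarrow> real \<Rightarrow> ('a, 't) fvec \<Rightarrow> ('a, 't) fvec" where
  "exp_field \<epsilon> R \<beta> x = lin_ext (\<lambda>y. Sum_any (\<lambda>(i, j).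
     if real i / 2 - real j / 2 + zpower \<beta> y = x
     then exp_minus (sector y) \<beta> i (exp_plus (sector y) \<beta> j (group_act \<epsilon> R \<beta> y)) else 0))"

text \<open>
  The normally ordered product of \<open>1/(n-1)! (d/dz)\<^bsup>n-1\<^esup> b(z)\<close>, where \<open>b(z) = \<Sum>\<^bsub>m\<in>s+\<int>\<^esub> b(m) z\<^bsup>-m-1\<^esup>\<close>,
  with a field \<open>\<Phi>\<close>; the field is given by its coefficients of the powers \<open>z\<^sup>x\<close>.
\<close>

definition normal_ordered ::
    "real \<Rightarrow> 'a::euclidean_space \<times> real \<Rightarrow> (real \<Rightarrow> ('a, 't) fvec \<Rightarrow> ('a, 't) fvec)
      \<Rightarrow> real \<Rightarrow> ('a, 't) fvec \<Rightarrow> ('a, 't) fvec" where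
  "normal_ordered s bn \<Phi> x w = (case bn of (b, n) \<Rightarrow>
     Sum_any (\<lambda>l::int. let m = of_int l + s in
       cscale (of_real ((- m - 1) gchoose (nat \<lfloor>n\<rfloor> - 1)))
         (if m < 0 then osc b m (\<Phi> (x + m + n) w) else \<Phi> (x + m + n) (osc b m w))))"

text \<open>
  \<open>vertex_coeff \<epsilon> R v x\<close> is the coefficient of \<open>z\<^sup>x\<close> in the normally ordered vertex operator of \<open>v\<close>.
  As the creation operators commute among themselves, and the other operators too, the result
  does not depend on the enumeration \<open>bs\<close> of the multiset.
\<close>

definition vertex_coeff ::
    "('a::euclidean_space \<Rightarrow> 'a \<Rightarrow> complex) \<Rightarrow> ('a \<Rightarrow> ('t \<Rightarrow> complex) \<Rightarrow> 't \<Rightarrow> complex)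
      \<Rightarrow> ('a, 't) fvec \<Rightarrow> real \<Rightarrow> ('a, 't) fvec \<Rightarrow> ('a, 't) fvec" where
  "vertex_coeff \<epsilon> R v x w = lin_ext (\<lambda>u. case u of
      Unt M \<beta> \<Rightarrow> (let bs = (SOME bs. mset bs = M) in
         lin_ext (\<lambda>y. foldr (normal_ordered (sector y)) bs (exp_field \<epsilon> R \<beta>) x (single y)) w)
    | Tw M t \<Rightarrow> 0) v"

text \<open>
  Frenkel, Lepowsky and Meurman's correction \<open>exp \<Delta>\<^sub>z\<close> of the twisted vertex operators:
  \<open>\<Delta>\<^sub>z = \<Sum>\<^bsub>m,n\<ge>0\<^esub> c\<^bsub>mn\<^esub> \<Sum>\<^sub>b b(m) b(n) z\<^bsup>-m-n\<^esup>\<close>, where the \<open>c\<^bsub>mn\<^esub>\<close> are the Taylor coefficients of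
  \<open>- log (((1+x)\<^bsup>1/2\<^esup> + (1+y)\<^bsup>1/2\<^esup>) / 2)\<close>; \<open>\<Delta>\<^sub>z\<close> has no constant term because \<open>c\<^bsub>00\<^esub> = 0\<close>.
\<close>

definition delta_coeff :: "nat \<Rightarrow> nat \<Rightarrow> real" where
  "delta_coeff m n =
     (deriv ^^ m) (\<lambda>x. (deriv ^^ n) (\<lambda>y. - ln ((sqrt (1 + x) + sqrt (1 + y)) / 2)) 0) 0 / (fact m * fact n)"

definition delta_op :: "nat \<Rightarrow> ('a::euclidean_space, 't) fvec \<Rightarrow> ('a, 't) fvec" where
  "delta_op j v = (\<Sum>m\<le>j. \<Sum>b\<in>Basis.
     cscale (of_real (delta_coeff m (j - m))) (osc b (real m) (osc b (real (j - m)) v)))"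

text \<open>
  \<open>fock_mode \<epsilon> R v p w\<close> is the coefficient of \<open>z\<^bsup>-p-1\<^esup>\<close> in \<open>Y(v,z) w\<close>, for \<open>v\<close> in a lattice VOA and \<open>w\<close> in
  a sum of untwisted and twisted modules. On the twisted modules \<open>Y(v,z)\<close> has integral powers of
  \<open>z\<close> only when \<open>v\<close> is fixed by the lift of \<open>-1\<close>.
\<close>

definition fock_mode ::
    "('a::euclidean_space \<Rightarrow> 'a \<Rightarrow> complex) \<Rightarrow> ('a \<Rightarrow> ('t \<Rightarrow> complex) \<Rightarrow> 't \<Rightarrow> complex)
      \<Rightarrow> ('a, 't) fvec \<Rightarrow> int \<Rightarrow> ('a, 't) fvec \<Rightarrow> ('a, 't) fvec" where
  "fock_mode \<epsilon> R v p w = lin_ext (\<lambda>y. case y of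
      Unt M \<gamma> \<Rightarrow> vertex_coeff \<epsilon> R v (- of_int p - 1) (single y)
    | Tw M t \<Rightarrow> Sum_any (\<lambda>r::nat. vertex_coeff \<epsilon> R (op_exp delta_op r v) (- of_int p - 1 + real r) (single y))) w"

definition fock_vac :: "('a::euclidean_space, 't) fvec" where
  "fock_vac = single (Unt {#} 0)"

definition fock_conf :: "('a::euclidean_space, 't) fvec" where
  "fock_conf = cscale (1 / 2) (\<Sum>b\<in>Basis. single (Unt {#(b, 1), (b, 1)#} 0))"

text \<open>
  The map induced by \<open>h(n) \<mapsto> - h(n)\<close>, \<open>e\<^sup>\<gamma> \<mapsto> f(\<gamma>) e\<^bsup>-\<gamma>\<^esup>\<close>, and the scalar \<open>s\<close> on the factor \<open>'t \<Rightarrow> complex\<close>.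
\<close>

definition theta :: "('a::euclidean_space \<Rightarrow> complex) \<Rightarrow> complex \<Rightarrow> ('a, 't) fvec \<Rightarrow> ('a, 't) fvec" where
  "theta f s = lin_ext (\<lambda>x. case x of
      Unt M \<gamma> \<Rightarrow> cscale ((-1) ^ size M * f \<gamma>) (single (Unt M (- \<gamma>)))
    | Tw M t \<Rightarrow> cscale ((-1) ^ size M * s) (single (Tw M t)))"


section \<open>The VOA \<open>V\<^sub>L\<^sup>+\<close> for \<open>L = \<int>\<alpha>\<close>, \<open>\<langle>\<alpha>,\<alpha>\<rangle> = 2k\<close>, and its modules\<close>

definition alpha :: "nat \<Rightarrow> real" where
  "alpha k = sqrt (2 * real k)"

text \<open>The coset \<open>r\<alpha>/2k + L\<close>; in particular \<open>rank1_coset k 0 = L\<close> and \<open>rank1_coset k k = \<alpha>/2 + L\<close>.\<close>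

definition rank1_coset :: "nat \<Rightarrow> int \<Rightarrow> real set" where
  "rank1_coset k r = {of_int r * alpha k / (2 * real k) + of_int j * alpha k | j. True}"

definition rho_hom :: "nat \<Rightarrow> (real \<Rightarrow> complex) \<Rightarrow> bool" where
  "rho_hom k \<rho> \<longleftrightarrow>
     (let L = rank1_coset k 0 in
      (\<forall>\<mu>\<in>L. \<rho> \<mu> \<noteq> 0) \<and> (\<forall>\<mu>\<in>L. \<forall>\<nu>\<in>L. \<rho> (\<mu> + \<nu>) = \<rho> \<mu> * \<rho> \<nu>) \<and>
      (\<forall>\<mu>\<in>L. \<rho> (2 * \<mu>) = (-1) powi \<lfloor>(\<mu> \<bullet> \<mu>) / 2\<rfloor>))"

definition bsgn :: "bit \<Rightarrow> complex" where
  "bsgn t = (if t = 0 then 1 else -1)"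

definition psgn :: "bool \<Rightarrow> complex" where
  "psgn e = (if e then 1 else -1)"

text \<open>
  \<open>T\<^sub>0\<close> and \<open>T\<^sub>1\<close> are the two coordinate lines of \<open>bit \<Rightarrow> complex\<close>, on which \<open>e\<^bsup>j\<alpha>\<^esup> = (e\<^sup>\<alpha>)\<^sup>j\<close> acts.
\<close>

definition rank1_rep :: "nat \<Rightarrow> (real \<Rightarrow> complex) \<Rightarrow> real \<Rightarrow> (bit \<Rightarrow> complex) \<Rightarrow> bit \<Rightarrow> complex" where
  "rank1_rep k \<rho> \<beta> x = (\<lambda>t. (bsgn t * \<rho> (alpha k)) powi \<lfloor>\<beta> / alpha k\<rfloor> * x t)"

definition rank1_mode :: "nat \<Rightarrow> (real \<Rightarrow> complex) \<Rightarrow> (real, bit) fvec \<Rightarrow> int \<Rightarrow> (real, bit) fvec \<Rightarrow> (real, bit) fvec" where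
  "rank1_mode k \<rho> = fock_mode (\<lambda>_ _. 1) (rank1_rep k \<rho>)"

text \<open>
  On \<open>V\<^sub>L\<close> this is the automorphism \<open>\<theta>\<close>. On \<open>V\<^bsub>\<alpha>/2+L\<^esub>\<close> the condition \<open>\<theta>(Y(v,z)w) = Y(\<theta>v,z)\<theta>w\<close> for
  \<open>v = \<alpha>(-1)\<one>\<close> and \<open>v = e\<^bsup>j\<alpha>\<^esup>\<close> together with \<open>\<theta>(e\<^bsup>\<alpha>/2\<^esup>) = \<rho>(\<alpha>) e\<^bsup>-\<alpha>/2\<^esup>\<close> forces
  \<open>\<theta>(e\<^bsup>\<alpha>/2+j\<alpha>\<^esup>) = \<rho>(2j\<alpha>) \<rho>(\<alpha>) e\<^bsup>-\<alpha>/2-j\<alpha>\<^esup>\<close>, so the same formula applies.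
\<close>

definition rank1_theta :: "(real \<Rightarrow> complex) \<Rightarrow> (real, bit) fvec \<Rightarrow> (real, bit) fvec" where
  "rank1_theta \<rho> = theta (\<lambda>\<gamma>. \<rho> (2 * \<gamma>)) 1"

definition V_coset :: "nat \<Rightarrow> int \<Rightarrow> (real, bit) fvec set" where
  "V_coset k r = lattice_space (rank1_coset k r)"

text \<open>\<open>V_pm k \<rho> r e\<close> is \<open>V\<^sub>L\<^sup>\<plusminus>\<close> for \<open>r = 0\<close> and \<open>V\<^bsub>\<alpha>/2+L\<^esub>\<^sup>\<plusminus>\<close> for \<open>r = k\<close>; the sign is \<open>+\<close> iff \<open>e\<close>.\<close>

definition V_pm :: "nat \<Rightarrow> (real \<Rightarrow> complex) \<Rightarrow> int \<Rightarrow> bool \<Rightarrow> (real, bit) fvec set" where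
  "V_pm k \<rho> r e = eigenspace (rank1_theta \<rho>) (V_coset k r) (psgn e)"

definition VT_pm :: "(real \<Rightarrow> complex) \<Rightarrow> bit \<Rightarrow> bool \<Rightarrow> (real, bit) fvec set" where
  "VT_pm \<rho> t e = eigenspace (rank1_theta \<rho>) (twisted_space {t}) (psgn e)"

definition VLplus :: "nat \<Rightarrow> (real \<Rightarrow> complex) \<Rightarrow> (real, bit) fvec voa" where
  "VLplus k \<rho> = \<lparr>vcarrier = V_pm k \<rho> 0 True, vmode = rank1_mode k \<rho>, vvac = fock_vac, vconf = fock_conf\<rparr>"

datatype irrep = IrrL bool | IrrHalf bool | IrrCoset nat | IrrTw bit bool

definition irreps :: "nat \<Rightarrow> irrep set" where
  "irreps k = range IrrL \<union> range IrrHalf \<union> IrrCoset ` {1..k - 1} \<union> {IrrTw t e | t e. True}"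

fun irr_space :: "nat \<Rightarrow> (real \<Rightarrow> complex) \<Rightarrow> irrep \<Rightarrow> (real, bit) fvec set" where
  "irr_space k \<rho> (IrrL e) = V_pm k \<rho> 0 e"
| "irr_space k \<rho> (IrrHalf e) = V_pm k \<rho> (int k) e"
| "irr_space k \<rho> (IrrCoset r) = V_coset k (int r)"
| "irr_space k \<rho> (IrrTw t e) = VT_pm \<rho> t e"

text \<open>For \<open>k\<close> odd; \<open>IrrCoset r\<close> is \<open>V\<^bsub>j\<alpha>/k+L\<^esub>\<close> for \<open>r = 2j\<close> and \<open>V\<^bsub>(2j-1)\<alpha>/2k+L\<^esub>\<close> for \<open>r = 2j-1\<close>.\<close>

fun mu :: "irrep \<Rightarrow> complex" where
  "mu (IrrL e) = 1"
| "mu (IrrHalf e) = -1"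
| "mu (IrrCoset r) = (if even r then 1 else -1)"
| "mu (IrrTw t e) = (if t = 0 then \<i> else - \<i>)"


section \<open>The defining properties of \<open>\<theta>\<close> on \<open>V\<^sub>L\<close> and \<open>V\<^bsub>\<alpha>/2+L\<^esub>\<close>\<close>

text \<open>
  \<open>rank1_theta_mode\<close> and \<open>rank1_theta_half\<close> at the end of this section state that \<open>rank1_theta \<rho>\<close>
  satisfies \<open>\<theta>(Y(v,z)w) = Y(\<theta>v,z)\<theta>w\<close> on both modules and \<open>\<theta>(e\<^bsup>\<alpha>/2\<^esup>) = \<rho>(\<alpha>) e\<^bsup>-\<alpha>/2\<^esup>\<close>.
\<close>

definition fin_supp :: "('i \<Rightarrow> complex) set" where
  "fin_supp = {w. finite {x. w x \<noteq> 0}}"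

lemma cscale_simps [simp]: "cscale a 0 = 0" "cscale 0 w = 0" "cscale 1 w = w"
  by (auto simp: cscale_def fun_eq_iff)

lemma lambda_zero [simp]: "(\<lambda>_. 0) = (0 :: 'i \<Rightarrow> complex)"
  by auto


lemma subspace_fin_supp: "cfun.subspace fin_supp"
  unfolding cfun.subspace_def fin_supp_def
proof (intro conjI ballI allI)
  fix v w :: "'i \<Rightarrow> complex"
  assume "v \<in> {w. finite {x. w x \<noteq> 0}}" "w \<in> {w. finite {x. w x \<noteq> 0}}"
  then have "finite ({x. v x \<noteq> 0} \<union> {x. w x \<noteq> 0})" by simp
  then show "v + w \<in> {w. finite {x. w x \<noteq> 0}}"
    unfolding mem_Collect_eq by (rule rev_finite_subset) auto
next
  fix a and w :: "'i \<Rightarrow> complex"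
  assume "w \<in> {w. finite {x. w x \<noteq> 0}}"
  then show "cscale a w \<in> {w. finite {x. w x \<noteq> 0}}"
    by (auto simp: cscale_def elim: rev_finite_subset)
qed simp

lemma lin_ext_superset:
  assumes "finite A" "{x. v x \<noteq> 0} \<subseteq> A"
  shows "lin_ext F v = (\<Sum>x\<in>A. cscale (v x) (F x))"
  unfolding lin_ext_def using assms by (intro sum.mono_neutral_left) auto

lemma lin_ext_single [simp]: "lin_ext F (single x) = F x"
proof -
  have "{y. single x y \<noteq> 0} = {x}" by (auto simp: single_def)
  then show ?thesis by (simp add: lin_ext_def) (simp add: single_def)
qed

lemma lin_ext_cscale: "lin_ext F (cscale a v) = cscale a (lin_ext F v)"
proof (cases "a = 0")
  case True then show ?thesis by (simp add: lin_ext_def)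
next
  case False
  then have "{x. cscale a v x \<noteq> 0} = {x. v x \<noteq> 0}" by (auto simp: cscale_def)
  then show ?thesis
    by (simp add: lin_ext_def cfun.scale_sum_right) (simp add: cscale_def mult.assoc)
qed

lemma lin_ext_add:
  assumes "v \<in> fin_supp" "w \<in> fin_supp"
  shows "lin_ext F (v + w) = lin_ext F v + lin_ext F w"
proof -
  let ?A = "{x. v x \<noteq> 0} \<union> {x. w x \<noteq> 0}"
  have "finite ?A" using assms by (simp add: fin_supp_def)
  moreover have "{x. (v + w) x \<noteq> 0} \<subseteq> ?A" by auto
  ultimately show ?thesis
    by (simp add: lin_ext_superset[of ?A] cfun.scale_left_distrib sum.distrib)
qed

lemma expansion: fixes w :: "'a \<Rightarrow> complex" shows "w \<in> fin_supp \<Longrightarrow> w = (\<Sum>x | w x \<noteq> 0. cscale (w x) (single x))"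
proof (rule ext)
  fix y :: 'a assume "w \<in> fin_supp"
  then have f: "finite {x. w x \<noteq> 0}" by (simp add: fin_supp_def)
  have sm: "(\<Sum>x\<in>A. h x) y = (\<Sum>x\<in>A. h x y)" if "finite A" for A and h :: "_ \<Rightarrow> _ \<Rightarrow> complex"
    using that by (induction A rule: finite_induct) auto
  show "w y = (\<Sum>x | w x \<noteq> 0. cscale (w x) (single x)) y"
    using f by (simp add: sm cscale_def single_def if_distrib[of "(*) _"] sum.delta' cong: if_cong)
qed

lemma lin_ext_sum:
  assumes "finite A" "\<And>x. x \<in> A \<Longrightarrow> h x \<in> fin_supp"
  shows "lin_ext F (sum h A) = (\<Sum>x\<in>A. lin_ext F (h x))"
  using assms
proof (induction A rule: finite_induct)
  case empty then show ?case by (simp add: lin_ext_def)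
next
  case (insert x A)
  have "sum h A \<in> fin_supp" using insert by (intro cfun.subspace_sum[OF subspace_fin_supp]) auto
  then have "lin_ext F (h x + sum h A) = lin_ext F (h x) + lin_ext F (sum h A)"
    using insert by (intro lin_ext_add) auto
  with insert show ?case by (simp del: plus_fun_apply)
qed

text \<open>Vectors in the untwisted sector with momenta in \<open>X\<close>.\<close>

definition usp :: "'a set \<Rightarrow> ('a, 't) fvec set" where
  "usp X = {w \<in> fin_supp. \<forall>x. w x \<noteq> 0 \<longrightarrow> (\<exists>M \<gamma>. x = Unt M \<gamma> \<and> \<gamma> \<in> X)}"

lemma subspace_usp: "cfun.subspace (usp X)"
  using subspace_fin_supp unfolding cfun.subspace_def usp_def
  by (auto simp: cscale_def) (metis add.right_neutral)

lemma usp_single [simp]: "single (Unt M \<gamma>) \<in> usp X \<longleftrightarrow> \<gamma> \<in> X"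
  by (auto simp: usp_def fin_supp_def single_def)

lemma usp_fin: "w \<in> usp X \<Longrightarrow> w \<in> fin_supp"
  by (simp add: usp_def)

lemmas usp_intros = cfun.subspace_add[OF subspace_usp] cfun.subspace_scale[OF subspace_usp]
  cfun.subspace_sum[OF subspace_usp] cfun.subspace_0[OF subspace_usp]

lemma Sum_any_usp: "(\<And>l. F l \<in> usp X) \<Longrightarrow> Sum_any F \<in> usp X"
  unfolding Sum_any.expand_set by (intro usp_intros)

lemma lin_ext_usp:
  assumes "w \<in> usp X" "\<And>M \<gamma>. \<gamma> \<in> X \<Longrightarrow> F (Unt M \<gamma>) \<in> usp Y"
  shows "lin_ext F w \<in> usp Y"
  unfolding lin_ext_def using assms by (intro usp_intros) (auto simp: usp_def)

lemma usp_induct [consumes 1, case_names single add scale zero]: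
  assumes "w \<in> usp X"
    and s: "\<And>M \<gamma>. \<gamma> \<in> X \<Longrightarrow> P (single (Unt M \<gamma>))"
    and a: "\<And>v w. v \<in> usp X \<Longrightarrow> w \<in> usp X \<Longrightarrow> P v \<Longrightarrow> P w \<Longrightarrow> P (v + w)"
    and c: "\<And>a w. w \<in> usp X \<Longrightarrow> P w \<Longrightarrow> P (cscale a w)"
    and z: "P 0"
  shows "P w"
proof -
  have w: "w \<in> fin_supp" using assms(1) by (rule usp_fin)
  have 1: "cscale (w x) (single x) \<in> usp X \<and> P (cscale (w x) (single x))" if nz: "w x \<noteq> 0" for x
  proof -
    obtain M \<gamma> where "x = Unt M \<gamma>" "\<gamma> \<in> X" using assms(1) nz unfolding usp_def by blast
    then show ?thesis by (auto intro!: usp_intros c s)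
  qed
  have "sum (\<lambda>x. cscale (w x) (single x)) A \<in> usp X \<and> P (sum (\<lambda>x. cscale (w x) (single x)) A)"
    if "finite A" "A \<subseteq> {x. w x \<noteq> 0}" for A
    using that
  proof (induction A rule: finite_induct)
    case empty then show ?case by (simp add: z usp_intros)
  next
    case (insert x A)
    then have "cscale (w x) (single x) \<in> usp X" "P (cscale (w x) (single x))"
      "sum (\<lambda>x. cscale (w x) (single x)) A \<in> usp X" "P (sum (\<lambda>x. cscale (w x) (single x)) A)"
      using 1[of x] by auto
    then show ?case unfolding sum.insert[OF insert(1,2)] by (intro conjI a usp_intros(1))
  qed
  from this[of "{x. w x \<noteq> 0}"] expansion[OF w] w show ?thesis by (simp add: fin_supp_def)
qed

lemma op_exp_cscale:
  assumes "\<And>j a w. F j (cscale a w) = cscale a (F j w)"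
  shows "op_exp F j (cscale a w) = cscale a (op_exp F j w)"
proof -
  have "op_pow F r j (cscale a w) = cscale a (op_pow F r j w)" for r j
    by (induction r arbitrary: j) (auto simp: assms cfun.scale_sum_right)
  then show ?thesis by (simp add: op_exp_def cfun.scale_sum_right mult.commute)
qed

locale theta_setup =
  fixes X :: "'a::euclidean_space set" and g :: "'a \<Rightarrow> complex" and s :: complex and th :: "('a, 't) fvec \<Rightarrow> ('a, 't) fvec"
  defines "th \<equiv> theta g s"
  assumes neg: "\<gamma> \<in> X \<Longrightarrow> - \<gamma> \<in> X" and g0: "\<gamma> \<in> X \<Longrightarrow> g \<gamma> \<noteq> 0"
begin

lemma th_single [simp]:
  "th (single (Unt M \<gamma>)) = cscale ((-1) ^ size M * g \<gamma>) (single (Unt M (- \<gamma>)))"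
  by (simp add: th_def theta_def)

lemma th_cscale: "th (cscale a w) = cscale a (th w)"
  by (simp add: th_def theta_def lin_ext_cscale)

lemma th_minus: "th (- w) = - th w"
proof -
  have "- w = cscale (-1) w" "- th w = cscale (-1) (th w)" for w by (auto simp: cscale_def fun_eq_iff)
  then show ?thesis by (metis th_cscale)
qed

lemma th_zero [simp]: "th 0 = 0"
  using th_cscale[of 0 0] by simp

lemma th_add: "v \<in> usp X \<Longrightarrow> w \<in> usp X \<Longrightarrow> th (v + w) = th v + th w"
  by (simp add: th_def theta_def lin_ext_add usp_fin)

lemma th_usp: "w \<in> usp X \<Longrightarrow> th w \<in> usp X"
  unfolding th_def theta_def by (erule lin_ext_usp) (auto intro!: usp_intros simp: neg)

lemma th_eval: 
  assumes "w \<in> usp X" 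
  shows "th w (Unt M (- \<gamma>)) = (-1) ^ size M * g \<gamma> * w (Unt M \<gamma>)"
  using assms
proof (induction rule: usp_induct)
  case (single M' \<gamma>')
  then show ?case by (auto simp: cscale_def) (auto simp: single_def)
next
  case (add v w)
  have "th (v + w) = th v + th w" using add by (intro th_add)
  with add show ?case unfolding plus_fun_apply distrib_left by (simp only: plus_fun_apply)
next
  case (scale a w) then show ?case by (simp add: th_cscale) (simp add: cscale_def)
qed simp

lemma th_eq_0: assumes "w \<in> usp X" shows "th w = 0 \<longleftrightarrow> w = 0"
proof
  assume z: "th w = 0"
  show "w = 0"
  proof (rule ext, rule ccontr)
    fix x assume "w x \<noteq> 0 x"
    then obtain M \<gamma> where x: "x = Unt M \<gamma>" "\<gamma> \<in> X" "w x \<noteq> 0" using assms by (auto simp: usp_def)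
    with th_eval[OF assms, of M \<gamma>] g0[of \<gamma>] z show False by auto
  qed
qed simp

lemma th_sum: "(\<And>x. x \<in> A \<Longrightarrow> h x \<in> usp X) \<Longrightarrow> th (sum h A) = (\<Sum>x\<in>A. th (h x))"
  by (induction A rule: infinite_finite_induct) (auto simp: th_add usp_intros)

lemma th_Sum_any: 
  assumes "\<And>l. F l \<in> usp X" shows "Sum_any (\<lambda>l. th (F l)) = th (Sum_any F)"
  unfolding Sum_any.expand_set by (simp add: th_eq_0 assms th_sum)

lemma osc_usp: "w \<in> usp X \<Longrightarrow> osc b n w \<in> usp X"
  unfolding osc_def by (erule lin_ext_usp) (auto intro!: usp_intros)

lemma osc_cscale: "osc b n (cscale a w) = cscale a (osc b n w)"
  by (simp add: osc_def lin_ext_cscale)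

lemma osc_add: "v \<in> usp X \<Longrightarrow> w \<in> usp X \<Longrightarrow> osc b n (v + w) = osc b n v + osc b n w"
  by (simp add: osc_def lin_ext_add usp_fin)

lemma osc_th: "w \<in> usp X \<Longrightarrow> osc b n (th w) = - th (osc b n w)"
proof (induction rule: usp_induct)
  case (single M \<gamma>)
  show ?case
  proof (cases "n > 0 \<and> (b, n) \<in># M")
    case True
    then have "size M = Suc (size (M - {#(b, n)#}))" by (simp add: size_Suc_Diff1)
    then show ?thesis using True
      unfolding th_single osc_cscale th_cscale
      by (simp add: osc_def th_cscale) (simp add: cscale_def fun_eq_iff)
  next
    case False
    then show ?thesis
      unfolding th_single osc_cscale th_cscale
      by (auto simp: osc_def th_cscale not_in_iff) (auto simp: cscale_def fun_eq_iff)
  qed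
next
  case (add v w)
  then have "osc b n (th (v + w)) = osc b n (th v) + osc b n (th w)"
    by (simp only: th_add osc_add th_usp)
  moreover have "th (osc b n (v + w)) = th (osc b n v) + th (osc b n w)"
    using add by (simp only: th_add osc_add osc_usp)
  ultimately show ?case using add by (simp only: minus_add_distrib)
next
  case (scale a w)
  then show ?case by (simp add: osc_cscale th_cscale) (simp add: cscale_def fun_eq_iff)
qed (simp add: osc_def lin_ext_def)

lemma hosc_usp: "w \<in> usp X \<Longrightarrow> hosc \<beta> n w \<in> usp X"
  unfolding hosc_def by (intro usp_intros osc_usp)

lemma hosc_th: "w \<in> usp X \<Longrightarrow> hosc (- \<beta>) n (th w) = th (hosc \<beta> n w)"
  unfolding hosc_def
  by (subst th_sum, intro usp_intros osc_usp, assumption)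
    (rule sum.cong, auto simp: osc_th th_cscale)

lemma op_pow_th:
  assumes F: "\<And>j w. w \<in> usp X \<Longrightarrow> F j w \<in> usp X" and G: "\<And>j w. w \<in> usp X \<Longrightarrow> G j (th w) = th (F j w)"
    and w: "w \<in> usp X"
  shows "op_pow F r j w \<in> usp X \<and> op_pow G r j (th w) = th (op_pow F r j w)"
proof (induction r arbitrary: j)
  case 0
  show ?case
    using w usp_intros(4)[where ?'b = 't, of X] th_zero by (simp del: zero_fun_apply)
next
  case (Suc r)
  then show ?case using w by (auto intro!: usp_intros F simp: th_sum F G)
qed

lemma op_exp_th:
  assumes "\<And>j w. w \<in> usp X \<Longrightarrow> F j w \<in> usp X" "\<And>j w. w \<in> usp X \<Longrightarrow> G j (th w) = th (F j w)" "w \<in> usp X"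
  shows "op_exp F j w \<in> usp X \<and> op_exp G j (th w) = th (op_exp F j w)"
proof -
  have [simp]: "(\<lambda>_. 0) = (0 :: ('a, 't) fvec)" by auto
  have P: "op_pow F r j w \<in> usp X" "op_pow G r j (th w) = th (op_pow F r j w)" for r j
    using op_pow_th[of F G, OF assms] by auto
  have "th (op_exp F j w) = op_exp G j (th w)"
    unfolding op_exp_def by (subst th_sum) (auto intro!: usp_intros simp: P th_cscale)
  moreover have "op_exp F j w \<in> usp X" unfolding op_exp_def by (intro usp_intros P)
  ultimately show ?thesis by simp
qed

lemma exp_minus_th: "w \<in> usp X \<Longrightarrow>
   exp_minus s' \<beta> j w \<in> usp X \<and> exp_minus s' (- \<beta>) j (th w) = th (exp_minus s' \<beta> j w)"
  unfolding exp_minus_def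
proof (rule op_exp_th, goal_cases)
  case (1 j w)
  then show ?case using usp_intros(4)[where ?'b = 't, of X] by (simp del: zero_fun_apply of_real_minus add: usp_intros(2) hosc_usp)
next
  case (2 j w)
  then show ?case using th_zero by (simp del: zero_fun_apply of_real_minus add: hosc_th th_cscale)
qed

lemma exp_plus_th: "w \<in> usp X \<Longrightarrow>
   exp_plus s' \<beta> j w \<in> usp X \<and> exp_plus s' (- \<beta>) j (th w) = th (exp_plus s' \<beta> j w)"
  unfolding exp_plus_def
proof (rule op_exp_th, goal_cases)
  case (1 j w)
  then show ?case using usp_intros(4)[where ?'b = 't, of X] by (simp del: zero_fun_apply of_real_minus add: usp_intros(2) hosc_usp)
next
  case (2 j w)
  then show ?case using th_zero by (simp del: zero_fun_apply of_real_minus add: hosc_th th_cscale)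
qed

lemma lin_ext_th:
  assumes "w \<in> usp X" "\<And>M \<gamma>. \<gamma> \<in> X \<Longrightarrow> F (Unt M \<gamma>) \<in> usp X"
    and "\<And>M \<gamma>. \<gamma> \<in> X \<Longrightarrow> cscale ((-1) ^ size M * g \<gamma>) (G (Unt M (- \<gamma>))) = cscale a (th (F (Unt M \<gamma>)))"
  shows "lin_ext G (th w) = cscale a (th (lin_ext F w))"
  using assms(1)
proof (induction rule: usp_induct)
  case (single M \<gamma>) then show ?case by (simp add: lin_ext_cscale assms)
next
  case (add v w)
  have "lin_ext F v \<in> usp X" "lin_ext F w \<in> usp X" using add assms(2) by (auto intro: lin_ext_usp)
  then have "th (lin_ext F (v + w)) = th (lin_ext F v) + th (lin_ext F w)"
    using add by (simp only: lin_ext_add th_add usp_fin)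
  moreover have "lin_ext G (th (v + w)) = lin_ext G (th v) + lin_ext G (th w)"
    using add(1,2) by (simp only: th_add lin_ext_add usp_fin[OF th_usp])
  ultimately show ?case using add by (simp only: cfun.scale_right_distrib)
next
  case (scale b w) then show ?case by (simp add: th_cscale lin_ext_cscale mult.commute)
qed (simp add: lin_ext_def)

context
  fixes \<beta> :: 'a and f :: complex and R :: "'a \<Rightarrow> ('t \<Rightarrow> complex) \<Rightarrow> 't \<Rightarrow> complex"
  assumes shift: "\<gamma> \<in> X \<Longrightarrow> \<beta> + \<gamma> \<in> X" and fg: "\<gamma> \<in> X \<Longrightarrow> g (\<beta> + \<gamma>) = f * g \<gamma>" and f0: "f \<noteq> 0"
begin

lemma exp_field_th:
  assumes "w \<in> usp X"
  shows "exp_field (\<lambda>_ _. 1) R \<beta> x w \<in> usp X \<and>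
    cscale f (exp_field (\<lambda>_ _. 1) R (- \<beta>) x (th w)) = th (exp_field (\<lambda>_ _. 1) R \<beta> x w)"
proof
  let ?F = "\<lambda>\<beta> y (i, j). if real i / 2 - real j / 2 + zpower \<beta> y = x
       then exp_minus (sector y) \<beta> i (exp_plus (sector y) \<beta> j (group_act (\<lambda>_ _. 1) R \<beta> y)) else 0"
  have F: "?F \<beta> (Unt M \<gamma>) ij \<in> usp X" if "\<gamma> \<in> X" for M \<gamma> ij
    using that by (cases ij) (auto simp: group_act_def intro!: usp_intros exp_minus_th[THEN conjunct1] exp_plus_th[THEN conjunct1] shift)
  show 1: "exp_field (\<lambda>_ _. 1) R \<beta> x w \<in> usp X"
    unfolding exp_field_def using F by (intro lin_ext_usp[OF assms] Sum_any_usp) auto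
  have key: "cscale ((-1) ^ size M * g \<gamma>) (Sum_any (?F (- \<beta>) (Unt M (- \<gamma>)))) = cscale (1 / f) (th (Sum_any (?F \<beta> (Unt M \<gamma>))))"
    if "\<gamma> \<in> X" for M \<gamma>
  proof -
    let ?c = "(-1) ^ size M * g (\<beta> + \<gamma>)"
    have c0: "?c \<noteq> 0" using g0[OF shift[OF that]] by simp
    have "single (Unt M (- \<beta> + - \<gamma>)) = cscale (1 / ?c) (th (single (Unt M (\<beta> + \<gamma>))))"
      using c0 unfolding th_single minus_add_distrib cfun.scale_scale by (simp del: add_uminus_conv_diff)
    also have "\<dots> = th (cscale (1 / ?c) (single (Unt M (\<beta> + \<gamma>))))" by (simp only: th_cscale)
    finally have s: "group_act (\<lambda>_ _. 1) R (- \<beta>) (Unt M (- \<gamma>)) = th (cscale (1 / ?c) (group_act (\<lambda>_ _. 1) R \<beta> (Unt M \<gamma>)))"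
      by (simp add: group_act_def del: add_uminus_conv_diff)
    have u: "cscale (1 / ?c) (group_act (\<lambda>_ _. 1) R \<beta> (Unt M \<gamma>)) \<in> usp X"
      using that by (auto simp: group_act_def intro!: usp_intros shift)
    have hs: "hosc b n (cscale a w) = cscale a (hosc b n w)" for b :: 'a and n a and w :: "('a, 't) fvec"
      by (simp add: hosc_def osc_cscale cfun.scale_sum_right mult.commute)
    have em: "exp_minus s' b j (cscale a w) = cscale a (exp_minus s' b j w)" for s' b j a and w :: "('a, 't) fvec"
      unfolding exp_minus_def by (rule op_exp_cscale) (simp add: hs mult.commute)
    have ep: "exp_plus s' b j (cscale a w) = cscale a (exp_plus s' b j w)" for s' b j a and w :: "('a, 't) fvec"
      unfolding exp_plus_def by (rule op_exp_cscale) (simp add: hs mult.commute)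
    have "?F (- \<beta>) (Unt M (- \<gamma>)) ij = cscale (1 / ?c) (th (?F \<beta> (Unt M \<gamma>) ij))" for ij
    proof (cases ij)
      case (Pair i j)
      have z: "zpower (- \<beta>) (Unt M (- \<gamma>) :: ('a, 't) fock) = zpower \<beta> (Unt M \<gamma> :: ('a, 't) fock)" by (simp add: zpower_def)
      show ?thesis
        using u by (simp add: Pair z s exp_plus_th exp_minus_th) (simp add: em ep th_cscale)
    qed
    then have "Sum_any (?F (- \<beta>) (Unt M (- \<gamma>))) = Sum_any (\<lambda>ij. th (cscale (1 / ?c) (?F \<beta> (Unt M \<gamma>) ij)))"
      by (simp add: th_cscale)
    also have "\<dots> = th (Sum_any (\<lambda>ij. cscale (1 / ?c) (?F \<beta> (Unt M \<gamma>) ij)))"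
      using F[OF that] by (intro th_Sum_any usp_intros)
    also have "Sum_any (\<lambda>ij. cscale (1 / ?c) (?F \<beta> (Unt M \<gamma>) ij)) = cscale (1 / ?c) (Sum_any (?F \<beta> (Unt M \<gamma>)))"
    proof -
      have "cscale (1 / ?c) v = 0 \<longleftrightarrow> v = 0" for v :: "('a, 't) fvec" using c0 by simp
      then show ?thesis unfolding Sum_any.expand_set cfun.scale_sum_right by simp
    qed
    finally show ?thesis
      using c0 f0 g0[OF that] fg[OF that] by (simp add: th_cscale)
  qed
  have "lin_ext (\<lambda>y. Sum_any (?F (- \<beta>) y)) (th w) = cscale (1 / f) (th (lin_ext (\<lambda>y. Sum_any (?F \<beta> y)) w))"
    using F by (intro lin_ext_th assms Sum_any_usp key) auto
  then show "cscale f (exp_field (\<lambda>_ _. 1) R (- \<beta>) x (th w)) = th (exp_field (\<lambda>_ _. 1) R \<beta> x w)"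
    unfolding exp_field_def using f0 by simp
qed

end

definition th_pair :: "complex \<Rightarrow> (real \<Rightarrow> ('a, 't) fvec \<Rightarrow> ('a, 't) fvec) \<Rightarrow> (real \<Rightarrow> ('a, 't) fvec \<Rightarrow> ('a, 't) fvec) \<Rightarrow> bool" where
  "th_pair c \<Phi> \<Psi> \<longleftrightarrow>
    (\<forall>x. \<forall>w\<in>usp X. \<Phi> x w \<in> usp X \<and> cscale c (\<Psi> x (th w)) = th (\<Phi> x w)) \<and>
    (\<forall>x a w. a \<noteq> 0 \<longrightarrow> \<Psi> x (cscale a w) = cscale a (\<Psi> x w))"

lemma cscale_m1: "cscale (-1) w = - w"
  by (auto simp: cscale_def fun_eq_iff)

lemma Sum_any_cscale: "a \<noteq> 0 \<Longrightarrow> Sum_any (\<lambda>l. cscale a (F l)) = cscale a (Sum_any F)"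
  unfolding Sum_any.expand_set cfun.scale_sum_right by simp

lemma normal_ordered_th:
  assumes "th_pair c \<Phi> \<Psi>" "c \<noteq> 0"
  shows "th_pair (- c) (normal_ordered s' bn \<Phi>) (normal_ordered s' bn \<Psi>)"
proof -
  obtain b n where bn: "bn = (b, n)" by (cases bn)
  have \<Phi>: "\<Phi> x w \<in> usp X" "cscale c (\<Psi> x (th w)) = th (\<Phi> x w)" if "w \<in> usp X" for x w
    using assms(1) that by (auto simp: th_pair_def)
  have \<Psi>: "\<Psi> x (cscale a w) = cscale a (\<Psi> x w)" if "a \<noteq> 0" for x a w
    using assms(1) that by (auto simp: th_pair_def)
  let ?k = "\<lambda>l::int. complex_of_real ((- (of_int l + s') - 1) gchoose (nat \<lfloor>n\<rfloor> - 1))"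
  let ?h = "\<lambda>\<Phi> x w l. cscale (?k l)
     (if of_int l + s' < 0 then osc b (of_int l + s') (\<Phi> (x + (of_int l + s') + n) w)
      else \<Phi> (x + (of_int l + s') + n) (osc b (of_int l + s') w))"
  have no: "normal_ordered s' bn \<Phi> x w = Sum_any (?h \<Phi> x w)" for \<Phi> x and w :: "('a, 't) fvec"
    by (simp add: normal_ordered_def bn Let_def)
  have u: "?h \<Phi> x w l \<in> usp X" if "w \<in> usp X" for x w l
    using that by (auto intro!: usp_intros osc_usp \<Phi>)
  have t: "?h \<Psi> x (th w) l = cscale (1 / (- c)) (th (?h \<Phi> x w l))" if w: "w \<in> usp X" for x l and w :: "('a, 't) fvec"
  proof -
    let ?m = "of_int l + s'"
    let ?x = "x + ?m + n"
    have P: "\<Psi> y (th v) = cscale (1 / c) (th (\<Phi> y v))" if "v \<in> usp X" for y v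
      using \<Phi>(2)[OF that, of y, symmetric] assms(2) by simp
    have "osc b ?m (\<Psi> ?x (th w)) = cscale (1 / (- c)) (th (osc b ?m (\<Phi> ?x w)))"
      using w assms(2) by (simp add: P osc_cscale osc_th \<Phi>(1))
    moreover have "\<Psi> ?x (osc b ?m (th w)) = cscale (1 / (- c)) (th (\<Phi> ?x (osc b ?m w)))"
    proof -
      have "\<Psi> ?x (osc b ?m (th w)) = \<Psi> ?x (cscale (-1) (th (osc b ?m w)))"
        using w by (simp add: osc_th cscale_m1)
      also have "\<dots> = cscale (-1) (cscale (1 / c) (th (\<Phi> ?x (osc b ?m w))))"
        using w by (simp add: \<Psi> P osc_usp del: cfun.scale_minus_left)
      finally show ?thesis by simp
    qed
    ultimately show ?thesis by (simp add: th_cscale mult.commute)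
  qed
  show ?thesis
    unfolding th_pair_def
  proof (intro conjI allI ballI impI)
    fix x and w :: "('a, 't) fvec" assume w: "w \<in> usp X"
    show "normal_ordered s' bn \<Phi> x w \<in> usp X" unfolding no by (intro Sum_any_usp u w)
    have "Sum_any (?h \<Psi> x (th w)) = cscale (1 / (- c)) (Sum_any (\<lambda>l. th (?h \<Phi> x w l)))"
      unfolding t[OF w] using assms(2) by (intro Sum_any_cscale) simp
    also have "Sum_any (\<lambda>l. th (?h \<Phi> x w l)) = th (Sum_any (?h \<Phi> x w))"
      by (intro th_Sum_any u w)
    finally show "cscale (- c) (normal_ordered s' bn \<Psi> x (th w)) = th (normal_ordered s' bn \<Phi> x w)"
      unfolding no using assms(2) by (simp only: cfun.scale_scale) simp
  next
    fix x a and w :: "('a, 't) fvec" assume a: "a \<noteq> (0 :: complex)"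
    have "?h \<Psi> x (cscale a w) = (\<lambda>l. cscale a (?h \<Psi> x w l))"
      using a by (simp add: fun_eq_iff \<Psi> osc_cscale mult.commute)
    then show "normal_ordered s' bn \<Psi> x (cscale a w) = cscale a (normal_ordered s' bn \<Psi> x w)"
      unfolding no by (simp only: Sum_any_cscale[OF a])
  qed
qed

lemma foldr_normal_ordered_th:
  assumes "th_pair c \<Phi> \<Psi>" "c \<noteq> 0"
  shows "th_pair ((-1) ^ length bs * c) (foldr (normal_ordered s') bs \<Phi>) (foldr (normal_ordered s') bs \<Psi>)"
proof (induction bs)
  case Nil then show ?case using assms by (simp add: id_def)
next
  case (Cons bn bs)
  from normal_ordered_th[OF this, of s' bn] assms(2) show ?case by simp
qed

lemma vertex_coeff_th:
  fixes f :: "'a \<Rightarrow> complex"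
  assumes shift: "\<And>\<beta> \<gamma>. \<beta> \<in> L \<Longrightarrow> \<gamma> \<in> X \<Longrightarrow> \<beta> + \<gamma> \<in> X"
    and fg: "\<And>\<beta> \<gamma>. \<beta> \<in> L \<Longrightarrow> \<gamma> \<in> X \<Longrightarrow> g (\<beta> + \<gamma>) = f \<beta> * g \<gamma>" and f0: "\<And>\<beta>. \<beta> \<in> L \<Longrightarrow> f \<beta> \<noteq> 0"
    and v: "v \<in> usp L" and w: "w \<in> usp X"
  shows "vertex_coeff (\<lambda>_ _. 1) R v x w \<in> usp X \<and>
    vertex_coeff (\<lambda>_ _. 1) R (theta f s v) x (th w) = th (vertex_coeff (\<lambda>_ _. 1) R v x w)"
  using v
proof (induction rule: usp_induct)
  case (single M \<beta>)
  define bs where "bs = (SOME bs. mset bs = M)"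
  have bs: "mset bs = M" unfolding bs_def by (rule someI_ex) (rule ex_mset)
  then have len: "length bs = size M" by (metis size_mset)
  let ?P = "\<lambda>\<beta>. foldr (normal_ordered 0) bs (exp_field (\<lambda>_ _. 1) R \<beta>)"
  let ?c = "(-1) ^ size M * f \<beta>"
  have c0: "?c \<noteq> 0" using f0[OF single] by simp
  have "th_pair (f \<beta>) (exp_field (\<lambda>_ _. 1) R \<beta>) (exp_field (\<lambda>_ _. 1) R (- \<beta>))"
    unfolding th_pair_def
    using exp_field_th[of \<beta> "f \<beta>"] shift[OF single] fg[OF single] f0[OF single]
    by (simp add: exp_field_def lin_ext_cscale)
  from foldr_normal_ordered_th[OF this f0[OF single], of bs 0] len
  have P: "th_pair ?c (?P \<beta>) (?P (- \<beta>))" by simp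
  let ?F = "\<lambda>\<beta> y. foldr (normal_ordered (sector y)) bs (exp_field (\<lambda>_ _. 1) R \<beta>) x (single y)"
  have vc: "vertex_coeff (\<lambda>_ _. 1) R (single (Unt M \<beta>')) x w' = lin_ext (?F \<beta>') w'" for \<beta>' w'
    by (simp add: vertex_coeff_def bs_def[symmetric])
  have F: "?F \<beta> (Unt M' \<gamma>) \<in> usp X" if "\<gamma> \<in> X" for M' :: "('a \<times> real) multiset" and \<gamma>
    using P that by (simp add: th_pair_def)
  have "lin_ext (?F (- \<beta>)) (th w) = cscale (1 / ?c) (th (lin_ext (?F \<beta>) w))"
  proof (rule lin_ext_th[OF w], erule F)
    fix M' :: "('a \<times> real) multiset" and \<gamma> assume \<gamma>: "\<gamma> \<in> X"
    let ?k = "(-1) ^ size M' * g \<gamma>"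
    have k0: "?k \<noteq> 0" using g0[OF \<gamma>] by simp
    have "cscale ?c (?P (- \<beta>) x (th (single (Unt M' \<gamma>)))) = th (?P \<beta> x (single (Unt M' \<gamma>)))"
      using P \<gamma> unfolding th_pair_def by (metis (no_types, lifting) usp_single)
    moreover have "?P (- \<beta>) x (th (single (Unt M' \<gamma>))) = cscale ?k (?P (- \<beta>) x (single (Unt M' (- \<gamma>))))"
      unfolding th_single using P k0 unfolding th_pair_def by blast
    ultimately have "cscale ?c (cscale ?k (?P (- \<beta>) x (single (Unt M' (- \<gamma>))))) = th (?P \<beta> x (single (Unt M' \<gamma>)))"
      by simp
    then have "cscale (1 / ?c) (cscale ?c (cscale ?k (?P (- \<beta>) x (single (Unt M' (- \<gamma>)))))) = cscale (1 / ?c) (th (?P \<beta> x (single (Unt M' \<gamma>))))"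
      by (rule arg_cong)
    moreover have "cscale (1 / ?c) (cscale ?c z) = z" for z :: "('a, 't) fvec"
      using c0 unfolding cfun.scale_scale by simp
    ultimately
    show "cscale ?k (?F (- \<beta>) (Unt M' (- \<gamma>))) = cscale (1 / ?c) (th (?F \<beta> (Unt M' \<gamma>)))"
      by (simp only: sector.simps)
  qed
  moreover have "cscale ?c (cscale (1 / ?c) z) = z" for z :: "('a, 't) fvec"
    using c0 unfolding cfun.scale_scale by simp
  ultimately have "cscale ?c (lin_ext (?F (- \<beta>)) (th w)) = th (lin_ext (?F \<beta>) w)"
    by simp
  moreover have "vertex_coeff (\<lambda>_ _. 1) R (theta f s (single (Unt M \<beta>))) x (th w) = cscale ?c (lin_ext (?F (- \<beta>)) (th w))"
  proof -
    have "vertex_coeff (\<lambda>_ _. 1) R (cscale ?c (single (Unt M (- \<beta>)))) x (th w) = cscale ?c (vertex_coeff (\<lambda>_ _. 1) R (single (Unt M (- \<beta>))) x (th w))"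
      by (simp add: vertex_coeff_def lin_ext_cscale del: lin_ext_single)
    then show ?thesis by (simp add: theta_def vc)
  qed
  moreover have "lin_ext (?F \<beta>) w \<in> usp X" by (rule lin_ext_usp[OF w]) (rule F)
  ultimately show ?case by (simp add: vc)
next
  case (add v v')
  have "theta f s v \<in> fin_supp" "theta f s v' \<in> fin_supp"
    using add(1,2) unfolding theta_def
    by (auto intro!: usp_fin[of _ UNIV] lin_ext_usp cfun.subspace_scale[OF subspace_usp])
  moreover have "theta f s (v + v') = theta f s v + theta f s v'"
    using add(1,2) by (simp add: theta_def lin_ext_add usp_fin)
  ultimately have 1: "vertex_coeff (\<lambda>_ _. 1) R (theta f s (v + v')) x (th w) =
      vertex_coeff (\<lambda>_ _. 1) R (theta f s v) x (th w) + vertex_coeff (\<lambda>_ _. 1) R (theta f s v') x (th w)"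
    unfolding vertex_coeff_def by (simp only: lin_ext_add)
  have 2: "vertex_coeff (\<lambda>_ _. 1) R (v + v') x w =
      vertex_coeff (\<lambda>_ _. 1) R v x w + vertex_coeff (\<lambda>_ _. 1) R v' x w"
    unfolding vertex_coeff_def using add(1,2) by (intro lin_ext_add usp_fin)
  show ?case
    unfolding 1 2 using add(3,4) by (simp only: th_add usp_intros(1))
next
  case (scale a v)
  then show ?case
    by (auto simp: vertex_coeff_def theta_def lin_ext_cscale th_cscale intro: usp_intros)
next
  case zero
  then show ?case by (simp add: vertex_coeff_def theta_def lin_ext_def usp_intros)
qed

lemma fock_mode_th:
  fixes f :: "'a \<Rightarrow> complex"
  assumes shift: "\<And>\<beta> \<gamma>. \<beta> \<in> L \<Longrightarrow> \<gamma> \<in> X \<Longrightarrow> \<beta> + \<gamma> \<in> X"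
    and fg: "\<And>\<beta> \<gamma>. \<beta> \<in> L \<Longrightarrow> \<gamma> \<in> X \<Longrightarrow> g (\<beta> + \<gamma>) = f \<beta> * g \<gamma>" and f0: "\<And>\<beta>. \<beta> \<in> L \<Longrightarrow> f \<beta> \<noteq> 0"
    and v: "v \<in> usp L" and w: "w \<in> usp X"
  shows "th (fock_mode (\<lambda>_ _. 1) R v p w) = fock_mode (\<lambda>_ _. 1) R (theta f s v) p (th w)"
proof -
  note V = vertex_coeff_th[of L f, OF shift fg f0 v]
  let ?x = "- of_int p - 1 :: real"
  let ?F = "\<lambda>v y. case y of
      Unt M \<gamma> \<Rightarrow> vertex_coeff (\<lambda>_ _. 1) R v ?x (single y)
    | Tw M t \<Rightarrow> Sum_any (\<lambda>r::nat. vertex_coeff (\<lambda>_ _. 1) R (op_exp delta_op r v) (?x + real r) (single y))"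
  have vs: "vertex_coeff (\<lambda>_ _. 1) R u x (cscale a w) = cscale a (vertex_coeff (\<lambda>_ _. 1) R u x w)" for u x a and w :: "('a, 't) fvec"
  proof -
    have L: "lin_ext (\<lambda>u. cscale a (F u)) u = cscale a (lin_ext F u)" for F :: "('a, 't) fock \<Rightarrow> ('a, 't) fvec"
      unfolding lin_ext_def cfun.scale_sum_right by (simp add: mult.commute)
    have "(case y of Unt M \<beta> \<Rightarrow> cscale a (G M \<beta>) | Tw M t \<Rightarrow> 0) = cscale a (case y of Unt M \<beta> \<Rightarrow> G M \<beta> | Tw M t \<Rightarrow> 0)"
      for y and G :: "('a \<times> real) multiset \<Rightarrow> 'a \<Rightarrow> ('a, 't) fvec" by (simp split: fock.split)
    note 1 = this
    have "vertex_coeff (\<lambda>_ _. 1) R u x (cscale a w) = lin_ext (\<lambda>y. cscale a (case y of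
        Unt M \<beta> \<Rightarrow> lin_ext (\<lambda>z. foldr (normal_ordered (sector z)) (SOME bs. mset bs = M) (exp_field (\<lambda>_ _. 1) R \<beta>) x (single z)) w
      | Tw M t \<Rightarrow> 0)) u"
      unfolding vertex_coeff_def Let_def lin_ext_cscale 1[symmetric] by simp
    then show ?thesis using L unfolding vertex_coeff_def Let_def by simp
  qed
  have "lin_ext (?F (theta f s v)) (th w) = cscale 1 (th (lin_ext (?F v) w))"
  proof (rule lin_ext_th[OF w])
    fix M \<gamma> assume \<gamma>: "\<gamma> \<in> X"
    then show "?F v (Unt M \<gamma>) \<in> usp X" using V[of "single (Unt M \<gamma>)"] by simp
    show "cscale ((- 1) ^ size M * g \<gamma>) (?F (theta f s v) (Unt M (- \<gamma>))) = cscale 1 (th (?F v (Unt M \<gamma>)))"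
      using V[of "single (Unt M \<gamma>)" R ?x] \<gamma> by (simp add: vs)
  qed
  then show ?thesis by (simp add: fock_mode_def)
qed

end

lemma lattice_space_usp: "v \<in> lattice_space X \<Longrightarrow> v \<in> usp X"
  unfolding lattice_space_def usp_def fin_supp_def by blast

theorem rank1_theta_mode:
  assumes k: "k > 0" and \<rho>: "rho_hom k \<rho>" and r: "r \<in> {0, int k}"
    and v: "v \<in> V_coset k 0" and w: "w \<in> V_coset k r"
  shows "rank1_theta \<rho> (rank1_mode k \<rho> v p w) = rank1_mode k \<rho> (rank1_theta \<rho> v) p (rank1_theta \<rho> w)"
proof -
  define a where "a = alpha k"
  let ?X = "rank1_coset k r" and ?L = "rank1_coset k 0"
  have half: "real_of_int r * alpha k / (2 * real k) = (if r = 0 then 0 else a / 2)"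
    using r k by (auto simp: a_def)
  have L: "\<beta> \<in> ?L \<longleftrightarrow> (\<exists>j. \<beta> = of_int j * a)" for \<beta>
    by (auto simp: rank1_coset_def a_def)
  have X: "\<gamma> \<in> ?X \<longleftrightarrow> (\<exists>j. \<gamma> = (if r = 0 then 0 else a / 2) + of_int j * a)" for \<gamma>
    unfolding rank1_coset_def half by (auto simp: a_def)
  have dbl: "2 * \<gamma> \<in> ?L" if "\<gamma> \<in> ?X" for \<gamma>
  proof -
    from that obtain j where "\<gamma> = (if r = 0 then 0 else a / 2) + of_int j * a" using X by blast
    then have "2 * \<gamma> = of_int (2 * j + (if r = 0 then 0 else 1)) * a" by (auto simp: algebra_simps)
    then show ?thesis using L by blast
  qed
  have dblL: "2 * \<beta> \<in> ?L" if "\<beta> \<in> ?L" for \<beta>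
  proof -
    from that obtain j where "\<beta> = of_int j * a" using L by blast
    then have "2 * \<beta> = of_int (2 * j) * a" by simp
    then show ?thesis using L by blast
  qed
  have neg: "- \<gamma> \<in> ?X" if "\<gamma> \<in> ?X" for \<gamma>
  proof -
    from that obtain j where "\<gamma> = (if r = 0 then 0 else a / 2) + of_int j * a" using X by blast
    then have "- \<gamma> = (if r = 0 then 0 else a / 2) + of_int (- j - (if r = 0 then 0 else 1)) * a"
      by (auto simp: algebra_simps)
    then show ?thesis using X by blast
  qed
  have shift: "\<beta> + \<gamma> \<in> ?X" if "\<beta> \<in> ?L" "\<gamma> \<in> ?X" for \<beta> \<gamma>
  proof -
    from that obtain i j where "\<beta> = of_int i * a" "\<gamma> = (if r = 0 then 0 else a / 2) + of_int j * a"
      using X L by blast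
    then have "\<beta> + \<gamma> = (if r = 0 then 0 else a / 2) + of_int (i + j) * a" by (simp add: algebra_simps)
    then show ?thesis using X by blast
  qed
  have nz: "\<rho> \<beta> \<noteq> 0" if "\<beta> \<in> ?L" for \<beta> using \<rho> that by (simp add: rho_hom_def Let_def)
  have mult: "\<rho> (\<beta> + \<gamma>) = \<rho> \<beta> * \<rho> \<gamma>" if "\<beta> \<in> ?L" "\<gamma> \<in> ?L" for \<beta> \<gamma>
    using \<rho> that by (simp add: rho_hom_def Let_def)
  interpret theta_setup ?X "\<lambda>\<gamma>. \<rho> (2 * \<gamma>)" 1 "theta (\<lambda>\<gamma>. \<rho> (2 * \<gamma>)) 1"
    by unfold_locales (auto simp: neg nz dbl)
  show ?thesis
    unfolding rank1_theta_def rank1_mode_def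
    using v w shift dblL dbl nz mult
    by (intro fock_mode_th[of ?L]) (auto simp: V_coset_def lattice_space_usp distrib_left)
qed

lemma rank1_theta_half:
  "rank1_theta \<rho> (single (Unt {#} (alpha k / 2))) = cscale (\<rho> (alpha k)) (single (Unt {#} (- (alpha k / 2))))"
  by (simp add: rank1_theta_def theta_def)


section \<open>Codes over \<open>\<int>\<^bsub>2k\<^esub>\<close>\<close>

text \<open>Elements of \<open>\<int>\<^bsub>2k\<^esub>\<close> are represented by the integers in \<open>{0..<2k}\<close>.\<close>

definition zmod_space :: "nat \<Rightarrow> ('n \<Rightarrow> int) set" where
  "zmod_space k = {c. \<forall>i. c i \<in> {0..<2 * int k}}"

definition linear_code :: "nat \<Rightarrow> ('n \<Rightarrow> int) set \<Rightarrow> bool" where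
  "linear_code k C \<longleftrightarrow> C \<subseteq> zmod_space k \<and> (\<lambda>_. 0) \<in> C \<and>
     (\<forall>c\<in>C. \<forall>d\<in>C. (\<lambda>i. (c i + d i) mod (2 * int k)) \<in> C) \<and>
     (\<forall>a. \<forall>c\<in>C. (\<lambda>i. (a * c i) mod (2 * int k)) \<in> C)"

definition euclidean_weight :: "nat \<Rightarrow> ('n::finite \<Rightarrow> int) \<Rightarrow> int" where
  "euclidean_weight k c = (\<Sum>i\<in>UNIV. (if c i \<le> int k then c i else c i - 2 * int k)\<^sup>2)"

definition self_dual_code :: "nat \<Rightarrow> ('n::finite \<Rightarrow> int) set \<Rightarrow> bool" where
  "self_dual_code k C \<longleftrightarrow>
     C = {x \<in> zmod_space k. \<forall>c\<in>C. (\<Sum>i\<in>UNIV. x i * c i) mod (2 * int k) = 0}"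

definition type_II_code :: "nat \<Rightarrow> ('n::finite \<Rightarrow> int) set \<Rightarrow> bool" where
  "type_II_code k C \<longleftrightarrow> linear_code k C \<and> self_dual_code k C \<and>
     (\<forall>c\<in>C. 4 * int k dvd euclidean_weight k c)"

definition extremal_type_II_code :: "nat \<Rightarrow> (24 \<Rightarrow> int) set \<Rightarrow> bool" where
  "extremal_type_II_code k C \<longleftrightarrow> type_II_code k C \<and>
     Min (euclidean_weight k ` (C - {\<lambda>_. 0})) = 8 * int k"

definition in_C2 :: "nat \<Rightarrow> ('n \<Rightarrow> int) \<Rightarrow> bool" where
  "in_C2 k c \<longleftrightarrow> (\<forall>i. int k dvd c i)"

definition C2 :: "nat \<Rightarrow> ('n::finite \<Rightarrow> int) set \<Rightarrow> (bit ^ 'n) set" where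
  "C2 k C = {(\<chi> i. if c i = 0 then 0 else 1) | c. c \<in> C \<and> in_C2 k c}"

definition binary_dual :: "(bit ^ 'n::finite) set \<Rightarrow> (bit ^ 'n) set" where
  "binary_dual D = {x. \<forall>d\<in>D. (\<Sum>i\<in>UNIV. x $ i * d $ i) = 0}"

definition tau :: "'n \<Rightarrow> ('n \<Rightarrow> int) \<Rightarrow> bit" where
  "tau i c = of_int (c i)"

text \<open>A choice of one element from each pair \<open>{c, -c}\<close> in \<open>C \<setminus> C\<^sub>2\<close>, where \<open>c \<noteq> -c\<close>.\<close>

definition half_system :: "nat \<Rightarrow> ('n \<Rightarrow> int) set \<Rightarrow> ('n \<Rightarrow> int) set \<Rightarrow> bool" where
  "half_system k C R \<longleftrightarrow> R \<subseteq> {c \<in> C. \<not> in_C2 k c} \<and>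
     (\<forall>c\<in>C. \<not> in_C2 k c \<longrightarrow> (c \<in> R \<longleftrightarrow> (\<lambda>i. (- c i) mod (2 * int k)) \<notin> R))"


section \<open>Modules for \<open>(V\<^sub>L\<^sup>+)\<^bsup>\<otimes>24\<^esup>\<close>\<close>

definition VLplus24 :: "nat \<Rightarrow> (real \<Rightarrow> complex) \<Rightarrow> ((24 \<Rightarrow> (real, bit) fock) \<Rightarrow> complex) voa" where
  "VLplus24 k \<rho> = tensor_power_voa (VLplus k \<rho>)"

definition M_code :: "nat \<Rightarrow> (24 \<Rightarrow> int) \<Rightarrow> ((24 \<Rightarrow> (real, bit) fock) \<Rightarrow> complex) set" where
  "M_code k c = tensor (\<lambda>i. V_coset k (c i))"

text \<open>The direct sums over the signs are internal.\<close>

definition M_plus :: "nat \<Rightarrow> (real \<Rightarrow> complex) \<Rightarrow> bit ^ 24 \<Rightarrow> ((24 \<Rightarrow> (real, bit) fock) \<Rightarrow> complex) set" where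
  "M_plus k \<rho> c = cfun.span (\<Union>e\<in>{e. (\<Prod>i\<in>UNIV. psgn (e i)) = 1}.
     tensor (\<lambda>i. V_pm k \<rho> (if c $ i = 0 then 0 else int k) (e i)))"

definition MT_minus :: "(real \<Rightarrow> complex) \<Rightarrow> bit ^ 24 \<Rightarrow> ((24 \<Rightarrow> (real, bit) fock) \<Rightarrow> complex) set" where
  "MT_minus \<rho> c = cfun.span (\<Union>e\<in>{e. (\<Prod>i\<in>UNIV. psgn (e i)) = -1}.
     tensor (\<lambda>i. VT_pm \<rho> (c $ i) (e i)))"

text \<open>
  All graded spaces in question have \<open>L(0)\<close>-weights in \<open>\<nat>\<close> (for \<open>M_code k c\<close> because the Euclidean
  weight of \<open>c\<close> is divisible by \<open>4k\<close>), so that characters are power series in \<open>q\<close>.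
\<close>

definition character :: "(('i \<Rightarrow> complex) \<Rightarrow> 'i \<Rightarrow> complex) \<Rightarrow> ('i \<Rightarrow> complex) set \<Rightarrow> complex fps" where
  "character L0 W = Abs_fps (\<lambda>n. of_nat (cfun.dim (eigenspace L0 W (of_nat n))))"

definition ch_M :: "nat \<Rightarrow> (real \<Rightarrow> complex) \<Rightarrow> (24 \<Rightarrow> int) \<Rightarrow> complex fps" where
  "ch_M k \<rho> c = character (vmode (VLplus24 k \<rho>) (vconf (VLplus24 k \<rho>)) 1) (M_code k c)"

definition b_series :: "nat \<Rightarrow> (real \<Rightarrow> complex) \<Rightarrow> complex fps" where
  "b_series k \<rho> = (let L0 = rank1_mode k \<rho> fock_conf 1 in
     character L0 (V_pm k \<rho> 0 True) - character L0 (V_pm k \<rho> 0 False))"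


section \<open>The moonshine module\<close>

text \<open>
  A self-dual subgroup is automatically discrete of full rank, i.e. a unimodular lattice. The
  Leech lattice is the even unimodular lattice of rank 24 without vectors of norm 2.
\<close>

definition leech_lattice :: "(real ^ 24) set \<Rightarrow> bool" where
  "leech_lattice \<Lambda> \<longleftrightarrow> \<Lambda> = {x. \<forall>y\<in>\<Lambda>. x \<bullet> y \<in> \<int>} \<and>
     (\<forall>x\<in>\<Lambda>. (x \<bullet> x) / 2 \<in> \<int>) \<and> (\<forall>x\<in>\<Lambda>. x \<bullet> x \<noteq> 2)"

text \<open>
  A central extension of \<open>\<Lambda>\<close> by \<open>\<langle>-1\<rangle>\<close>, given by the cocycle of a normalised section \<open>\<beta> \<mapsto> e\<^sub>\<beta>\<close>, that
  is \<open>e\<^sub>\<beta> e\<^sub>\<gamma> = \<epsilon>(\<beta>,\<gamma>) e\<^bsub>\<beta>+\<gamma>\<^esub>\<close>, with commutator map \<open>\<langle>\<beta>,\<gamma>\<rangle> + 2\<int>\<close>.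
\<close>

definition central_extension :: "'a::euclidean_space set \<Rightarrow> ('a \<Rightarrow> 'a \<Rightarrow> complex) \<Rightarrow> bool" where
  "central_extension \<Lambda> \<epsilon> \<longleftrightarrow>
     (\<forall>\<beta>\<in>\<Lambda>. \<forall>\<gamma>\<in>\<Lambda>. \<epsilon> \<beta> \<gamma> \<in> {1, -1}) \<and>
     (\<forall>\<beta>\<in>\<Lambda>. \<epsilon> \<beta> 0 = 1 \<and> \<epsilon> 0 \<beta> = 1) \<and>
     (\<forall>\<beta>\<in>\<Lambda>. \<forall>\<gamma>\<in>\<Lambda>. \<forall>\<delta>\<in>\<Lambda>. \<epsilon> \<beta> \<gamma> * \<epsilon> (\<beta> + \<gamma>) \<delta> = \<epsilon> \<gamma> \<delta> * \<epsilon> \<beta> (\<gamma> + \<delta>)) \<and>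
     (\<forall>\<beta>\<in>\<Lambda>. \<forall>\<gamma>\<in>\<Lambda>. \<epsilon> \<beta> \<gamma> * \<epsilon> \<gamma> \<beta> = (-1) powi \<lfloor>\<beta> \<bullet> \<gamma>\<rfloor>)"

text \<open>
  An irreducible representation \<open>T\<close> of the central extension on \<open>'t \<Rightarrow> complex\<close> in which the central
  element \<open>-1\<close> acts by \<open>-1\<close> and the elements \<open>\<theta>(a) a\<^bsup>-1\<^esup> = a\<^bsup>-2\<^esup> (-1)\<^bsup>\<langle>\<beta>,\<beta>\<rangle>/2\<^esup>\<close> (\<open>\<beta>\<close> the image of \<open>a\<close>) act
  trivially.
\<close>

definition twisted_rep ::
    "'a::euclidean_space set \<Rightarrow> ('a \<Rightarrow> 'a \<Rightarrow> complex) \<Rightarrow> ('a \<Rightarrow> ('t::finite \<Rightarrow> complex) \<Rightarrow> 't \<Rightarrow> complex) \<Rightarrow> bool" where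
  "twisted_rep \<Lambda> \<epsilon> T \<longleftrightarrow>
     (\<forall>\<beta>\<in>\<Lambda>. lin_on UNIV (T \<beta>)) \<and> T 0 = id \<and>
     (\<forall>\<beta>\<in>\<Lambda>. \<forall>\<gamma>\<in>\<Lambda>. \<forall>x. T \<beta> (T \<gamma> x) = cscale (\<epsilon> \<beta> \<gamma>) (T (\<beta> + \<gamma>) x)) \<and>
     (\<forall>\<beta>\<in>\<Lambda>. \<forall>x. T \<beta> (T \<beta> x) = cscale ((-1) powi \<lfloor>(\<beta> \<bullet> \<beta>) / 2\<rfloor>) x) \<and>
     (\<forall>U. cfun.subspace U \<and> (\<forall>\<beta>\<in>\<Lambda>. T \<beta> ` U \<subseteq> U) \<longrightarrow> U = {0} \<or> U = UNIV)"

text \<open>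
  Since \<open>\<theta>(e\<^sub>\<beta>) = e\<^sub>\<beta>\<^bsup>-1\<^esup> (-1)\<^bsup>\<langle>\<beta>,\<beta>\<rangle>/2\<^esup> = \<epsilon>(\<beta>,-\<beta>) (-1)\<^bsup>\<langle>\<beta>,\<beta>\<rangle>/2\<^esup> e\<^bsub>-\<beta>\<^esub>\<close>; on the twisted module it is \<open>\<theta> \<otimes> (-1)\<close>.
\<close>

definition leech_theta :: "('a::euclidean_space \<Rightarrow> 'a \<Rightarrow> complex) \<Rightarrow> ('a, 't) fvec \<Rightarrow> ('a, 't) fvec" where
  "leech_theta \<epsilon> = theta (\<lambda>\<beta>. \<epsilon> \<beta> (- \<beta>) * (-1) powi \<lfloor>(\<beta> \<bullet> \<beta>) / 2\<rfloor>) (-1)"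

definition VLambda_plus :: "'a::euclidean_space set \<Rightarrow> ('a \<Rightarrow> 'a \<Rightarrow> complex) \<Rightarrow> ('a, 't) fvec set" where
  "VLambda_plus \<Lambda> \<epsilon> = eigenspace (leech_theta \<epsilon>) (lattice_space \<Lambda>) 1"

definition VLambdaT_plus :: "('a::euclidean_space \<Rightarrow> 'a \<Rightarrow> complex) \<Rightarrow> ('a, 't) fvec set" where
  "VLambdaT_plus \<epsilon> = eigenspace (leech_theta \<epsilon>) (twisted_space UNIV) 1"

text \<open>
  The moonshine module, with carrier \<open>V\<^sub>\<Lambda>\<^sup>+ \<oplus> V\<^sub>\<Lambda>\<^bsup>T,+\<^esup>\<close>. Its vertex operators are given by the untwisted
  and twisted vertex operators for elements of \<open>V\<^sub>\<Lambda>\<^sup>+\<close>; this determines the structure of a simple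
  \<open>\<int>\<^sub>2\<close>-graded VOA up to isomorphism.
\<close>

definition moonshine_voa ::
    "'a::euclidean_space set \<Rightarrow> ('a \<Rightarrow> 'a \<Rightarrow> complex) \<Rightarrow> ('a \<Rightarrow> ('t::finite \<Rightarrow> complex) \<Rightarrow> 't \<Rightarrow> complex)
      \<Rightarrow> ('a, 't) fvec voa \<Rightarrow> bool" where
  "moonshine_voa \<Lambda> \<epsilon> T V \<longleftrightarrow>
     is_voa V \<and> simple_voa V \<and>
     vcarrier V = {u + v | u v. u \<in> VLambda_plus \<Lambda> \<epsilon> \<and> v \<in> VLambdaT_plus \<epsilon>} \<and>
     vvac V = fock_vac \<and> vconf V = fock_conf \<and>
     (\<forall>u\<in>VLambda_plus \<Lambda> \<epsilon>. \<forall>n. \<forall>w\<in>vcarrier V. vmode V u n w = fock_mode \<epsilon> T u n w) \<and>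
     (\<forall>u\<in>VLambdaT_plus \<epsilon>. \<forall>n. \<forall>w\<in>VLambda_plus \<Lambda> \<epsilon>. vmode V u n w \<in> VLambdaT_plus \<epsilon>) \<and>
     (\<forall>u\<in>VLambdaT_plus \<epsilon>. \<forall>n. \<forall>w\<in>VLambdaT_plus \<epsilon>. vmode V u n w \<in> VLambda_plus \<Lambda> \<epsilon>)"

definition mckay_thompson ::
    "('i \<Rightarrow> complex) voa \<Rightarrow> (('i \<Rightarrow> complex) \<Rightarrow> 'i \<Rightarrow> complex) \<Rightarrow> complex fls" where
  "mckay_thompson V g = fls_X_inv * fps_to_fls (Abs_fps (\<lambda>n. trace_on (weight_space V (int n)) g))"

text \<open>
  The two decompositions of \<open>V\<^sup>\<natural>\<close> under the image of \<open>\<iota> : (V\<^sub>L\<^sup>+)\<^bsup>\<otimes>24\<^esup> \<rightarrow> V\<^sub>\<Lambda>\<^sup>+\<close>. For odd \<open>k\<close> the binary code \<open>C\<^sub>2\<close>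
  is self-dual, so that \<open>m = 12\<close> and the truncation in \<open>m - 12\<close> is harmless.
\<close>

definition natural_act ::
    "('i \<Rightarrow> complex) voa \<Rightarrow> (('j \<Rightarrow> complex) \<Rightarrow> 'i \<Rightarrow> complex)
      \<Rightarrow> ('j \<Rightarrow> complex) \<Rightarrow> int \<Rightarrow> ('i \<Rightarrow> complex) \<Rightarrow> 'i \<Rightarrow> complex" where
  "natural_act V \<iota> a n w = vmode V (\<iota> a) n w"

definition untwisted_decomposition ::
    "nat \<Rightarrow> (real \<Rightarrow> complex) \<Rightarrow> (24 \<Rightarrow> int) set \<Rightarrow> (24 \<Rightarrow> int) set
      \<Rightarrow> ((24 \<Rightarrow> (real, bit) fock) \<Rightarrow> complex) set
      \<Rightarrow> (((24 \<Rightarrow> (real, bit) fock) \<Rightarrow> complex) \<Rightarrow> int \<Rightarrow> ('i \<Rightarrow> complex) \<Rightarrow> 'i \<Rightarrow> complex)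
      \<Rightarrow> ('i \<Rightarrow> complex) set \<Rightarrow> bool" where
  "untwisted_decomposition k \<rho> C R A act W \<longleftrightarrow>
     module_iso A act W (dsum_act (vmode (VLplus24 k \<rho>)))
       (dsum (C2 k C <+> R) (\<lambda>j. case j of Inl c \<Rightarrow> M_plus k \<rho> c | Inr c \<Rightarrow> M_code k c))"

definition twisted_decomposition ::
    "nat \<Rightarrow> (real \<Rightarrow> complex) \<Rightarrow> (24 \<Rightarrow> int) set
      \<Rightarrow> ((24 \<Rightarrow> (real, bit) fock) \<Rightarrow> complex) set
      \<Rightarrow> (((24 \<Rightarrow> (real, bit) fock) \<Rightarrow> complex) \<Rightarrow> int \<Rightarrow> ('i \<Rightarrow> complex) \<Rightarrow> 'i \<Rightarrow> complex)
      \<Rightarrow> ('i \<Rightarrow> complex) set \<Rightarrow> bool" where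
  "twisted_decomposition k \<rho> C A act W \<longleftrightarrow>
     module_iso A act W (dsum_act (vmode (VLplus24 k \<rho>)))
       (dsum (binary_dual (C2 k C) \<times> {..<2 ^ (vec.dim (C2 k C) - 12) :: nat}) (\<lambda>(c, j). MT_minus \<rho> c))"

text \<open>
  \<open>\<sigma>\<close> acts on every irreducible submodule isomorphic to \<open>W\<^sub>1 \<otimes> \<dots> \<otimes> W\<^sub>24\<close> by \<open>\<mu>(W\<^sub>i)\<close>; a submodule
  isomorphic to such a tensor product of irreducible modules is itself irreducible.
\<close>

definition acts_by_mu ::
    "nat \<Rightarrow> (real \<Rightarrow> complex) \<Rightarrow> 24
      \<Rightarrow> (((24 \<Rightarrow> (real, bit) fock) \<Rightarrow> complex) \<Rightarrow> int \<Rightarrow> ('i \<Rightarrow> complex) \<Rightarrow> 'i \<Rightarrow> complex)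
      \<Rightarrow> ('i \<Rightarrow> complex) set \<Rightarrow> (('i \<Rightarrow> complex) \<Rightarrow> 'i \<Rightarrow> complex) \<Rightarrow> bool" where
  "acts_by_mu k \<rho> i act V \<sigma> \<longleftrightarrow>
     (let A = vcarrier (VLplus24 k \<rho>) in
      \<forall>W N. (\<forall>j. W j \<in> irreps k) \<and> submodule A act V N \<and>
        module_iso A act N (vmode (VLplus24 k \<rho>)) (tensor (\<lambda>j. irr_space k \<rho> (W j)))
        \<longrightarrow> (\<forall>v\<in>N. \<sigma> v = cscale (mu (W i)) v))"

end

theory Submission
  imports Defs
begin

text \<open>
  Since \<open>\<sigma>\<close> is a scalar on every summand of the two decompositions, its trace on a weight space is a
  signed sum of graded dimensions. In the twisted part the all-one word lies in \<open>C\<^sub>2\<^sup>\<bottom>\<close>, and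
  exchanging \<open>T\<^sub>0\<close> and \<open>T\<^sub>1\<close> in all tensor factors preserves the weights while it turns the eigenvalue
  \<open>\<plusminus>\<surd>-1\<close> into its negative; this part contributes nothing. In the untwisted part the summands for \<open>c\<close>
  and \<open>-c\<close> have equal dimensions, and \<open>M(c)\<^sup>+\<close> is the fixed space of \<open>\<theta>\<^bsup>\<otimes>24\<^esup>\<close> on \<open>M(c)\<close>. There
  \<open>\<theta>\<^bsup>\<otimes>24\<^esup>\<close> permutes the standard basis up to signs; it has fixed basis vectors only for \<open>c = 0\<close>, where
  its trace is the coefficient of \<open>b\<^bsup>24\<^esup>\<close>.

  That \<open>\<theta>\<close> commutes with the vertex operators of \<open>V\<^sub>L\<^sup>+\<close>, on all cosets and on the twisted modules, is a
  covariance property of the vertex operators under signed permutations of the basis of the Fock space.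
\<close>

section \<open>Supports and monomial maps\<close>

text \<open>The modes are built from \<open>Sum_any\<close> and \<open>lin_ext\<close>, which
  silently return 0 on infinite supports. No general convergence is established: every symmetry in
  use is an injective monomial map and respects these defaults, and \<open>L(0)\<close> is evaluated
  only on basis vectors of untwisted modules, where the sums collapse. Twisted weights are never
  computed; that the exchange preserves them follows from covariance, the conformal vector having
  momentum zero.

  The hypothesis on \<sigma> speaks only of submodules isomorphic to tensor products of listed
  irreducibles. Hence M(c) is cut into sign parts at the coordinates 0 and k, and a factor with
  coordinate above k is replaced by its copy under \<theta>. That the parts are submodules is not
  read off from the vertex operators: the given isomorphism forces each summand to be closed, and
  eigenvalue equations of \<theta> in single factors cut out the part.

  An element g of the class satisfies g h = h \<sigma>, so the decomposition moved by h diagonalises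
  g.\<close>

definition spt :: "'i set \<Rightarrow> ('i \<Rightarrow> complex) set" where
  "spt X = {w. \<forall>x. w x \<noteq> 0 \<longrightarrow> x \<in> X}"

definition fsp :: "'i set \<Rightarrow> ('i \<Rightarrow> complex) set" where
  "fsp X = spt X \<inter> fin_supp"

lemma sum_fun_apply: "(\<Sum>x\<in>A. h x) y = (\<Sum>x\<in>A. h x y)"
  for h :: "'a \<Rightarrow> 'i \<Rightarrow> complex"
  by (induction A rule: infinite_finite_induct) auto

lemma subspace_spt: "cfun.subspace (spt X)"
  unfolding cfun.subspace_def spt_def by (auto simp: cscale_def) (metis add.right_neutral)

lemma subspace_fsp: "cfun.subspace (fsp X)"
  unfolding fsp_def by (intro cfun.subspace_inter subspace_spt subspace_fin_supp)

lemmas spt_intros = cfun.subspace_add[OF subspace_spt] cfun.subspace_scale[OF subspace_spt]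
  cfun.subspace_sum[OF subspace_spt] cfun.subspace_0[OF subspace_spt]

lemma single_spt [simp]: "single x \<in> spt X \<longleftrightarrow> x \<in> X"
  by (auto simp: spt_def single_def)

lemma single_fin_supp [simp]: "single x \<in> fin_supp"
  by (auto simp: fin_supp_def single_def)

lemma single_fsp [simp]: "single x \<in> fsp X \<longleftrightarrow> x \<in> X"
  by (simp add: fsp_def)

text \<open>No finiteness of the family is required: an infinite \<open>Sum_any\<close> is 0, which
  lies in every \<open>spt X\<close>.\<close>

lemma spt_Sum_any: "(\<And>l. F l \<in> spt X) \<Longrightarrow> Sum_any F \<in> spt X"
  unfolding Sum_any.expand_set by (intro spt_intros)

lemma spt_lin_ext:
  assumes "w \<in> spt X" "\<And>x. x \<in> X \<Longrightarrow> F x \<in> spt Y"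
  shows "lin_ext F w \<in> spt Y"
  unfolding lin_ext_def using assms by (intro spt_intros) (auto simp: spt_def)

lemma lin_ext_scale_right: "lin_ext (\<lambda>x. cscale a (F x)) w = cscale a (lin_ext F w)"
  unfolding lin_ext_def cfun.scale_sum_right by (simp add: mult.commute)

lemma lin_ext_zero [simp]: "lin_ext F 0 = 0"
  by (simp add: lin_ext_def)

text \<open>Serves to read \<open>L(0)\<close>, which is diagonal on basis vectors, as pointwise
  multiplication by the weight.\<close>

lemma lin_ext_diag:
  assumes "w \<in> fin_supp" "\<And>x. w x \<noteq> 0 \<Longrightarrow> F x = cscale (d x) (single x)"
  shows "lin_ext F w = (\<lambda>x. d x * w x)"
proof
  fix y
  have fin: "finite {x. w x \<noteq> 0}" using assms(1) by (simp add: fin_supp_def)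
  have "lin_ext F w y = (\<Sum>x | w x \<noteq> 0. w x * (d x * single x y))"
    unfolding lin_ext_def sum_fun_apply by (rule sum.cong) (auto simp: assms(2), auto simp: cscale_def)
  also have "\<dots> = (\<Sum>x | w x \<noteq> 0. if x = y then d y * w y else 0)"
    by (rule sum.cong) (auto simp: single_def)
  also have "\<dots> = d y * w y" using fin by (simp add: sum.delta)
  finally show "lin_ext F w y = d y * w y" .
qed

text \<open>Linearity on all functions, in contrast to \<open>lin_on\<close>: the vectors passed to
  \<open>lin_ext_P\<close> carry no support condition.\<close>

definition lin_map :: "(('i \<Rightarrow> complex) \<Rightarrow> 'j \<Rightarrow> complex) \<Rightarrow> bool" where
  "lin_map P \<longleftrightarrow> (\<forall>v w. P (v + w) = P v + P w) \<and> (\<forall>a v. P (cscale a v) = cscale a (P v))"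

lemma lin_map_zero: "lin_map P \<Longrightarrow> P 0 = 0"
  unfolding lin_map_def by (metis cfun.scale_zero_left)

lemma lin_map_sum: "lin_map P \<Longrightarrow> P (sum h A) = (\<Sum>x\<in>A. P (h x))"
  by (induction A rule: infinite_finite_induct) (auto simp: lin_map_zero lin_map_def)

lemma lin_map_span:
  assumes "lin_map P"
  shows "P ` cfun.span B = cfun.span (P ` B)"
proof -
  interpret Vector_Spaces.linear cscale cscale P
    using assms by unfold_locales (auto simp: lin_map_def)
  show ?thesis by (rule span_image[symmetric])
qed

lemma lin_map_on: "lin_map P \<Longrightarrow> lin_on W P"
  by (simp add: lin_map_def lin_on_def)

text \<open>
  The pullback makes the map linear and, for an involution \<open>\<pi>\<close> and nonvanishing \<open>a\<close>, injective on all
  functions, not only on those of finite support. It therefore commutes with \<open>Sum_any\<close> also where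
  the latter has infinitely many nonzero terms and takes the value \<open>0\<close>.
\<close>

definition monomap :: "('i \<Rightarrow> 'i) \<Rightarrow> ('i \<Rightarrow> complex) \<Rightarrow> ('i \<Rightarrow> complex) \<Rightarrow> 'i \<Rightarrow> complex" where
  "monomap \<pi> a w = (\<lambda>x. a (\<pi> x) * w (\<pi> x))"

lemma lin_map_monomap: "lin_map (monomap \<pi> a)"
  by (auto simp: lin_map_def monomap_def cscale_def fun_eq_iff algebra_simps)

text \<open>Only \<pi> is an involution. The square of P multiplies by
  \<open>a x * a (\<pi> x)\<close>, which need not be 1; for \<theta> it is 1 on the cosets L and
  \<alpha>/2 + L.\<close>

locale monomial =
  fixes \<pi> :: "'i \<Rightarrow> 'i" and a :: "'i \<Rightarrow> complex"
  assumes invol [simp]: "\<pi> (\<pi> x) = x" and nz [simp]: "a x \<noteq> 0"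
begin

abbreviation "P \<equiv> monomap \<pi> a"

lemma P_zero [simp]: "P 0 = 0"
  by (simp add: lin_map_zero lin_map_monomap)

lemma P_scale: "P (cscale b w) = cscale b (P w)"
  using lin_map_monomap unfolding lin_map_def by blast

lemma P_add: "P (v + w) = P v + P w"
  using lin_map_monomap unfolding lin_map_def by blast

lemma P_sum: "P (sum h A) = (\<Sum>x\<in>A. P (h x))"
  by (simp add: lin_map_sum lin_map_monomap)

lemma P_eq_iff: "P v = P w \<longleftrightarrow> v = w"
  by (auto simp: monomap_def fun_eq_iff) (metis invol)

lemma P_eq_0: "P w = 0 \<longleftrightarrow> w = 0"
  using P_eq_iff[of w 0] by simp

lemma P_Sum_any: "P (Sum_any F) = Sum_any (\<lambda>l. P (F l))"
  unfolding Sum_any.expand_set by (simp add: P_sum P_eq_0)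

lemma P_single: "P (single x) = cscale (a x) (single (\<pi> x))"
  by (auto simp: monomap_def single_def cscale_def fun_eq_iff)

lemma \<pi>_eq_iff: "\<pi> x = \<pi> y \<longleftrightarrow> x = y"
  by (metis invol)

lemma P_fin_supp: "P w \<in> fin_supp \<longleftrightarrow> w \<in> fin_supp"
proof -
  have "{x. P w x \<noteq> 0} = \<pi> ` {x. w x \<noteq> 0}"
    by (auto simp: monomap_def image_iff) (metis invol)
  moreover have "inj \<pi>" by (auto intro!: injI simp: \<pi>_eq_iff)
  ultimately show ?thesis
    by (simp add: fin_supp_def finite_image_iff inj_on_subset)
qed

text \<open>The transport principle behind all covariance proofs: nested \<open>lin_ext\<close> are
  moved through P one layer at a time. As \<pi> maps the support of w bijectively onto that of
  \<open>P w\<close>, an infinite support gives the default 0 on both sides.\<close>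

lemma lin_ext_P:
  assumes "lin_map Q" "\<And>x. w x \<noteq> 0 \<Longrightarrow> cscale (a x) (F (\<pi> x)) = Q (G x)"
  shows "lin_ext F (P w) = Q (lin_ext G w)"
proof -
  have "bij_betw \<pi> {x. w x \<noteq> 0} {x. P w x \<noteq> 0}"
    by (rule bij_betwI[where g = \<pi>]) (auto simp: monomap_def)
  then have "lin_ext F (P w) = (\<Sum>x | w x \<noteq> 0. cscale (P w (\<pi> x)) (F (\<pi> x)))"
    unfolding lin_ext_def by (rule sum.reindex_bij_betw[symmetric])
  also have "\<dots> = (\<Sum>x | w x \<noteq> 0. cscale (w x) (Q (G x)))"
    by (rule sum.cong) (auto simp: assms(2)[symmetric], auto simp: monomap_def mult.commute)
  also have "\<dots> = Q (lin_ext G w)"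
    using assms(1) unfolding lin_ext_def by (simp add: lin_map_sum) (simp add: lin_map_def)
  finally show ?thesis .
qed

lemma P_image_fsp: "P ` fsp X = fsp (\<pi> ` X)"
proof -
  have 1: "P w \<in> spt (\<pi> ` X) \<longleftrightarrow> w \<in> spt X" for w X
    by (auto simp: spt_def monomap_def image_iff) (metis invol nz)+
  show ?thesis
  proof (intro set_eqI iffI)
    fix v assume v: "v \<in> fsp (\<pi> ` X)"
    \<comment> \<open>The inverse of P written out, as P itself may fail to be an
      involution.\<close>
    define w where "w = (\<lambda>x. v (\<pi> x) / a x)"
    have "v = P w" by (auto simp: w_def monomap_def)
    then show "v \<in> P ` fsp X" using v by (auto simp: fsp_def P_fin_supp 1)
  qed (auto simp: fsp_def P_fin_supp 1)
qed

end

section \<open>Symmetries of vertex operators\<close>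

fun fock_perm :: "real \<Rightarrow> ('t \<Rightarrow> 't) \<Rightarrow> ('a::real_vector, 't) fock \<Rightarrow> ('a, 't) fock" where
  "fock_perm \<eta> \<phi> (Unt M \<gamma>) = Unt M (\<eta> *\<^sub>R \<gamma>)"
| "fock_perm \<eta> \<phi> (Tw M t) = Tw M (\<phi> t)"

text \<open>\<open>\<eta> ^ size M\<close> comes from h(n) \<mapsto> \<eta> h(n) in every creation
  operator. The twisted sector gets no further scalar: \<phi> merely permutes the basis of the
  second factor.\<close>

fun fock_coeff :: "real \<Rightarrow> ('a \<Rightarrow> complex) \<Rightarrow> ('a, 't) fock \<Rightarrow> complex" where
  "fock_coeff \<eta> g (Unt M \<gamma>) = of_real \<eta> ^ size M * g \<gamma>"
| "fock_coeff \<eta> g (Tw M t) = of_real \<eta> ^ size M"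

text \<open>Twisted basis vectors are left unrestricted, since \<open>vertex_coeff\<close> assigns
  them the zero operator.\<close>

definition unt_over :: "'a set \<Rightarrow> ('a, 't) fock set" where
  "unt_over L = {x. \<forall>M \<gamma>. x = Unt M \<gamma> \<longrightarrow> \<gamma> \<in> L}"

lemma osc_cscale: "osc b n (cscale a w) = cscale a (osc b n w)"
  by (simp add: osc_def lin_ext_cscale)

lemma hosc_cscale: "hosc b n (cscale a w) = cscale a (hosc b n w)"
  by (simp add: hosc_def osc_cscale cfun.scale_sum_right mult.commute)

lemma exp_minus_cscale: "exp_minus s b j (cscale a w) = cscale a (exp_minus s b j w)"
  unfolding exp_minus_def by (rule op_exp_cscale) (simp add: hosc_cscale mult.commute)

lemma exp_plus_cscale: "exp_plus s b j (cscale a w) = cscale a (exp_plus s b j w)"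
  unfolding exp_plus_def by (rule op_exp_cscale) (simp add: hosc_cscale mult.commute)

lemma Sum_any_cscale: "Sum_any (\<lambda>l. cscale a (F l)) = cscale a (Sum_any F)"
  by (cases "a = 0") (simp_all add: Sum_any.expand_set cfun.scale_sum_right)

lemma osc_unt_over:
  assumes "w \<in> spt (unt_over L)"
  shows "osc b n w \<in> spt (unt_over L)"
  unfolding osc_def using assms
  by (rule spt_lin_ext) (auto intro!: spt_intros simp: unt_over_def split: fock.splits elim: map_modes.elims)

lemma op_exp_spt:
  assumes "w \<in> spt X" "\<And>j w. w \<in> spt X \<Longrightarrow> F j w \<in> spt X"
  shows "op_exp F j w \<in> spt X"
proof -
  have "op_pow F r j w \<in> spt X" for r j
    using assms by (induction r arbitrary: j) (auto intro!: spt_intros)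
  then show ?thesis unfolding op_exp_def by (intro spt_intros)
qed

lemma delta_op_unt_over: "w \<in> spt (unt_over L) \<Longrightarrow> delta_op j w \<in> spt (unt_over L)"
  unfolding delta_op_def by (intro spt_intros osc_unt_over)

locale fock_symmetry =
  fixes \<eta> :: real and g :: "'a::euclidean_space \<Rightarrow> complex" and \<phi> :: "'t \<Rightarrow> 't"
  assumes \<eta>: "\<eta> = 1 \<or> \<eta> = -1" and g0: "g \<gamma> \<noteq> 0" and \<phi>: "\<phi> (\<phi> t) = t"
begin

abbreviation "\<pi> \<equiv> fock_perm \<eta> \<phi> :: ('a, 't) fock \<Rightarrow> ('a, 't) fock"
abbreviation "co \<equiv> fock_coeff \<eta> g :: ('a, 't) fock \<Rightarrow> complex"

lemma \<eta>_sq [simp]: "\<eta> * \<eta> = 1" "\<eta> * (\<eta> * x) = x" "complex_of_real \<eta> * complex_of_real \<eta> = 1"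
   "complex_of_real \<eta> * (complex_of_real \<eta> * z) = z"
  using \<eta> by auto

lemma \<eta>_nz [simp]: "\<eta> \<noteq> 0"
  using \<eta> by auto

sublocale monomial \<pi> co
proof
  fix x :: "('a, 't) fock"
  show "\<pi> (\<pi> x) = x" by (cases x) (auto simp: \<phi>)
  show "co x \<noteq> 0" using g0 by (cases x) auto
qed

lemma \<pi>_simps [simp]: "fmodes (\<pi> x) = fmodes x" "sector (\<pi> x) = sector x"
  "\<pi> (map_modes f x) = map_modes f (\<pi> x)"
  by (cases x; simp)+

lemma co_map_modes [simp]: "co (map_modes f x) = of_real \<eta> ^ size (f (fmodes x)) / of_real \<eta> ^ size (fmodes x) * co x"
  by (cases x) auto

text \<open>Creation and annihilation change the number of oscillators by one and hence the sign by
  \<eta>; b(0) reads the momentum, which P scales by \<eta>. So all modes pick up the same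
  factor.\<close>

lemma osc_P: "osc b n (P w) = cscale (of_real \<eta>) (P (osc b n w))"
proof -
  have "osc b n (P w) = P (lin_ext (\<lambda>x. cscale (of_real \<eta>)
     (if n < 0 then single (map_modes (add_mset (b, - n)) x)
     else if n > 0 then
       cscale (of_real (n * real (count (fmodes x) (b, n)))) (single (map_modes (\<lambda>M. M - {#(b, n)#}) x))
     else (case x of Unt M \<gamma> \<Rightarrow> cscale (of_real (b \<bullet> \<gamma>)) (single x) | Tw M t \<Rightarrow> 0))) w)"
    unfolding osc_def
  proof (rule lin_ext_P[OF lin_map_monomap])
    fix x assume "w x \<noteq> 0"
    consider "n < 0" | "n > 0" "(b, n) \<notin># fmodes x" | "n > 0" "(b, n) \<in># fmodes x" | "n = 0" by linarith
    then show "cscale (co x) (if n < 0 then single (map_modes (add_mset (b, - n)) (\<pi> x))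
            else if 0 < n then cscale (of_real (n * real (count (fmodes (\<pi> x)) (b, n)))) (single (map_modes (\<lambda>M. M - {#(b, n)#}) (\<pi> x)))
                 else case \<pi> x of Unt M \<gamma> \<Rightarrow> cscale (of_real (b \<bullet> \<gamma>)) (single (\<pi> x)) | Tw M t \<Rightarrow> 0) =
          P (cscale (of_real \<eta>)
              (if n < 0 then single (map_modes (add_mset (b, - n)) x)
               else if 0 < n then cscale (of_real (n * real (count (fmodes x) (b, n)))) (single (map_modes (\<lambda>M. M - {#(b, n)#}) x))
                    else case x of Unt M \<gamma> \<Rightarrow> cscale (of_real (b \<bullet> \<gamma>)) (single x) | Tw M t \<Rightarrow> 0))"
    proof cases
      case 1 then show ?thesis by (simp add: P_scale P_single)
    next
      \<comment> \<open>Removing an absent mode would leave the multiset, and thus the sign,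
        unchanged; the vanishing \<open>count\<close> kills this term.\<close>
      case 2 then show ?thesis by (simp add: P_scale P_single not_in_iff)
    next
      case 3
      then have s: "size (fmodes x) = Suc (size (fmodes x - {#(b, n)#}))" by (simp add: size_Suc_Diff1)
      show ?thesis using 3 by (simp add: P_scale P_single s mult.commute)
    next
      case 4 then show ?thesis by (cases x) (auto simp: P_scale P_single mult_ac)
    qed
  qed
  then show ?thesis unfolding lin_ext_scale_right P_scale osc_def .
qed

text \<open>Passing from \<beta> to \<eta> \<beta> absorbs the sign of \<open>osc_P\<close>, so the
  exponentials built from the two correspond without a scalar.\<close>

lemma hosc_P: "hosc (\<eta> *\<^sub>R \<beta>) n (P w) = P (hosc \<beta> n w)"
  unfolding hosc_def P_sum by (rule sum.cong) (auto simp: osc_P P_scale mult_ac)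

lemma op_exp_P:
  assumes "\<And>j w. G j (P w) = P (F j w)"
  shows "op_exp G j (P w) = P (op_exp F j w)"
proof -
  have "op_pow G r j (P w) = P (op_pow F r j w)" for r j
    by (induction r arbitrary: j) (auto simp: P_sum assms simp del: zero_fun_apply)
  then show ?thesis unfolding op_exp_def by (simp add: P_sum P_scale)
qed

lemma exp_minus_P: "exp_minus s (\<eta> *\<^sub>R \<beta>) j (P w) = P (exp_minus s \<beta> j w)"
  unfolding exp_minus_def by (rule op_exp_P) (simp add: hosc_P P_scale del: zero_fun_apply)

lemma exp_plus_P: "exp_plus s (\<eta> *\<^sub>R \<beta>) j (P w) = P (exp_plus s \<beta> j w)"
  unfolding exp_plus_def by (rule op_exp_P) (simp add: hosc_P P_scale del: zero_fun_apply of_real_minus)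

text \<open>The oscillators occur in pairs, so their signs cancel.\<close>

lemma delta_op_P: "delta_op j (P w) = P (delta_op j w)"
  unfolding delta_op_def by (simp add: P_sum P_scale osc_P osc_cscale)

text \<open>c collects the scalars so far, and each oscillator in front adds one \<eta>. Homogeneity
  of \<Psi> is used where \<open>osc\<close> acts before \<Psi> and its sign has to be pulled
  out.\<close>

lemma normal_ordered_P:
  assumes "\<And>x w. cscale c (\<Psi> x (P w)) = P (\<Phi> x w)" and "\<And>x a w. \<Psi> x (cscale a w) = cscale a (\<Psi> x w)"
  shows "cscale (of_real \<eta> * c) (normal_ordered s bn \<Psi> x (P w)) = P (normal_ordered s bn \<Phi> x w)"
proof -
  obtain b n where bn: "bn = (b, n)" by (cases bn)
  show ?thesis
    unfolding normal_ordered_def bn prod.case Let_def P_Sum_any Sum_any_cscale[symmetric]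
  proof (rule arg_cong[where f = Sum_any], rule ext)
    fix l :: int
    have o: "P (osc b m u) = cscale (of_real \<eta>) (osc b m (P u))" for m u
      by (simp add: osc_P)
    have "cscale (of_real \<eta> * c) (\<Psi> y (osc b m (P w))) = P (\<Phi> y (osc b m w))" for y m
      by (simp add: osc_P assms(2) assms(1)[symmetric] mult_ac)
    moreover have "cscale (of_real \<eta> * c) (osc b m (\<Psi> y (P w))) = P (osc b m (\<Phi> y w))" for y m
      unfolding o assms(1)[symmetric] osc_cscale by simp
    ultimately have "cscale (of_real \<eta> * c)
        (if Q then osc b m (\<Psi> y (P w)) else \<Psi> y (osc b m (P w))) =
       P (if Q then osc b m (\<Phi> y w) else \<Phi> y (osc b m w))" for Q m y
      by simp
    note * = this[symmetric]
    show "cscale (of_real \<eta> * c) (cscale (of_real (- (of_int l + s) - 1 gchoose (nat \<lfloor>n\<rfloor> - 1)))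
        (if of_int l + s < 0 then osc b (of_int l + s) (\<Psi> (x + (of_int l + s) + n) (P w))
         else \<Psi> (x + (of_int l + s) + n) (osc b (of_int l + s) (P w)))) =
      P (cscale (of_real (- (of_int l + s) - 1 gchoose (nat \<lfloor>n\<rfloor> - 1)))
        (if of_int l + s < 0 then osc b (of_int l + s) (\<Phi> (x + (of_int l + s) + n) w)
         else \<Phi> (x + (of_int l + s) + n) (osc b (of_int l + s) w)))"
      unfolding P_scale * by (simp only: cfun.scale_scale mult_ac)
  qed
qed

lemma normal_ordered_cscale:
  assumes "\<And>x a w. \<Psi> x (cscale a w) = cscale a (\<Psi> x w)"
  shows "normal_ordered s bn \<Psi> x (cscale a w) = cscale a (normal_ordered s bn \<Psi> x w)"
proof -
  obtain b n where bn: "bn = (b, n)" by (cases bn)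
  show ?thesis
    unfolding normal_ordered_def bn prod.case Let_def Sum_any_cscale[symmetric]
    by (rule arg_cong[where f = Sum_any], rule ext) (auto simp: assms osc_cscale mult_ac)
qed

text \<open>Homogeneity is part of the induction because \<open>normal_ordered_P\<close> asks for it
  at every stage. With c = g \<beta> the accumulated scalar is the \<open>fock_coeff\<close> of the
  basis vector \<open>Unt M \<beta>\<close>.\<close>

lemma foldr_normal_ordered_P:
  assumes "\<And>x w. cscale c (\<Psi> x (P w)) = P (\<Phi> x w)" and "\<And>x a w. \<Psi> x (cscale a w) = cscale a (\<Psi> x w)"
  shows "cscale (of_real \<eta> ^ length bs * c) (foldr (normal_ordered s) bs \<Psi> x (P w)) = P (foldr (normal_ordered s) bs \<Phi> x w)
    \<and> foldr (normal_ordered s) bs \<Psi> x (cscale a w) = cscale a (foldr (normal_ordered s) bs \<Psi> x w)"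
proof (induction bs arbitrary: x w a)
  case Nil then show ?case using assms by simp
next
  case (Cons bn bs)
  from Cons.IH show ?case
    using normal_ordered_P[of "of_real \<eta> ^ length bs * c" "foldr (normal_ordered s) bs \<Psi>" "foldr (normal_ordered s) bs \<Phi>" s bn x w]
      normal_ordered_cscale[of "foldr (normal_ordered s) bs \<Psi>" s bn x a w]
    by (simp add: mult_ac)
qed

end

text \<open>
  Used with \<open>\<eta> = -1\<close> and \<open>L = \<int>\<alpha>\<close> for \<open>\<theta>\<close>, and with \<open>\<eta> = 1\<close> and \<open>L = {0}\<close> for the exchange of \<open>T\<^sub>0\<close> and
  \<open>T\<^sub>1\<close>, which commutes only with the vertex operators of momentum zero.
\<close>

locale vertex_symmetry = fock_symmetry \<eta> g \<phi>
  for \<eta> :: real and g :: "'a::euclidean_space \<Rightarrow> complex" and \<phi> :: "'t \<Rightarrow> 't" +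
  fixes L :: "'a set" and R :: "'a \<Rightarrow> ('t \<Rightarrow> complex) \<Rightarrow> 't \<Rightarrow> complex"
  assumes g_add: "\<beta> \<in> L \<Longrightarrow> g (\<beta> + \<gamma>) = g \<beta> * g \<gamma>"
    and R: "\<beta> \<in> L \<Longrightarrow> cscale (g \<beta>) (R (\<eta> *\<^sub>R \<beta>) (single (\<phi> t))) = (\<lambda>t'. R \<beta> (single t) (\<phi> t'))"
begin

text \<open>Lifts the intertwining condition on R from the factor indexed by 't to the vectors
  \<open>Tw M t'\<close>; the power of \<eta> on the right undoes the sign contained in P.\<close>

lemma twisted_factor_P:
  assumes "\<beta> \<in> L"
  shows "cscale (g \<beta>) (lin_ext (\<lambda>t'. single (Tw M t')) (R (\<eta> *\<^sub>R \<beta>) (single (\<phi> t)))) =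
    cscale (of_real \<eta> ^ size M) (P (lin_ext (\<lambda>t'. single (Tw M t')) (R \<beta> (single t))))"
proof -
  interpret tw: monomial \<phi> "\<lambda>_. 1" by unfold_locales (auto simp: \<phi>)
  have "cscale (g \<beta>) (lin_ext (\<lambda>t'. single (Tw M t')) (R (\<eta> *\<^sub>R \<beta>) (single (\<phi> t)))) =
      lin_ext (\<lambda>t'. single (Tw M t')) (tw.P (R \<beta> (single t)))"
    unfolding lin_ext_cscale[symmetric] R[OF assms] by (simp add: monomap_def)
  also have "\<dots> = (\<lambda>w. cscale (of_real \<eta> ^ size M) (P w)) (lin_ext (\<lambda>t'. single (Tw M t')) (R \<beta> (single t)))"
  proof (rule tw.lin_ext_P)
    show "lin_map (\<lambda>w. cscale (of_real \<eta> ^ size M) (P w))"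
      unfolding lin_map_def by (auto simp: P_add P_scale cfun.scale_right_distrib mult.commute)
  qed (simp add: P_single flip: power_mult_distrib)
  finally show ?thesis .
qed

lemma group_act_P:
  assumes "\<beta> \<in> L"
  shows "cscale (g \<beta> * co y) (group_act (\<lambda>_ _. 1) R (\<eta> *\<^sub>R \<beta>) (\<pi> y)) = P (group_act (\<lambda>_ _. 1) R \<beta> y)"
proof (cases y)
  case (Unt M \<gamma>)
  then show ?thesis using g_add[OF assms] by (simp add: group_act_def P_single scaleR_add_right mult_ac)
next
  case (Tw M t)
  have n: "(\<eta> *\<^sub>R \<beta>) \<bullet> (\<eta> *\<^sub>R \<beta>) = \<beta> \<bullet> \<beta>" by simp
  have "cscale (g \<beta> * co y) (group_act (\<lambda>_ _. 1) R (\<eta> *\<^sub>R \<beta>) (\<pi> y)) =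
      cscale (of_real \<eta> ^ size M * of_real (2 powr (- (\<beta> \<bullet> \<beta>))))
        (cscale (g \<beta>) (lin_ext (\<lambda>t'. single (Tw M t')) (R (\<eta> *\<^sub>R \<beta>) (single (\<phi> t)))))"
    unfolding Tw group_act_def fock_perm.simps fock.case n by (simp add: mult_ac)
  also have "\<dots> = P (group_act (\<lambda>_ _. 1) R \<beta> y)"
    unfolding twisted_factor_P[OF assms] Tw group_act_def fock.case P_scale
    by (simp add: mult_ac flip: power_mult_distrib)
  finally show ?thesis .
qed

lemma exp_field_P:
  assumes "\<beta> \<in> L"
  shows "cscale (g \<beta>) (exp_field (\<lambda>_ _. 1) R (\<eta> *\<^sub>R \<beta>) x (P w)) = P (exp_field (\<lambda>_ _. 1) R \<beta> x w)"
proof -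
  \<comment> \<open>Both momenta are scaled by \<eta>, so the exponent of z stays the same and the
    two double sums match term by term.\<close>
  have z: "zpower (\<eta> *\<^sub>R \<beta>) (\<pi> y) = zpower \<beta> y" for y
    by (cases y) (auto simp: zpower_def)
  have 1: "cscale (g \<beta> * co y) (exp_minus s (\<eta> *\<^sub>R \<beta>) i (exp_plus s (\<eta> *\<^sub>R \<beta>) j (group_act (\<lambda>_ _. 1) R (\<eta> *\<^sub>R \<beta>) (\<pi> y)))) =
     P (exp_minus s \<beta> i (exp_plus s \<beta> j (group_act (\<lambda>_ _. 1) R \<beta> y)))" for s i j y
    by (simp add: exp_minus_cscale[symmetric] exp_plus_cscale[symmetric] group_act_P[OF assms] exp_plus_P exp_minus_P
      del: cfun.scale_scale)
  show ?thesis
    unfolding exp_field_def lin_ext_scale_right[symmetric]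
  proof (rule lin_ext_P[OF lin_map_monomap])
    fix y assume "w y \<noteq> 0"
    show "cscale (co y) (cscale (g \<beta>) (\<Sum>(i, j). if real i / 2 - real j / 2 + zpower (\<eta> *\<^sub>R \<beta>) (\<pi> y) = x
             then exp_minus (sector (\<pi> y)) (\<eta> *\<^sub>R \<beta>) i (exp_plus (sector (\<pi> y)) (\<eta> *\<^sub>R \<beta>) j (group_act (\<lambda>_ _. 1) R (\<eta> *\<^sub>R \<beta>) (\<pi> y)))
             else 0)) = P (\<Sum>(i, j). if real i / 2 - real j / 2 + zpower \<beta> y = x
             then exp_minus (sector y) \<beta> i (exp_plus (sector y) \<beta> j (group_act (\<lambda>_ _. 1) R \<beta> y)) else 0)"
      unfolding P_Sum_any cfun.scale_scale mult.commute[of "co y"] Sum_any_cscale[symmetric] z \<pi>_simps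
      by (rule arg_cong[where f = Sum_any], rule ext) (auto simp: 1)
  qed
qed

lemma vertex_coeff_P:
  assumes "v \<in> spt (unt_over L)"
  shows "vertex_coeff (\<lambda>_ _. 1) R (P v) x (P w) = P (vertex_coeff (\<lambda>_ _. 1) R v x w)"
  unfolding vertex_coeff_def
proof (rule lin_ext_P[OF lin_map_monomap])
  fix u assume u: "v u \<noteq> 0"
  show "cscale (co u) (case \<pi> u of
      Unt M \<beta> \<Rightarrow> (let bs = (SOME bs. mset bs = M) in
         lin_ext (\<lambda>y. foldr (normal_ordered (sector y)) bs (exp_field (\<lambda>_ _. 1) R \<beta>) x (single y)) (P w))
    | Tw M t \<Rightarrow> 0) = P (case u of
      Unt M \<beta> \<Rightarrow> (let bs = (SOME bs. mset bs = M) in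
         lin_ext (\<lambda>y. foldr (normal_ordered (sector y)) bs (exp_field (\<lambda>_ _. 1) R \<beta>) x (single y)) w)
    | Tw M t \<Rightarrow> 0)"
  proof (cases u)
    case (Unt M \<beta>)
    have \<beta>: "\<beta> \<in> L" using u assms by (auto simp: Unt spt_def unt_over_def)
    \<comment> \<open>\<pi> does not touch M, so both sides choose the same enumeration.\<close>
    define bs where "bs = (SOME bs. mset bs = M)"
    have "mset bs = M" unfolding bs_def by (rule someI_ex) (rule ex_mset)
    then have len: "length bs = size M" by (metis size_mset)
    have f: "cscale (of_real \<eta> ^ length bs * g \<beta>)
          (foldr (normal_ordered s) bs (exp_field (\<lambda>_ _. 1) R (\<eta> *\<^sub>R \<beta>)) x (P w)) =
        P (foldr (normal_ordered s) bs (exp_field (\<lambda>_ _. 1) R \<beta>) x w)"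
      "foldr (normal_ordered s) bs (exp_field (\<lambda>_ _. 1) R (\<eta> *\<^sub>R \<beta>)) x (cscale a w) =
        cscale a (foldr (normal_ordered s) bs (exp_field (\<lambda>_ _. 1) R (\<eta> *\<^sub>R \<beta>)) x w)" for s w a
      using foldr_normal_ordered_P[where c = "g \<beta>" and \<Psi> = "exp_field (\<lambda>_ _. 1) R (\<eta> *\<^sub>R \<beta>)" and \<Phi> = "exp_field (\<lambda>_ _. 1) R \<beta>"]
        exp_field_P[OF \<beta>] by (auto simp: exp_field_def lin_ext_cscale)
    have "cscale (co u) (lin_ext (\<lambda>y. foldr (normal_ordered (sector y)) bs (exp_field (\<lambda>_ _. 1) R (\<eta> *\<^sub>R \<beta>)) x (single y)) (P w))
      = P (lin_ext (\<lambda>y. foldr (normal_ordered (sector y)) bs (exp_field (\<lambda>_ _. 1) R \<beta>) x (single y)) w)"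
      unfolding lin_ext_scale_right[symmetric]
    proof (rule lin_ext_P[OF lin_map_monomap])
      fix y
      show "cscale (co y) (cscale (co u) (foldr (normal_ordered (sector (\<pi> y))) bs (exp_field (\<lambda>_ _. 1) R (\<eta> *\<^sub>R \<beta>)) x (single (\<pi> y)))) =
         P (foldr (normal_ordered (sector y)) bs (exp_field (\<lambda>_ _. 1) R \<beta>) x (single y))"
        unfolding f(1)[symmetric] P_single f(2) by (simp add: Unt len mult_ac)
    qed
    then show ?thesis by (simp add: Unt bs_def[symmetric])
  qed simp
qed

text \<open>The correction by \<open>delta_op\<close> commutes with P and does not change momenta,
  so the twisted sector also reduces to \<open>vertex_coeff_P\<close>.\<close>

lemma fock_mode_P:
  assumes v: "v \<in> spt (unt_over L)"
  shows "fock_mode (\<lambda>_ _. 1) R (P v) p (P w) = P (fock_mode (\<lambda>_ _. 1) R v p w)"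
proof -
  have vs: "cscale a (vertex_coeff (\<lambda>_ _. 1) R u x w) = vertex_coeff (\<lambda>_ _. 1) R u x (cscale a w)" for u x a and w :: "('a, 't) fvec"
    unfolding vertex_coeff_def lin_ext_scale_right[symmetric]
    by (rule arg_cong[where f = "\<lambda>F. lin_ext F u"], rule ext)
      (auto simp: Let_def lin_ext_cscale split: fock.split)
  have d: "op_exp delta_op r (P v) = P (op_exp delta_op r v)" for r
    by (rule op_exp_P) (rule delta_op_P)
  have dv: "op_exp delta_op r v \<in> spt (unt_over L)" for r
    by (intro op_exp_spt v delta_op_unt_over)
  show ?thesis
    unfolding fock_mode_def
  proof (rule lin_ext_P[OF lin_map_monomap])
    fix y
    have y: "cscale (co y) (single (\<pi> y)) = P (single y)" by (simp add: P_single)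
    show "cscale (co y) (case \<pi> y of
      Unt M \<gamma> \<Rightarrow> vertex_coeff (\<lambda>_ _. 1) R (P v) (- of_int p - 1) (single (\<pi> y))
    | Tw M t \<Rightarrow> Sum_any (\<lambda>r::nat. vertex_coeff (\<lambda>_ _. 1) R (op_exp delta_op r (P v)) (- of_int p - 1 + real r) (single (\<pi> y)))) =
      P (case y of
      Unt M \<gamma> \<Rightarrow> vertex_coeff (\<lambda>_ _. 1) R v (- of_int p - 1) (single y)
    | Tw M t \<Rightarrow> Sum_any (\<lambda>r::nat. vertex_coeff (\<lambda>_ _. 1) R (op_exp delta_op r v) (- of_int p - 1 + real r) (single y)))"
    proof (cases y)
      case (Unt M \<gamma>)
      then show ?thesis using y
        by (simp add: vs del: fock_coeff.simps) (simp add: vertex_coeff_P[OF v])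
    next
      case (Tw M t)
      have "cscale (co y) (Sum_any (\<lambda>r::nat. vertex_coeff (\<lambda>_ _. 1) R (op_exp delta_op r (P v)) (- of_int p - 1 + real r) (single (\<pi> y)))) =
        P (Sum_any (\<lambda>r::nat. vertex_coeff (\<lambda>_ _. 1) R (op_exp delta_op r v) (- of_int p - 1 + real r) (single y)))"
        unfolding Sum_any_cscale[symmetric] P_Sum_any vs y d vertex_coeff_P[OF dv] ..
      then show ?thesis by (simp add: Tw del: fock_coeff.simps)
    qed
  qed
qed

end

section \<open>Vertex operators preserve the sectors\<close>

text \<open>The VOA axioms only say that modes preserve the sum of the two halves of the moonshine
  module; the sector of the support then tells the halves apart. Therefore \<epsilon> and R are
  arbitrary in this section.\<close>

definition in_sector :: "real \<Rightarrow> ('a, 't) fock set" where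
  "in_sector s = {x. sector x = s}"

lemma sector_map_modes [simp]: "sector (map_modes f x) = sector x"
  by (cases x) auto

lemma osc_in_sector: "w \<in> spt (in_sector s) \<Longrightarrow> osc b n w \<in> spt (in_sector s)"
  unfolding osc_def by (rule spt_lin_ext) (auto intro!: spt_intros simp: in_sector_def split: fock.splits)

lemma hosc_in_sector: "w \<in> spt (in_sector s) \<Longrightarrow> hosc b n w \<in> spt (in_sector s)"
  unfolding hosc_def by (intro spt_intros osc_in_sector)

lemma exp_minus_in_sector: "w \<in> spt (in_sector s) \<Longrightarrow> exp_minus r \<beta> j w \<in> spt (in_sector s)"
  unfolding exp_minus_def by (rule op_exp_spt) (auto intro!: spt_intros hosc_in_sector)

lemma exp_plus_in_sector: "w \<in> spt (in_sector s) \<Longrightarrow> exp_plus r \<beta> j w \<in> spt (in_sector s)"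
  unfolding exp_plus_def by (rule op_exp_spt) (auto intro!: spt_intros hosc_in_sector simp del: of_real_minus)

lemma group_act_in_sector: "y \<in> in_sector s \<Longrightarrow> group_act \<epsilon> R \<beta> y \<in> spt (in_sector s)"
  unfolding group_act_def
  by (auto intro!: spt_intros spt_lin_ext[of _ UNIV] simp: in_sector_def simp del: cfun.scale_minus_left split: fock.splits)
    (auto simp: spt_def)

lemma exp_field_in_sector: "w \<in> spt (in_sector s) \<Longrightarrow> exp_field \<epsilon> R \<beta> x w \<in> spt (in_sector s)"
  unfolding exp_field_def
  by (rule spt_lin_ext) (auto intro!: spt_Sum_any spt_intros exp_minus_in_sector exp_plus_in_sector group_act_in_sector)

lemma normal_ordered_in_sector:
  assumes "\<And>x w. w \<in> spt (in_sector s) \<Longrightarrow> \<Phi> x w \<in> spt (in_sector s)" "w \<in> spt (in_sector s)"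
  shows "normal_ordered r bn \<Phi> x w \<in> spt (in_sector s)"
  unfolding normal_ordered_def Let_def
  by (cases bn) (auto intro!: spt_Sum_any spt_intros osc_in_sector assms)

lemma vertex_coeff_in_sector:
  assumes "w \<in> spt (in_sector s)"
  shows "vertex_coeff \<epsilon> R v x w \<in> spt (in_sector s)"
proof -
  have "foldr (normal_ordered r) bs (exp_field \<epsilon> R \<beta>) x w \<in> spt (in_sector s)"
    if "w \<in> spt (in_sector s)" for r bs \<beta> x w
    using that by (induction bs arbitrary: x w) (auto intro!: normal_ordered_in_sector exp_field_in_sector)
  then show ?thesis
    unfolding vertex_coeff_def Let_def
    by (intro spt_lin_ext[of _ UNIV]) (auto simp: spt_def[of UNIV] intro!: spt_intros spt_lin_ext[OF assms] split: fock.split)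
qed

lemma fock_mode_in_sector:
  assumes "w \<in> spt (in_sector s)"
  shows "fock_mode \<epsilon> R v p w \<in> spt (in_sector s)"
  unfolding fock_mode_def
  by (rule spt_lin_ext[OF assms]) (auto intro!: spt_Sum_any vertex_coeff_in_sector split: fock.split)

section \<open>Tensor products\<close>

lemma pure_tensor_single: "pure_tensor (\<lambda>j. single (f j)) = single f"
  for f :: "'n::finite \<Rightarrow> 'i"
proof
  fix g
  show "pure_tensor (\<lambda>j. single (f j)) g = single f g"
  proof (cases "g = f")
    case False
    then obtain j where "g j \<noteq> f j" by blast
    then show ?thesis using False by (auto simp: pure_tensor_def single_def intro!: prod_zero)
  qed (auto simp: pure_tensor_def single_def)
qed

lemma pure_tensor_cscale: "pure_tensor (\<lambda>j. cscale (b j) (w j)) = cscale (\<Prod>j\<in>UNIV. b j) (pure_tensor w)"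
  by (simp add: pure_tensor_def cscale_def prod.distrib)

lemma tensor_subspace: "cfun.subspace (tensor W)"
  unfolding tensor_def by (rule cfun.subspace_span)

lemma pure_tensor_in_tensor: "(\<And>j. w j \<in> W j) \<Longrightarrow> pure_tensor w \<in> tensor W"
  unfolding tensor_def by (intro cfun.span_base) auto

lemma tensor_mono: "(\<And>j. W j \<subseteq> W' j) \<Longrightarrow> tensor W \<subseteq> tensor W'"
  unfolding tensor_def by (intro cfun.span_mono) blast

lemma fin_supp_in_span:
  assumes "w \<in> fsp X"
  shows "w \<in> cfun.span (single ` X)"
proof -
  have "w = (\<Sum>x | w x \<noteq> 0. cscale (w x) (single x))"
    using assms by (intro expansion) (simp add: fsp_def)
  also have "\<dots> \<in> cfun.span (single ` X)"
    using assms by (intro cfun.span_sum cfun.span_scale cfun.span_base) (auto simp: fsp_def spt_def)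
  finally show ?thesis .
qed

lemma span_singles: "cfun.span (single ` X) = fsp X"
  by (intro antisym cfun.span_minimal subspace_fsp) (auto intro: fin_supp_in_span)

text \<open>Makes M(c) a coordinate subspace, so that its graded dimensions become counts of index
  tuples.\<close>

lemma tensor_fsp:
  fixes X :: "'n::finite \<Rightarrow> 'i set"
  shows "tensor (\<lambda>j. fsp (X j)) = fsp {f. \<forall>j. f j \<in> X j}"
proof
  show "tensor (\<lambda>j. fsp (X j)) \<subseteq> fsp {f. \<forall>j. f j \<in> X j}"
    unfolding tensor_def
  proof (rule cfun.span_minimal[OF _ subspace_fsp], safe)
    fix w :: "'n \<Rightarrow> 'i \<Rightarrow> complex" assume w: "\<forall>i. w i \<in> fsp (X i)"
    have nz: "pure_tensor w f \<noteq> 0 \<longleftrightarrow> (\<forall>j. w j (f j) \<noteq> 0)" for f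
      by (simp add: pure_tensor_def)
    have "finite (PiE UNIV (\<lambda>j. {x. w j x \<noteq> 0}))"
      using w by (intro finite_PiE) (auto simp: fsp_def fin_supp_def)
    moreover have "PiE UNIV (\<lambda>j. {x. w j x \<noteq> 0}) = {f. pure_tensor w f \<noteq> 0}"
      by (auto simp: nz)
    ultimately show "pure_tensor w \<in> fsp {f. \<forall>j. f j \<in> X j}"
      using w nz by (auto simp: fsp_def fin_supp_def spt_def)
  qed
  show "fsp {f. \<forall>j. f j \<in> X j} \<subseteq> tensor (\<lambda>j. fsp (X j))"
    unfolding span_singles[symmetric]
  proof (rule cfun.span_minimal[OF _ tensor_subspace], safe)
    fix f assume f: "\<forall>j. f j \<in> X j"
    have "pure_tensor (\<lambda>j. single (f j)) \<in> tensor (\<lambda>j. cfun.span (single ` X j))"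
      using f by (intro pure_tensor_in_tensor) (auto simp: span_singles)
    then show "single f \<in> tensor (\<lambda>j. cfun.span (single ` X j))" by (simp only: pure_tensor_single)
  qed
qed

text \<open>The factors may carry different maps: \<theta> in some of them and the identity in the
  others gives the partial symmetries used below.\<close>

locale tensor_monomial =
  fixes \<pi> :: "'n::finite \<Rightarrow> 'i \<Rightarrow> 'i" and a :: "'n \<Rightarrow> 'i \<Rightarrow> complex"
  assumes factor: "monomial (\<pi> j) (a j)"
begin

abbreviation "\<pi>t \<equiv> \<lambda>f j. \<pi> j (f j)"
abbreviation "ct \<equiv> \<lambda>f. \<Prod>j\<in>UNIV. a j (f j)"

sublocale monomial \<pi>t ct
  using factor by unfold_locales (auto simp: monomial_def)

lemma P_pure_tensor: "P (pure_tensor w) = pure_tensor (\<lambda>j. monomap (\<pi> j) (a j) (w j))"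
  by (simp add: monomap_def pure_tensor_def prod.distrib)

lemma P_tensor: "P ` tensor W = tensor (\<lambda>j. monomap (\<pi> j) (a j) ` W j)"
proof -
  have "P ` {pure_tensor w |w. \<forall>i. w i \<in> W i} = {pure_tensor w |w. \<forall>i. w i \<in> monomap (\<pi> i) (a i) ` W i}"
  proof (intro set_eqI iffI)
    fix v assume "v \<in> {pure_tensor w |w. \<forall>i. w i \<in> monomap (\<pi> i) (a i) ` W i}"
    then obtain w where v: "v = pure_tensor w" and "\<forall>i. \<exists>u. u \<in> W i \<and> w i = monomap (\<pi> i) (a i) u" by blast
    then obtain u where "\<And>i. u i \<in> W i" "\<And>i. w i = monomap (\<pi> i) (a i) (u i)" by metis
    then have "w = (\<lambda>j. monomap (\<pi> j) (a j) (u j))" "\<forall>i. u i \<in> W i" by auto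
    then have "v = P (pure_tensor u)" "\<forall>i. u i \<in> W i" unfolding P_pure_tensor v by auto
    then show "v \<in> P ` {pure_tensor w |w. \<forall>i. w i \<in> W i}" by blast
  next
    fix v assume "v \<in> P ` {pure_tensor w |w. \<forall>i. w i \<in> W i}"
    then obtain w where "v = P (pure_tensor w)" and w: "\<forall>i. w i \<in> W i" by blast
    then have "v = pure_tensor (\<lambda>j. monomap (\<pi> j) (a j) (w j))" by (simp only: P_pure_tensor)
    with w show "v \<in> {pure_tensor w |w. \<forall>i. w i \<in> monomap (\<pi> i) (a i) ` W i}" by blast
  qed
  then show ?thesis unfolding tensor_def by (simp add: lin_map_span lin_map_monomap)
qed

text \<open>X restricts only the acting indices x; the indices y of module vectors are arbitrary. P
  leaves the mode tuples alone, so the sums over them agree termwise.\<close>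

lemma tensor_mode_P:
  assumes Y: "\<And>a u n b w. Y (cscale a u) n (cscale b w) = cscale (a * b) (Y u n w)"
    and cov: "\<And>j x n y. x \<in> X \<Longrightarrow>
      monomap (\<pi> j) (a j) (Y (single x) n (single y)) =
      Y (monomap (\<pi> j) (a j) (single x)) n (monomap (\<pi> j) (a j) (single y))"
    and u: "u \<in> spt {f. \<forall>j. f j \<in> X}"
  shows "tensor_mode Y (P u) p (P w) = P (tensor_mode Y u p w)"
  unfolding tensor_mode_def
proof (rule lin_ext_P[OF lin_map_monomap])
  fix f assume "u f \<noteq> 0"
  then have f: "f j \<in> X" for j using u by (auto simp: spt_def)
  let ?F = "\<lambda>f g \<nu>. if (\<Sum>i\<in>UNIV. \<nu> i + 1) = p + 1
                    then pure_tensor (\<lambda>i. Y (single (f i)) (\<nu> i) (single (g i))) else 0"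
  show "cscale (ct f) (lin_ext (\<lambda>g. Sum_any (?F (\<pi>t f) g)) (P w)) = P (lin_ext (\<lambda>g. Sum_any (?F f g)) w)"
    unfolding lin_ext_scale_right[symmetric]
  proof (rule lin_ext_P[OF lin_map_monomap])
    fix g
    have "cscale (ct g * ct f) (pure_tensor (\<lambda>i. Y (single (\<pi> i (f i))) (\<nu> i) (single (\<pi> i (g i))))) =
        P (pure_tensor (\<lambda>i. Y (single (f i)) (\<nu> i) (single (g i))))" for \<nu>
      unfolding P_pure_tensor cov[OF f] monomial.P_single[OF factor] Y pure_tensor_cscale
      by (simp add: prod.distrib mult.commute)
    then have "cscale (ct g * ct f) (?F (\<pi>t f) (\<pi>t g) \<nu>) = P (?F f g \<nu>)" for \<nu>
      by simp
    then show "cscale (ct g) (cscale (ct f) (Sum_any (?F (\<pi>t f) (\<pi>t g)))) = P (Sum_any (?F f g))"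
      unfolding P_Sum_any cfun.scale_scale Sum_any_cscale[symmetric] by simp
  qed
qed

end

lemma tensor_mode_cscale: "tensor_mode Y u p (cscale b w) = cscale b (tensor_mode Y u p w)"
  unfolding tensor_mode_def lin_ext_cscale lin_ext_scale_right ..

lemma tensor_mode_zero: "tensor_mode Y u p 0 = 0"
  using tensor_mode_cscale[of Y u p 0 0] by simp

lemma tensor_mode_add:
  assumes "v \<in> fin_supp" "w \<in> fin_supp"
  shows "tensor_mode Y u p (v + w) = tensor_mode Y u p v + tensor_mode Y u p w"
  unfolding tensor_mode_def lin_ext_add[OF assms]
  unfolding lin_ext_def[of _ u] by (simp add: cfun.scale_right_distrib sum.distrib)


section \<open>Sign decompositions of tensor products\<close>

lemma psgn_sq [simp]: "psgn e * psgn e = 1" "psgn e * (psgn e * z) = z"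
  by (auto simp: psgn_def)

lemma prod_UNIV_restrict: "(\<Prod>j\<in>UNIV. if j \<in> T then h j else 1) = (\<Prod>j\<in>T. h j)"
  for T :: "'n::finite set"
  by (simp add: prod.If_cases)

lemma prod_if_split:
  fixes T :: "'n::finite set"
  shows "(\<Prod>j\<in>UNIV. (if j \<in> T then h j else h' j) (f j)) = (\<Prod>j\<in>T. h j (f j)) * (\<Prod>j\<in>-T. h' j (f j))"
proof -
  have "(\<Prod>j\<in>UNIV. (if j \<in> T then h j else h' j) (f j)) = (\<Prod>j\<in>UNIV. if j \<in> T then h j (f j) else h' j (f j))"
    by (rule prod.cong) auto
  then show ?thesis by (simp add: prod.If_cases)
qed

text \<open>S collects factors on which the monomial map is an involution of X j; for M(c) these are
  the coordinates 0 and k. Elsewhere \<theta> leads to another coset, and the factor stays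
  whole.\<close>

locale sign_split =
  fixes \<pi> :: "'n::finite \<Rightarrow> 'i \<Rightarrow> 'i" and a :: "'n \<Rightarrow> 'i \<Rightarrow> complex"
    and X :: "'n \<Rightarrow> ('i \<Rightarrow> complex) set" and S :: "'n set"
  assumes mon: "monomial (\<pi> j) (a j)" and X_sub: "cfun.subspace (X j)"
    and X_closed: "j \<in> S \<Longrightarrow> w \<in> X j \<Longrightarrow> monomap (\<pi> j) (a j) w \<in> X j"
    and X_invol: "j \<in> S \<Longrightarrow> w \<in> X j \<Longrightarrow> monomap (\<pi> j) (a j) (monomap (\<pi> j) (a j) w) = w"
begin

abbreviation "PP T \<equiv> monomap (\<lambda>f j. if j \<in> T then \<pi> j (f j) else f j) (\<lambda>f. \<Prod>j\<in>UNIV. if j \<in> T then a j (f j) else 1)"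

definition part :: "('n \<Rightarrow> bool) \<Rightarrow> 'n \<Rightarrow> ('i \<Rightarrow> complex) set" where
  "part e j = (if j \<in> S then {w \<in> X j. monomap (\<pi> j) (a j) w = cscale (psgn (e j)) w} else X j)"

lemma PP_eq: "PP T = monomap (\<lambda>f j. (if j \<in> T then \<pi> j else id) (f j)) (\<lambda>f. \<Prod>j\<in>UNIV. (if j \<in> T then a j else (\<lambda>_. 1)) (f j))"
  by (intro arg_cong2[where f = monomap] ext prod.cong) auto

lemma PP_pure: "PP T (pure_tensor w) = pure_tensor (\<lambda>j. if j \<in> T then monomap (\<pi> j) (a j) (w j) else w j)"
proof -
  interpret tensor_monomial "\<lambda>j. if j \<in> T then \<pi> j else id" "\<lambda>j. if j \<in> T then a j else (\<lambda>_. 1)"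
    using mon by unfold_locales (auto simp: monomial_def)
  show ?thesis unfolding PP_eq P_pure_tensor
    by (rule arg_cong[where f = pure_tensor]) (auto simp: monomap_def)
qed

lemma part_subset: "part e j \<subseteq> X j"
  by (auto simp: part_def)

lemma PP_part:
  assumes "w \<in> tensor (part e)" "T \<subseteq> S"
  shows "PP T w = cscale (\<Prod>j\<in>T. psgn (e j)) w"
proof -
  let ?N = "{w. PP T w = cscale (\<Prod>j\<in>T. psgn (e j)) w}"
  have "cfun.subspace ?N"
    using lin_map_monomap[of "\<lambda>f j. if j \<in> T then \<pi> j (f j) else f j" "\<lambda>f. \<Prod>j\<in>UNIV. if j \<in> T then a j (f j) else 1"]
    unfolding cfun.subspace_def lin_map_def
    by (auto simp: lin_map_zero[OF lin_map_monomap] cfun.scale_right_distrib mult.commute)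
  moreover have "pure_tensor w \<in> ?N" if "\<forall>j. w j \<in> part e j" for w
  proof -
    have "(\<lambda>j. if j \<in> T then monomap (\<pi> j) (a j) (w j) else w j) =
        (\<lambda>j. cscale (if j \<in> T then psgn (e j) else 1) (w j))"
    proof
      fix j show "(if j \<in> T then monomap (\<pi> j) (a j) (w j) else w j) = cscale (if j \<in> T then psgn (e j) else 1) (w j)"
        using spec[OF that, of j] assms(2) by (auto simp: part_def)
    qed
    then show ?thesis unfolding mem_Collect_eq PP_pure by (simp add: pure_tensor_cscale prod_UNIV_restrict)
  qed
  ultimately have "tensor (part e) \<subseteq> ?N"
    unfolding tensor_def by (intro cfun.span_minimal) blast
  then show ?thesis using assms(1) by blast
qed

lemma proj_in_part:
  assumes "w \<in> X j" "j \<in> S"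
  shows "w + cscale (psgn s) (monomap (\<pi> j) (a j) w) \<in> {w \<in> X j. monomap (\<pi> j) (a j) w = cscale (psgn s) w}"
proof -
  interpret monomial "\<pi> j" "a j" by (rule mon)
  have "P (w + cscale (psgn s) (P w)) = cscale (psgn s) (w + cscale (psgn s) (P w))"
    unfolding P_add P_scale X_invol[OF assms(2,1)] by (simp add: cfun.scale_right_distrib add.commute)
  then show ?thesis
    using assms X_sub[of j] X_closed[of j w] by (auto intro!: cfun.subspace_add cfun.subspace_scale)
qed

text \<open>The sum over T is the expanded product over S of the operators 1 +
  \<open>psgn (e j)\<close> times the j-th factor map, each of them twice the projection to an
  eigenspace. A pure tensor thus becomes a pure tensor of projected factors.\<close>

lemma proj_tensor:
  assumes "w \<in> tensor X"
  shows "(\<Sum>T\<in>Pow S. cscale (\<Prod>j\<in>T. psgn (e j)) (PP T w)) \<in> tensor (part e)"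
proof -
  let ?Q = "\<lambda>w. \<Sum>T\<in>Pow S. cscale (\<Prod>j\<in>T. psgn (e j)) (PP T w)"
  have lin: "PP T (v + w) = PP T v + PP T w" "PP T (cscale b v) = cscale b (PP T v)" for T v w b
    using lin_map_monomap unfolding lin_map_def by blast+
  have Q: "?Q (v + w) = ?Q v + ?Q w" "?Q (cscale b v) = cscale b (?Q v)" for v w b
    unfolding lin by (simp_all add: cfun.scale_right_distrib sum.distrib cfun.scale_sum_right mult.commute)
  have "cfun.subspace {w. ?Q w \<in> tensor (part e)}"
    unfolding cfun.subspace_def mem_Collect_eq Q
    by (intro conjI ballI allI) (auto simp: lin_map_zero[OF lin_map_monomap] intro: cfun.subspace_0 cfun.subspace_add cfun.subspace_scale tensor_subspace)
  moreover have "?Q (pure_tensor w) \<in> tensor (part e)" if w: "\<forall>j. w j \<in> X j" for w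
  proof -
    let ?v = "\<lambda>j. if j \<in> S then w j + cscale (psgn (e j)) (monomap (\<pi> j) (a j) (w j)) else w j"
    have "?Q (pure_tensor w) = pure_tensor ?v"
    proof
      fix f
      have "pure_tensor ?v f = (\<Prod>j\<in>S. psgn (e j) * monomap (\<pi> j) (a j) (w j) (f j) + w j (f j)) * (\<Prod>j\<in>-S. w j (f j))"
        unfolding pure_tensor_def prod_if_split by (simp add: cscale_def add.commute)
      also have "\<dots> = (\<Sum>T\<in>Pow S. (\<Prod>j\<in>T. psgn (e j)) * PP T (pure_tensor w) f)"
        unfolding prod_add[OF finite] sum_distrib_right
      proof (rule sum.cong[OF refl])
        fix T assume T: "T \<in> Pow S"
        have "PP T (pure_tensor w) f = (\<Prod>j\<in>T. monomap (\<pi> j) (a j) (w j) (f j)) * (\<Prod>j\<in>-T. w j (f j))"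
          unfolding PP_pure unfolding pure_tensor_def prod_if_split ..
        moreover have "(\<Prod>j\<in>-T. w j (f j)) = (\<Prod>j\<in>S - T. w j (f j)) * (\<Prod>j\<in>-S. w j (f j))"
          using T by (subst prod.union_disjoint[symmetric]) (auto intro!: prod.cong)
        ultimately show "(\<Prod>j\<in>T. psgn (e j) * monomap (\<pi> j) (a j) (w j) (f j)) * (\<Prod>j\<in>S - T. w j (f j)) * (\<Prod>j\<in>-S. w j (f j))
          = (\<Prod>j\<in>T. psgn (e j)) * PP T (pure_tensor w) f"
          by (simp add: prod.distrib mult_ac)
      qed
      finally show "?Q (pure_tensor w) f = pure_tensor ?v f"
        by (simp add: sum_fun_apply cscale_def)
    qed
    moreover have "?v j \<in> part e j" for j
      using w proj_in_part[of "w j" j "e j"] by (auto simp: part_def)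
    ultimately show ?thesis by (auto intro: pure_tensor_in_tensor)
  qed
  ultimately have "tensor X \<subseteq> {w. ?Q w \<in> tensor (part e)}"
    unfolding tensor_def[of X] by (intro cfun.span_minimal) blast
  then show ?thesis using assms by blast
qed

text \<open>A span of pure tensors is hard to recognise after applying a mode; the eigenvalue
  equations on the right pass through covariant operators.\<close>

lemma tensor_part_iff:
  "w \<in> tensor (part e) \<longleftrightarrow> w \<in> tensor X \<and> (\<forall>T\<subseteq>S. PP T w = cscale (\<Prod>j\<in>T. psgn (e j)) w)"
proof
  assume "w \<in> tensor (part e)"
  then show "w \<in> tensor X \<and> (\<forall>T\<subseteq>S. PP T w = cscale (\<Prod>j\<in>T. psgn (e j)) w)"
    using PP_part tensor_mono[of "part e" X] part_subset by blast
next
  assume w: "w \<in> tensor X \<and> (\<forall>T\<subseteq>S. PP T w = cscale (\<Prod>j\<in>T. psgn (e j)) w)"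
  \<comment> \<open>The signs square to 1, so on a joint eigenvector every term of the expanded
    projector equals w.\<close>
  have "(\<Sum>T\<in>Pow S. cscale (\<Prod>j\<in>T. psgn (e j)) (PP T w)) = (\<Sum>T\<in>Pow S. w)"
    using w by (intro sum.cong) (auto simp flip: prod.distrib)
  also have "\<dots> = cscale (of_nat (card (Pow S))) w"
    by (simp add: cscale_def fun_eq_iff sum_fun_apply)
  finally have "cscale (of_nat (card (Pow S))) w \<in> tensor (part e)"
    using proj_tensor[of w e] w by simp
  from cfun.subspace_scale[OF tensor_subspace this, of "1 / of_nat (card (Pow S))"]
  show "w \<in> tensor (part e)" by (simp add: card_Pow)
qed

lemma tensor_in_span_parts: "tensor X \<subseteq> cfun.span (\<Union>e. tensor (part e))"
  unfolding tensor_def[of X]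
proof (rule cfun.span_minimal[OF _ cfun.subspace_span], safe)
  fix w assume w: "\<forall>j. w j \<in> X j"
  \<comment> \<open>Inside S the two summands are the \<plusminus> projections of w j. Outside S
    both signs stand for the same space, so w j is divided evenly between them; expanding the
    product then runs over all e.\<close>
  let ?h = "\<lambda>j s. if j \<in> S then cscale (1 / 2) (w j + cscale (psgn s) (monomap (\<pi> j) (a j) (w j))) else cscale (1 / 2) (w j)"
  have h: "?h j s \<in> part e j" if "e j = s" for e j s
    using w proj_in_part[of "w j" j "e j"] that X_sub[of j] monomial.P_scale[OF mon]
    by (auto simp: part_def mult.commute simp del: cfun.scale_right_distrib intro!: cfun.subspace_scale)
  have "w j x = (\<Sum>s\<in>UNIV. ?h j s x)" for j x
    by (simp add: UNIV_bool psgn_def cscale_def field_simps)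
  then have "pure_tensor w = (\<Sum>e\<in>UNIV. pure_tensor (\<lambda>j. ?h j (e j)))"
    unfolding pure_tensor_def by (simp add: fun_eq_iff sum_fun_apply prod_sum_PiE)
  also have "\<dots> \<in> cfun.span (\<Union>e. tensor (part e))"
    by (intro cfun.span_sum cfun.span_base) (blast intro: pure_tensor_in_tensor h)
  finally show "pure_tensor w \<in> cfun.span (\<Union>e. tensor (part e))" .
qed

text \<open>The product of all factor maps acts on the part of e by the product of its signs. Hence
  w + Q w is 2 w on even parts and 0 on odd ones, and a fixed w is half of w + Q w.\<close>

lemma even_parts_eq:
  assumes "S = UNIV"
  shows "cfun.span (\<Union>e\<in>{e. (\<Prod>j\<in>UNIV. psgn (e j)) = 1}. tensor (part e)) = {w \<in> tensor X. PP UNIV w = w}"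
    (is "cfun.span ?E = ?F")
proof -
  define Q where "Q = PP UNIV"
  have Q_part: "Q w = cscale (\<Prod>j\<in>UNIV. psgn (e j)) w" if "w \<in> tensor (part e)" for e w
    using PP_part[OF that, of UNIV] assms by (simp add: Q_def)
  have lin: "Q (v + w) = Q v + Q w" "Q (cscale b v) = cscale b (Q v)" "Q 0 = 0" for v w b
    unfolding Q_def using lin_map_monomap lin_map_zero[OF lin_map_monomap] unfolding lin_map_def by blast+
  let ?F' = "{w \<in> tensor X. Q w = w}"
  have "cfun.subspace ?F'"
    using tensor_subspace[of X] unfolding cfun.subspace_def by (auto simp: lin)
  moreover have "?E \<subseteq> ?F'" 
  proof safe
    fix w e assume e: "(\<Prod>j\<in>UNIV. psgn (e j)) = 1" and w: "w \<in> tensor (part e)"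
    from w show "w \<in> tensor X" by (simp add: tensor_part_iff)
    show "Q w = w" unfolding Q_part[OF w] e by simp
  qed
  ultimately have 1: "cfun.span ?E \<subseteq> ?F'" by (intro cfun.span_minimal)
  have sub: "cfun.subspace {w. w + Q w \<in> cfun.span ?E}"
    unfolding cfun.subspace_def mem_Collect_eq
  proof (intro conjI ballI allI)
    fix v w assume "v \<in> {w. w + Q w \<in> cfun.span ?E}" "w \<in> {w. w + Q w \<in> cfun.span ?E}"
    then have "(v + Q v) + (w + Q w) \<in> cfun.span ?E"
      using cfun.span_add[of "v + Q v" ?E "w + Q w"] by blast
    then show "(v + w) + Q (v + w) \<in> cfun.span ?E" by (simp only: lin add_ac)
  next
    fix b w assume "w \<in> {w. w + Q w \<in> cfun.span ?E}"
    then have "cscale b (w + Q w) \<in> cfun.span ?E"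
      using cfun.span_scale[of "w + Q w" ?E b] by blast
    then show "cscale b w + Q (cscale b w) \<in> cfun.span ?E" by (simp only: lin cfun.scale_right_distrib)
  qed (simp add: lin cfun.span_zero)
  have parts: "w + Q w \<in> cfun.span ?E" if "w \<in> tensor (part e)" for e w
  proof -
    have w: "Q w = cscale (\<Prod>j\<in>UNIV. psgn (e j)) w" using that by (rule Q_part)
    have "(\<Prod>j\<in>UNIV. psgn (e j)) * (\<Prod>j\<in>UNIV. psgn (e j)) = 1" by (simp flip: prod.distrib)
    then have "(\<Prod>j\<in>UNIV. psgn (e j)) = 1 \<or> (\<Prod>j\<in>UNIV. psgn (e j)) = -1"
      by (simp add: square_eq_1_iff)
    then show ?thesis
    proof
      assume "(\<Prod>j\<in>UNIV. psgn (e j)) = 1"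
      with that have m: "w \<in> cfun.span ?E" by (intro cfun.span_base) blast
      have "Q w = w" unfolding w \<open>(\<Prod>j\<in>UNIV. psgn (e j)) = 1\<close> by simp
      with m have "Q w \<in> cfun.span ?E" by (simp only:)
      with m show ?thesis by (rule cfun.span_add)
    next
      assume "(\<Prod>j\<in>UNIV. psgn (e j)) = -1"
      then have "w + Q w = 0" unfolding w by (auto simp: cscale_def)
      then show ?thesis by (simp only: cfun.span_zero)
    qed
  qed
  have "(\<Union>e. tensor (part e)) \<subseteq> {w. w + Q w \<in> cfun.span ?E}"
    using parts by (intro UN_least subsetI CollectI)
  then have sub: "tensor X \<subseteq> {w. w + Q w \<in> cfun.span ?E}"
    by (intro order_trans[OF tensor_in_span_parts] cfun.span_minimal sub)
  have "?F' \<subseteq> cfun.span ?E"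
  proof
    fix w assume "w \<in> ?F'"
    then have "w \<in> tensor X" and Qw: "Q w = w" by blast+
    from subsetD[OF sub this(1)] have "w + Q w \<in> cfun.span ?E" by (rule CollectD)
    then have "cscale (1 / 2) (w + w) \<in> cfun.span ?E" unfolding Qw by (rule cfun.span_scale)
    moreover have "cscale (1 / 2) (w + w) = w" by (rule ext) (simp add: cscale_def)
    ultimately show "w \<in> cfun.span ?E" by (simp only:)
  qed
  with 1 have "cfun.span ?E = ?F'" by (rule equalityI)
  then show ?thesis unfolding Q_def .
qed

end

section \<open>Dimensions and traces\<close>

interpretation cpair: vector_space_pair cscale cscale
  by unfold_locales

lemma linear_iff_lin_map: "Vector_Spaces.linear cscale cscale P \<longleftrightarrow> lin_map P"
  by (simp add: Vector_Spaces.linear_iff lin_map_def cfun.vector_space_axioms)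

text \<open>Modes and module maps are linear on a carrier only; a total linear map with the same
  values there gives access to general linear algebra.\<close>

lemma lin_on_extend:
  assumes "cfun.subspace W" "lin_on W f"
  shows "\<exists>g. lin_map g \<and> (\<forall>w\<in>W. g w = f w)"
proof -
  obtain B where B: "B \<subseteq> W" "cfun.independent B" "W \<subseteq> cfun.span B"
    using cfun.maximal_independent_subset by blast
  obtain g where g: "lin_map g" "\<forall>b\<in>B. g b = f b"
    using cpair.linear_independent_extend[OF B(2), of f] by (auto simp: linear_iff_lin_map)
  have sB: "cfun.span B \<subseteq> W" using B(1) assms(1) by (rule cfun.span_minimal)
  have "w \<in> W \<and> g w = f w" if "w \<in> cfun.span B" for w
    using that
  proof (induction rule: cfun.span_induct_alt)
    case base
    have "f 0 = 0" using assms(2) cfun.subspace_0[OF assms(1)] unfolding lin_on_def by (metis cscale_simps(2))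
    then show ?case using g(1) by (simp add: lin_map_zero assms(1) cfun.subspace_0)
  next
    case (step c b v)
    then have "b \<in> W" "v \<in> W" "cscale c b \<in> W" "g v = f v" using B(1) assms(1) by (auto intro: cfun.subspace_scale)
    moreover have "f (cscale c b + v) = cscale c (f b) + f v"
      using assms(2) calculation unfolding lin_on_def by metis
    moreover have "g (cscale c b + v) = cscale c (f b) + f v"
      using g step calculation unfolding lin_map_def by metis
    ultimately show ?case using assms(1) by (metis cfun.subspace_add)
  qed
  with g(1) B(3) show ?thesis by blast
qed

lemma lin_on_subset: "lin_on W f \<Longrightarrow> W' \<subseteq> W \<Longrightarrow> lin_on W' f"
  unfolding lin_on_def by blast

lemma lin_on_zero: "lin_on W f \<Longrightarrow> 0 \<in> W \<Longrightarrow> f 0 = 0"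
  unfolding lin_on_def by (metis cscale_simps(2))

lemma lin_on_sum:
  assumes "lin_on W f" "cfun.subspace W" "\<And>x. x \<in> A \<Longrightarrow> h x \<in> W"
  shows "f (sum h A) = (\<Sum>x\<in>A. f (h x))"
proof -
  obtain g where g: "lin_map g" "\<forall>w\<in>W. g w = f w" using lin_on_extend[OF assms(2,1)] by blast
  have "sum h A \<in> W" using assms by (intro cfun.subspace_sum) auto
  then have "f (sum h A) = (\<Sum>x\<in>A. g (h x))" using g by (simp add: lin_map_sum[symmetric])
  also have "\<dots> = (\<Sum>x\<in>A. f (h x))" using g(2) assms(3) by (intro sum.cong) auto
  finally show ?thesis .
qed

lemma lin_on_compose: "lin_on W f \<Longrightarrow> lin_on W' g \<Longrightarrow> f ` W \<subseteq> W' \<Longrightarrow> lin_on W (\<lambda>w. g (f w))"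
  unfolding lin_on_def by (simp add: image_subset_iff)

lemma lin_on_subspace_image:
  assumes "cfun.subspace W" "lin_on W f"
  shows "cfun.subspace (f ` W)"
proof -
  obtain g where g: "lin_map g" "\<forall>w\<in>W. g w = f w" using lin_on_extend[OF assms(1,2)] by blast
  then have "f ` W = g ` W" by (auto simp: image_iff)
  then show ?thesis using cpair.linear_subspace_image[of g W] g assms(1) by (simp add: linear_iff_lin_map)
qed

lemma independent_lin_on_image:
  assumes "cfun.subspace W" "lin_on W f" "inj_on f W" "cfun.independent B" "B \<subseteq> W"
  shows "cfun.independent (f ` B)"
proof -
  obtain g where g: "lin_map g" "\<forall>w\<in>W. g w = f w" using lin_on_extend[OF assms(1,2)] by blast
  have sB: "cfun.span B \<subseteq> W" using assms by (intro cfun.span_minimal)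
  have "cfun.independent (g ` B)"
  proof (rule cpair.linear_independent_injective_image)
    show "inj_on g (cfun.span B)" using assms(3) sB g(2) by (auto simp: inj_on_def subset_iff)
  qed (use g assms in \<open>auto simp: linear_iff_lin_map\<close>)
  also have "g ` B = f ` B" using g(2) assms(5) by (auto simp: subset_iff image_iff)
  finally show ?thesis .
qed

text \<open>Both sides are cardinalities of corresponding bases, so the equation also covers the
  default 0 in infinite dimension.\<close>

lemma dim_lin_on_bij:
  assumes "cfun.subspace W" "lin_on W f" "inj_on f W" "f ` W = W'"
  shows "cfun.dim W' = cfun.dim W"
proof -
  obtain B where B: "B \<subseteq> W" "cfun.independent B" "W \<subseteq> cfun.span B" "card B = cfun.dim W"
    using cfun.basis_exists by blast
  obtain g where g: "lin_map g" "\<forall>w\<in>W. g w = f w" using lin_on_extend[OF assms(1,2)] by blast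
  have sB: "cfun.span B = W" using B cfun.span_minimal[OF B(1) assms(1)] by blast
  have "cfun.span (f ` B) = W'"
  proof -
    have "f ` B = g ` B" using g(2) B(1) by (auto simp: subset_iff image_iff)
    then have "cfun.span (f ` B) = g ` W" using lin_map_span[OF g(1), of B] sB by simp
    also have "\<dots> = W'" using g(2) assms(4) by (auto simp: image_iff)
    finally show ?thesis .
  qed
  moreover have "cfun.independent (f ` B)" using independent_lin_on_image[OF assms(1-3) B(2,1)] .
  ultimately have "cfun.dim W' = card (f ` B)" using cfun.dim_span_eq_card_independent by metis
  also have "\<dots> = card B" using assms(3) B(1) by (intro card_image) (auto intro: inj_on_subset)
  finally show ?thesis using B(4) by simp
qed

section \<open>Coordinate subspaces, traces and direct sums\<close>

lemma independent_singles: "cfun.independent (single ` X)"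
proof
  assume "cfun.dependent (single ` X)"
  then obtain x where x: "x \<in> X" "single x \<in> cfun.span (single ` X - {single x})"
    unfolding cfun.dependent_def by blast
  have "cfun.span (single ` X - {single x}) \<subseteq> cfun.span (single ` (X - {x}))"
    by (intro cfun.span_mono) auto
  with x(2) have "single x \<in> fsp (X - {x})" unfolding span_singles by blast
  then show False by simp
qed

lemma inj_single: "inj single"
  by (auto simp: inj_def single_def fun_eq_iff split: if_splits)

lemma dim_fsp: "cfun.dim (fsp X) = card X"
proof -
  have "cfun.dim (fsp X) = card (single ` X)"
    unfolding span_singles[symmetric] by (intro cfun.dim_span_eq_card_independent independent_singles)
  also have "\<dots> = card X" by (intro card_image inj_on_subset[OF inj_single]) simp
  finally show ?thesis .
qed

text \<open>\<open>trace_on\<close> takes its basis B' by choice. Expanding f b in B' and then each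
  c in B gives a double sum; summed in the other order it is the trace in B'.\<close>

lemma trace_on_basis:
  assumes B: "finite B" "cfun.independent B" "cfun.span B = W"
    and f: "lin_on W f" "f ` W \<subseteq> W"
  shows "trace_on W f = (\<Sum>b\<in>B. cfun.representation B (f b) b)"
proof -
  define B' where "B' = (SOME B. B \<subseteq> W \<and> cfun.independent B \<and> cfun.span B = W)"
  have "B \<subseteq> W" using B(3) cfun.span_superset by blast
  with B have "\<exists>B. B \<subseteq> W \<and> cfun.independent B \<and> cfun.span B = W" by blast
  from someI_ex[OF this] have B': "B' \<subseteq> W" "cfun.independent B'" "cfun.span B' = W"
    unfolding B'_def by blast+
  then have fin: "finite B'" using cfun.independent_span_bound[OF B(1), of B'] B(3) by blast
  have sub: "cfun.subspace W" using B(3) cfun.subspace_span by metis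
  let ?r = "cfun.representation B" and ?r' = "cfun.representation B'"
  have e: "(\<Sum>b\<in>B. cscale (?r v b) b) = v" and e': "(\<Sum>c\<in>B'. cscale (?r' v c) c) = v" if "v \<in> W" for v
    using that B B' fin by (auto intro!: cfun.sum_representation_eq)
  have "(\<Sum>b\<in>B. ?r (f b) b) = (\<Sum>b\<in>B. \<Sum>c\<in>B'. ?r' (f b) c * ?r c b)"
  proof (rule sum.cong[OF refl])
    fix b assume "b \<in> B"
    then have fb: "f b \<in> W" using \<open>B \<subseteq> W\<close> f(2) by blast
    have c: "cscale (?r' (f b) c) c \<in> cfun.span B" if "c \<in> B'" for c
      unfolding B(3) using that B'(1) sub by (auto intro: cfun.subspace_scale)
    have "?r (f b) b = ?r (\<Sum>c\<in>B'. cscale (?r' (f b) c) c) b" using e'[OF fb] by simp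
    also have "\<dots> = (\<Sum>c\<in>B'. ?r (cscale (?r' (f b) c) c) b)"
      by (simp only: cfun.representation_sum[OF B(2) c])
    also have "\<dots> = (\<Sum>c\<in>B'. ?r' (f b) c * ?r c b)"
      using B(2,3) B'(1) by (intro sum.cong refl) (subst cfun.representation_scale, auto)
    finally show "?r (f b) b = (\<Sum>c\<in>B'. ?r' (f b) c * ?r c b)" .
  qed
  also have "\<dots> = (\<Sum>c\<in>B'. \<Sum>b\<in>B. ?r c b * ?r' (f b) c)"
    by (subst sum.swap) (simp add: mult.commute)
  also have "\<dots> = (\<Sum>c\<in>B'. ?r' (f c) c)"
  proof (rule sum.cong[OF refl])
    fix c assume "c \<in> B'"
    then have c: "c \<in> W" using B'(1) by blast
    have bW: "b \<in> W" "f b \<in> W" if "b \<in> B" for b using that \<open>B \<subseteq> W\<close> f(2) by blast+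
    have "f c = f (\<Sum>b\<in>B. cscale (?r c b) b)" using e[OF c] by simp
    also have "\<dots> = (\<Sum>b\<in>B. f (cscale (?r c b) b))"
      using bW by (intro lin_on_sum[OF f(1) sub] cfun.subspace_scale sub) auto
    also have "\<dots> = (\<Sum>b\<in>B. cscale (?r c b) (f b))"
      using f(1) bW by (intro sum.cong refl) (auto simp: lin_on_def)
    finally have "?r' (f c) c = ?r' (\<Sum>b\<in>B. cscale (?r c b) (f b)) c" by simp
    also have "\<dots> = (\<Sum>b\<in>B. ?r' (cscale (?r c b) (f b)) c)"
    proof -
      have "cscale (?r c b) (f b) \<in> cfun.span B'" if "b \<in> B" for b
        unfolding B'(3) using bW[OF that] sub by (auto intro: cfun.subspace_scale)
      then show ?thesis by (simp only: cfun.representation_sum[OF B'(2)])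
    qed
    also have "\<dots> = (\<Sum>b\<in>B. ?r c b * ?r' (f b) c)"
      using B'(2,3) bW by (intro sum.cong refl) (subst cfun.representation_scale, auto)
    finally show "(\<Sum>b\<in>B. ?r c b * ?r' (f b) c) = ?r' (f c) c" by simp
  qed
  finally show ?thesis unfolding trace_on_def Let_def B'_def by simp
qed

text \<open>A direct sum given by injections from model spaces: the models may live over another
  index type than V, and dimensions are counted there.\<close>

locale decomposition =
  fixes J :: "'j set" and U :: "'j \<Rightarrow> ('i \<Rightarrow> complex) set" and K :: "'j \<Rightarrow> ('i \<Rightarrow> complex) \<Rightarrow> 'k \<Rightarrow> complex"
    and V :: "('k \<Rightarrow> complex) set"
  assumes J: "finite J" and U: "j \<in> J \<Longrightarrow> cfun.subspace (U j)" and V: "cfun.subspace V"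
    and K: "j \<in> J \<Longrightarrow> lin_on (U j) (K j)" "j \<in> J \<Longrightarrow> K j ` U j \<subseteq> V"
    and uniq: "(\<And>j. j \<in> J \<Longrightarrow> u j \<in> U j) \<Longrightarrow> (\<Sum>j\<in>J. K j (u j)) = 0 \<Longrightarrow> j \<in> J \<Longrightarrow> u j = 0"
    and surj: "v \<in> V \<Longrightarrow> \<exists>u. (\<forall>j\<in>J. u j \<in> U j) \<and> v = (\<Sum>j\<in>J. K j (u j))"
begin

lemma K_in: "j \<in> J \<Longrightarrow> x \<in> U j \<Longrightarrow> K j x \<in> V"
  using K(2) by (auto simp: image_subset_iff)

text \<open>Bases of the models are pushed forward by K j. The finite spanning set F bounds each of
  them, because uniqueness makes every K j injective.\<close>

lemma adapted_basis:
  assumes "finite F" "V \<subseteq> cfun.span F"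
  obtains B where "\<And>j. j \<in> J \<Longrightarrow> finite (B j)" "\<And>j. j \<in> J \<Longrightarrow> B j \<subseteq> U j"
    "\<And>j. j \<in> J \<Longrightarrow> card (B j) = cfun.dim (U j)" "inj_on (\<lambda>(j, b). K j b) (Sigma J B)"
    "cfun.independent ((\<lambda>(j, b). K j b) ` Sigma J B)" "cfun.span ((\<lambda>(j, b). K j b) ` Sigma J B) = V"
proof -
  have "\<exists>B. B \<subseteq> U j \<and> cfun.independent B \<and> U j \<subseteq> cfun.span B \<and> card B = cfun.dim (U j)" for j
    by (rule cfun.basis_exists[of "U j"]) (rule exI, intro conjI)
  then obtain B where B': "\<forall>j. B j \<subseteq> U j \<and> cfun.independent (B j) \<and> U j \<subseteq> cfun.span (B j) \<and> card (B j) = cfun.dim (U j)"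
    using choice[of "\<lambda>j B. B \<subseteq> U j \<and> cfun.independent B \<and> U j \<subseteq> cfun.span B \<and> card B = cfun.dim (U j)"] by (meson)
  have B: "B j \<subseteq> U j" "cfun.independent (B j)" "U j \<subseteq> cfun.span (B j)"
    "card (B j) = cfun.dim (U j)" for j by (simp_all add: B'[rule_format])
  have Kz: "K j 0 = 0" if "j \<in> J" for j
    using lin_on_zero[OF K(1)] U that cfun.subspace_0 by blast
  \<comment> \<open>Uniqueness applied to the family concentrated at j.\<close>
  have K0: "u = 0" if "j \<in> J" "u \<in> U j" "K j u = 0" for j u
  proof -
    have "(\<Sum>i\<in>J. K i (if i = j then u else 0)) = (\<Sum>i\<in>J. if i = j then K i u else 0)"
      by (intro sum.cong) (auto simp: Kz simp del: zero_fun_apply)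
    also have "\<dots> = 0" using that J by (simp add: sum.delta)
    finally have "(if j = j then u else 0) = 0"
      using that U cfun.subspace_0 by (intro uniq[of "\<lambda>i. if i = j then u else 0"]) auto
    then show ?thesis by simp
  qed
  have Kinj: "inj_on (K j) (U j)" if j: "j \<in> J" for j
  proof (rule inj_onI)
    fix x y assume xy: "x \<in> U j" "y \<in> U j" "K j x = K j y"
    obtain g where g: "lin_map g" "\<forall>w\<in>U j. g w = K j w" using lin_on_extend[OF U[OF j] K(1)[OF j]] by blast
    have d: "x - y \<in> U j" using xy U[OF j] by (intro cfun.subspace_diff)
    have "g (x - y) + g y = g x" using g(1) unfolding lin_map_def by (metis diff_add_cancel)
    then have "K j (x - y) = 0" using g(2) xy d by (metis add_cancel_left_left)
    from K0[OF j d this] show "x = y" by simp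
  qed
  have fin: "finite (B j)" if j: "j \<in> J" for j
  proof -
    have "cfun.independent (K j ` B j)" by (intro independent_lin_on_image[OF U[OF j] K(1)[OF j] Kinj[OF j]] B)
    moreover have "K j ` B j \<subseteq> cfun.span F" using B(1)[of j] K(2)[OF j] assms(2) by blast
    ultimately have "finite (K j ` B j)" using cfun.independent_span_bound[OF assms(1)] by blast
    then show ?thesis using Kinj[OF j] B(1)[of j] by (auto dest: finite_imageD intro: inj_on_subset)
  qed
  have scal: "h (j, b) = 0" if h: "(\<Sum>j\<in>J. K j (\<Sum>b\<in>B j. cscale (h (j, b)) b)) = 0" and jb: "j \<in> J" "b \<in> B j" for h j b
  proof -
    have "(\<Sum>b\<in>B j. cscale (h (j, b)) b) = 0"
      using jb U B(1) h by (intro uniq[of "\<lambda>j. \<Sum>b\<in>B j. cscale (h (j, b)) b"] cfun.subspace_sum cfun.subspace_scale) blast+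
    then show ?thesis
      using B(2)[of j, unfolded cfun.independent_explicit_finite_subsets, rule_format,
          of "B j" "\<lambda>b. h (j, b)" b] fin[OF jb(1)] jb(2) by simp
  qed
  let ?e = "\<lambda>(j, b). K j b"
  have inj: "inj_on ?e (Sigma J B)"
  proof (rule inj_onI, clarify)
    fix i b j c assume ij: "i \<in> J" "b \<in> B i" "j \<in> J" "c \<in> B j" and eq: "K i b = K j c"
    have b0: "b \<noteq> 0" using ij(2) B(2)[of i] cfun.dependent_zero by blast
    show "i = j \<and> b = c"
    proof (cases "i = j")
      case True
      then show ?thesis using Kinj[OF ij(1)] eq ij B(1)[of j] by (auto dest: inj_onD)
    next
      case False
      \<comment> \<open>A common image of two different summands would be a nontrivial relation: b
        at place i and -c at place j.\<close>
      let ?u = "\<lambda>k. if k = i then b else if k = j then cscale (-1) c else 0"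
      have cU: "c \<in> U j" and bU: "b \<in> U i" using ij B(1) by blast+
      have "K j (cscale (-1) c) = cscale (-1) (K j c)" using K(1)[OF ij(3)] cU unfolding lin_on_def by blast
      then have "(\<Sum>k\<in>J. K k (?u k)) = (\<Sum>k\<in>J. (if k = i then K i b else 0) + (if k = j then cscale (-1) (K j c) else 0))"
        using False by (intro sum.cong refl) (auto simp: Kz simp del: zero_fun_apply)
      also have "\<dots> = K i b + cscale (-1) (K j c)"
        using ij J by (simp add: sum.distrib sum.delta)
      also have "\<dots> = 0" using eq by (auto simp: cscale_def)
      finally have "?u i = 0"
        using ij cU bU U cfun.subspace_0 by (intro uniq[of ?u]) (auto intro: cfun.subspace_neg)
      with b0 show ?thesis by simp
    qed
  qed
  have Ksum: "(\<Sum>x\<in>?e ` Sigma J B. cscale (h x) x) = (\<Sum>j\<in>J. K j (\<Sum>b\<in>B j. cscale (h (K j b)) b))" for h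
  proof -
    have "(\<Sum>x\<in>?e ` Sigma J B. cscale (h x) x) = (\<Sum>(j, b)\<in>Sigma J B. cscale (h (K j b)) (K j b))"
      by (subst sum.reindex[OF inj]) (simp add: case_prod_unfold)
    also have "\<dots> = (\<Sum>j\<in>J. \<Sum>b\<in>B j. cscale (h (K j b)) (K j b))"
      using J fin by (subst sum.Sigma) auto
    also have "\<dots> = (\<Sum>j\<in>J. K j (\<Sum>b\<in>B j. cscale (h (K j b)) b))"
    proof (rule sum.cong[OF refl])
      fix j assume j: "j \<in> J"
      have "K j (\<Sum>b\<in>B j. cscale (h (K j b)) b) = (\<Sum>b\<in>B j. K j (cscale (h (K j b)) b))"
        using B(1)[of j] U[OF j] by (intro lin_on_sum[OF K(1)[OF j] U[OF j]] cfun.subspace_scale) auto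
      also have "\<dots> = (\<Sum>b\<in>B j. cscale (h (K j b)) (K j b))"
        using K(1)[OF j] B(1)[of j] by (intro sum.cong refl) (auto simp: lin_on_def)
      finally show "(\<Sum>b\<in>B j. cscale (h (K j b)) (K j b)) = K j (\<Sum>b\<in>B j. cscale (h (K j b)) b)" by simp
    qed
    finally show ?thesis .
  qed
  have ind: "cfun.independent (?e ` Sigma J B)"
  proof (rule cfun.independent_if_scalars_zero)
    show "finite (?e ` Sigma J B)" using J fin by auto
    fix h x assume h: "(\<Sum>x\<in>?e ` Sigma J B. cscale (h x) x) = 0" and "x \<in> ?e ` Sigma J B"
    then obtain j b where x: "x = K j b" "j \<in> J" "b \<in> B j" by auto
    show "h x = 0" using scal[of "\<lambda>(j, b). h (K j b)" j b] h x unfolding Ksum by simp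
  qed
  have "cfun.span (?e ` Sigma J B) = V"
  proof
    show "cfun.span (?e ` Sigma J B) \<subseteq> V"
    proof (rule cfun.span_minimal[OF _ V], clarify)
      fix j b assume "j \<in> J" "b \<in> B j"
      then show "K j b \<in> V" using K(2)[of j] B(1)[of j] by blast
    qed
    show "V \<subseteq> cfun.span (?e ` Sigma J B)"
    proof
      fix v assume v: "v \<in> V"
      from surj[OF v] obtain u where u: "\<forall>j\<in>J. u j \<in> U j" "v = (\<Sum>j\<in>J. K j (u j))" by blast
      have "K j (u j) \<in> cfun.span (?e ` Sigma J B)" if j: "j \<in> J" for j
      proof -
        obtain g where g: "lin_map g" "\<forall>w\<in>U j. g w = K j w" using lin_on_extend[OF U[OF j] K(1)[OF j]] by blast
        have "g (u j) \<in> g ` cfun.span (B j)" using u(1) j B(3)[of j] by blast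
        then have "K j (u j) \<in> cfun.span (g ` B j)" using g(2) u(1) j by (simp add: lin_map_span[OF g(1)])
        also have "cfun.span (g ` B j) \<subseteq> cfun.span (?e ` Sigma J B)"
          using g(2) j B(1)[of j] by (intro cfun.span_mono) (force simp: subset_iff image_iff)
        finally show ?thesis .
      qed
      then show "v \<in> cfun.span (?e ` Sigma J B)" unfolding u(2) by (intro cfun.span_sum)
    qed
  qed
  with that[of B] fin B inj ind show thesis by blast
qed

lemma dim_eq_sum:
  assumes "finite F" "V \<subseteq> cfun.span F"
  shows "cfun.dim V = (\<Sum>j\<in>J. cfun.dim (U j))"
proof (rule adapted_basis[OF assms])
  fix B
  assume B: "\<And>j. j \<in> J \<Longrightarrow> finite (B j)" "\<And>j. j \<in> J \<Longrightarrow> B j \<subseteq> U j"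
    "\<And>j. j \<in> J \<Longrightarrow> card (B j) = cfun.dim (U j)" "inj_on (\<lambda>(j, b). K j b) (Sigma J B)"
    "cfun.independent ((\<lambda>(j, b). K j b) ` Sigma J B)" "cfun.span ((\<lambda>(j, b). K j b) ` Sigma J B) = V"
  have "cfun.dim V = card ((\<lambda>(j, b). K j b) ` Sigma J B)"
    using cfun.dim_span_eq_card_independent[OF B(5)] B(6) by simp
  also have "\<dots> = (\<Sum>j\<in>J. cfun.dim (U j))"
    using J B by (simp add: card_image)
  finally show ?thesis .
qed

lemma trace_eq_sum:
  assumes F: "finite F" "V \<subseteq> cfun.span F" and f: "lin_on V f"
    and s: "\<And>j u. j \<in> J \<Longrightarrow> u \<in> U j \<Longrightarrow> f (K j u) = cscale (s j) (K j u)"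
  shows "trace_on V f = (\<Sum>j\<in>J. s j * of_nat (cfun.dim (U j)))"
proof (rule adapted_basis[OF F])
  let ?e = "\<lambda>(j, b). K j b"
  fix B
  assume B: "\<And>j. j \<in> J \<Longrightarrow> finite (B j)" "\<And>j. j \<in> J \<Longrightarrow> B j \<subseteq> U j"
    "\<And>j. j \<in> J \<Longrightarrow> card (B j) = cfun.dim (U j)" "inj_on ?e (Sigma J B)"
    "cfun.independent (?e ` Sigma J B)" "cfun.span (?e ` Sigma J B) = V"
  have fV: "f v \<in> V" if v: "v \<in> V" for v
  proof -
    from surj[OF v] obtain u where u: "\<forall>j\<in>J. u j \<in> U j" "v = (\<Sum>j\<in>J. K j (u j))" by blast
    have "f v = (\<Sum>j\<in>J. f (K j (u j)))"
      unfolding u(2) by (intro lin_on_sum[OF f V] K_in u(1)[rule_format])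
    also have "\<dots> = (\<Sum>j\<in>J. cscale (s j) (K j (u j)))" using u(1) s by (intro sum.cong) auto
    also have "\<dots> \<in> V" by (intro cfun.subspace_sum cfun.subspace_scale V K_in u(1)[rule_format])
    finally show ?thesis .
  qed
  have "trace_on V f = (\<Sum>x\<in>?e ` Sigma J B. cfun.representation (?e ` Sigma J B) (f x) x)"
    using J B(1) fV by (intro trace_on_basis B f) auto
  also have "\<dots> = (\<Sum>(j, b)\<in>Sigma J B. s j)"
  proof (subst sum.reindex[OF B(4)], rule sum.cong[OF refl], clarify)
    fix j b assume jb: "j \<in> J" "b \<in> B j"
    then have m: "K j b \<in> ?e ` Sigma J B" by force
    have "f (K j b) = cscale (s j) (K j b)" using s jb B(2) by blast
    then show "((\<lambda>x. cfun.representation (?e ` Sigma J B) (f x) x) \<circ> ?e) (j, b) = s j"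
      using cfun.representation_scale[OF B(5) cfun.span_base[OF m], of "s j"] cfun.representation_basis[OF B(5) m]
      by simp
  qed
  also have "\<dots> = (\<Sum>j\<in>J. \<Sum>b\<in>B j. s j)" using J B(1) by (subst sum.Sigma) auto
  also have "\<dots> = (\<Sum>j\<in>J. s j * of_nat (cfun.dim (U j)))"
    using B(3) by (intro sum.cong) (auto simp: mult.commute)
  finally show ?thesis .
qed

end

text \<open>The trace of P on \<open>fsp X\<close> is computed twice: from its eigenvalues
  \<plusminus>1, and in the standard basis, where only fixed points of \<pi> reach the diagonal. The
  condition on a makes P an involution there.\<close>

lemma dims_monomial_involution:
  assumes "monomial \<pi> a" and X: "finite X" "\<pi> ` X \<subseteq> X" and a: "\<And>x. x \<in> X \<Longrightarrow> a x * a (\<pi> x) = 1"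
  defines "E \<equiv> \<lambda>e. {w \<in> fsp X. monomap \<pi> a w = cscale (psgn e) w}"
  shows "cfun.dim (E True) + cfun.dim (E False) = card X"
    and "of_nat (cfun.dim (E True)) - of_nat (cfun.dim (E False)) = (\<Sum>x\<in>{x\<in>X. \<pi> x = x}. a x)"
proof -
  interpret monomial \<pi> a by (rule assms(1))
  have Pf: "P w \<in> fsp X" if "w \<in> fsp X" for w
  proof -
    have "P w \<in> fsp (\<pi> ` X)" unfolding P_image_fsp[symmetric] using that by (rule imageI)
    then show ?thesis using X(2) by (auto simp: fsp_def spt_def)
  qed
  have PP: "P (P w) = w" if "w \<in> fsp X" for w
  proof
    fix x show "P (P w) x = w x"
    proof (cases "x \<in> X")
      case True
      have "P (P w) x = (a x * a (\<pi> x)) * w x" by (simp add: monomap_def mult_ac)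
      then show ?thesis using a[OF True] by simp
    next
      case False
      then show ?thesis using that by (auto simp: monomap_def fsp_def spt_def)
    qed
  qed
  have sub: "cfun.subspace (E e)" for e
    using subspace_fsp[of X] unfolding E_def cfun.subspace_def
    by (auto simp: P_add P_scale cfun.scale_right_distrib mult.commute)
  interpret decomposition UNIV E "\<lambda>_ w. w" "fsp X"
  proof
    show "(\<lambda>w. w) ` E e \<subseteq> fsp X" for e by (auto simp: E_def)
    show "lin_on (E e) (\<lambda>w. w)" for e by (simp add: lin_on_def)
    fix u e assume u: "\<And>e. e \<in> UNIV \<Longrightarrow> u e \<in> E e" and 0: "(\<Sum>e\<in>UNIV. u e) = (0 :: 'a \<Rightarrow> complex)"
    have s: "u True + u False = 0" using 0 by (simp add: UNIV_bool add.commute)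
    have "P (u True) = u True" "P (u False) = cscale (-1) (u False)" using u by (auto simp: E_def psgn_def)
    then have "u True + cscale (-1) (u False) = 0" using arg_cong[OF s, of P] unfolding P_add by simp
    with s have "u True x = 0 \<and> u False x = 0" for x
    proof -
      have "u True x + u False x = 0" "u True x - u False x = 0"
        using fun_cong[OF s, of x] fun_cong[OF \<open>u True + cscale (-1) (u False) = 0\<close>, of x] by (auto simp: cscale_def)
      then show ?thesis by auto
    qed
    then have "u True = 0" "u False = 0" by auto
    then show "u e = 0" by (cases e) auto
  next
    fix v assume v: "v \<in> fsp X"
    let ?u = "\<lambda>e. cscale (1 / 2) (v + cscale (psgn e) (P v))"
    have "?u e \<in> E e" for e
    proof -
      have "?u e \<in> fsp X" using v Pf by (intro cfun.subspace_scale cfun.subspace_add subspace_fsp) auto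
      moreover have "P (?u e) = cscale (psgn e) (?u e)"
        unfolding P_scale P_add PP[OF v] by (auto simp: cscale_def psgn_def algebra_simps)
      ultimately show ?thesis by (simp add: E_def)
    qed
    moreover have "v = (\<Sum>e\<in>UNIV. ?u e)"
      by (rule ext) (simp add: sum_fun_apply UNIV_bool psgn_def cscale_def field_simps)
    ultimately show "\<exists>u. (\<forall>e\<in>UNIV. u e \<in> E e) \<and> v = (\<Sum>e\<in>UNIV. u e)"
      by (intro exI[of _ ?u] conjI ballI)
  qed (auto simp: sub subspace_fsp)
  have F: "finite (single ` X)" "fsp X \<subseteq> cfun.span (single ` X)"
    using X(1) by (auto simp: span_singles)
  have "(\<Sum>e\<in>UNIV. cfun.dim (E e)) = card X"
    using dim_eq_sum[OF F] by (simp add: dim_fsp)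
  then show "cfun.dim (E True) + cfun.dim (E False) = card X" by (simp add: UNIV_bool)
  have "trace_on (fsp X) P = (\<Sum>e\<in>UNIV. psgn e * of_nat (cfun.dim (E e)))"
    by (rule trace_eq_sum[OF F lin_map_on[OF lin_map_monomap]]) (simp add: E_def)
  also have "\<dots> = of_nat (cfun.dim (E True)) - of_nat (cfun.dim (E False))"
    by (simp add: UNIV_bool psgn_def)
  also have "trace_on (fsp X) P = (\<Sum>b\<in>single ` X. cfun.representation (single ` X) (P b) b)"
    using F Pf by (intro trace_on_basis lin_map_on lin_map_monomap independent_singles span_singles) auto
  also have "\<dots> = (\<Sum>x\<in>X. cfun.representation (single ` X) (P (single x)) (single x))"
    using inj_single by (subst sum.reindex) (auto intro: inj_on_subset)
  also have "\<dots> = (\<Sum>x\<in>X. if \<pi> x = x then a x else 0)"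
  proof (rule sum.cong[OF refl])
    fix x assume "x \<in> X"
    then have m: "single (\<pi> x) \<in> single ` X" using X(2) by blast
    show "cfun.representation (single ` X) (P (single x)) (single x) = (if \<pi> x = x then a x else 0)"
      unfolding P_single cfun.representation_scale[OF independent_singles cfun.span_base[OF m]]
        cfun.representation_basis[OF independent_singles m]
      by (simp add: inj_eq[OF inj_single] eq_commute)
  qed
  also have "\<dots> = (\<Sum>x\<in>{x\<in>X. \<pi> x = x}. a x)" by (rule sum.inter_filter[OF X(1), symmetric])
  finally show "of_nat (cfun.dim (E True)) - of_nat (cfun.dim (E False)) = (\<Sum>x\<in>{x\<in>X. \<pi> x = x}. a x)" by simp
qed

section \<open>Conformal weights on untwisted modules\<close>

definition modes :: "'a::euclidean_space itself \<Rightarrow> ('a \<times> real) multiset set" where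
  "modes _ = {M. \<forall>(b, n)\<in>#M. b \<in> Basis \<and> n \<in> \<nat> \<and> n > 0}"

definition lat :: "'a::euclidean_space set \<Rightarrow> ('a, 't) fock set" where
  "lat X = {Unt M \<gamma> | M \<gamma>. M \<in> modes TYPE('a) \<and> \<gamma> \<in> X}"

definition twb :: "'t set \<Rightarrow> ('a::euclidean_space, 't) fock set" where
  "twb J = {Tw M t | M t. t \<in> J \<and> (\<forall>(b, n)\<in>#M. b \<in> Basis \<and> n - 1 / 2 \<in> \<nat>)}"

lemma lattice_space_eq: "lattice_space X = fsp (lat X)"
  unfolding lattice_space_def fsp_def spt_def fin_supp_def lat_def modes_def by blast

lemma twisted_space_eq: "twisted_space J = fsp (twb J)"
  unfolding twisted_space_def fsp_def spt_def fin_supp_def twb_def by blast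

definition energy :: "('a \<times> real) multiset \<Rightarrow> real" where
  "energy M = (\<Sum>(b, n)\<in>#M. n)"

text \<open>On \<open>Tw\<close> the weight of the twisted vacuum is left out; \<open>L(0)\<close>
  is identified with \<open>wt\<close> on untwisted modules only.\<close>

fun wt :: "('a::euclidean_space, 't) fock \<Rightarrow> real" where
  "wt (Unt M \<gamma>) = (\<gamma> \<bullet> \<gamma>) / 2 + energy M"
| "wt (Tw M t) = energy M"

lemma energy_simps [simp]: "energy {#} = 0" "energy (add_mset (b, n) M) = n + energy M"
  by (simp_all add: energy_def)

lemma hosc_zero: "hosc 0 n w = 0"
  by (simp add: hosc_def)

lemma op_exp_trivial:
  assumes "\<And>j w. F j w = 0"
  shows "op_exp F j w = (if j = 0 then w else 0)"
proof -
  have "op_pow F (Suc r) j w = 0" for r j by (simp add: assms)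
  then have p: "op_pow F r j w = (if r = 0 \<and> j = 0 then w else 0)" for r j by (cases r) auto
  show ?thesis unfolding op_exp_def p by (cases "j = 0") auto
qed

lemma exp_zero: "exp_minus s 0 j w = (if j = 0 then w else 0)" "exp_plus s 0 j w = (if j = 0 then w else 0)"
  unfolding exp_minus_def exp_plus_def by (auto intro!: op_exp_trivial[THEN trans] simp: hosc_zero)

text \<open>At momentum zero the exponentials are trivial, which leaves the identity field. In the
  twisted sector the field would involve \<open>R 0\<close>, which is arbitrary here.\<close>

lemma exp_field_zero:
  assumes "w \<in> fsp {x. sector x = 0}"
  shows "exp_field (\<lambda>_ _. 1) R 0 x w = (if x = 0 then w else 0)"
proof -
  have "exp_field (\<lambda>_ _. 1) R 0 x w = (\<lambda>y. (if x = 0 then 1 else 0) * w y)"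
    unfolding exp_field_def
  proof (rule lin_ext_diag)
    fix y assume "w y \<noteq> 0"
    then have "sector y = 0" using assms(1) by (auto simp: fsp_def spt_def)
    then obtain M \<gamma> where y: "y = Unt M \<gamma>" by (cases y) auto
    have "(\<lambda>(i, j). if real i / 2 - real j / 2 + zpower 0 y = x
       then exp_minus (sector y) 0 i (exp_plus (sector y) 0 j (group_act (\<lambda>_ _. 1) R 0 y)) else 0) =
      (\<lambda>ij. if ij = (0, 0) then (if x = 0 then single y else 0) else 0)"
      by (auto simp: exp_zero y zpower_def group_act_def fun_eq_iff)
    then show "Sum_any (\<lambda>(i, j). if real i / 2 - real j / 2 + zpower 0 y = x
       then exp_minus (sector y) 0 i (exp_plus (sector y) 0 j (group_act (\<lambda>_ _. 1) R 0 y)) else 0) =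
      cscale (if x = 0 then 1 else 0) (single y)"
      by (simp only: Sum_any.delta') simp
  qed (use assms in \<open>simp add: fsp_def\<close>)
  then show ?thesis by (auto simp: fun_eq_iff)
qed

lemma osc_fin_supp: "osc b n w \<in> fin_supp"
proof -
  have "osc b n (single x) \<in> fin_supp" for x :: "('a, 'b) fock"
    unfolding osc_def lin_ext_single
    by (auto split: fock.split intro!: cfun.subspace_scale[OF subspace_fin_supp] cfun.subspace_0[OF subspace_fin_supp])
  then show ?thesis
    unfolding osc_def lin_ext_single
    by (subst lin_ext_def) (intro cfun.subspace_sum[OF subspace_fin_supp] cfun.subspace_scale[OF subspace_fin_supp])
qed

lemma osc_sector0: "w \<in> fsp {x. sector x = 0} \<Longrightarrow> osc b n w \<in> fsp {x. sector x = 0}"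
  using osc_in_sector[of w 0 b n] by (simp add: fsp_def in_sector_def osc_fin_supp)

text \<open>The product b(-n) b(n) is n times the number operator of the mode.\<close>

lemma osc_pair:
  assumes "n \<noteq> 0"
  shows "osc b (- \<bar>n\<bar>) (osc b \<bar>n\<bar> (single x)) = cscale (of_real (\<bar>n\<bar> * real (count (fmodes x) (b, \<bar>n\<bar>)))) (single x)"
proof (cases "(b, \<bar>n\<bar>) \<in># fmodes x")
  case True
  then show ?thesis using assms
    by (cases x) (simp_all add: osc_def lin_ext_cscale)
next
  case False
  then show ?thesis using assms
    by (cases x) (simp_all add: osc_def lin_ext_cscale not_in_iff)
qed

text \<open>The identity field has exponent 0 only, which singles out l = - z - 1; both branches of
  the normal ordering then give the same operator.\<close>

lemma normal_ordered_once:
  assumes "w \<in> fsp {x. sector x = 0}"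
  shows "normal_ordered 0 (b, 1) (exp_field (\<lambda>_ _. 1) R 0) (of_int z) w = osc b (- of_int z - 1) w"
proof -
  have "normal_ordered 0 (b, 1) (exp_field (\<lambda>_ _. 1) R 0) (of_int z) w =
     Sum_any (\<lambda>l. if l = - z - 1 then osc b (- of_int z - 1) w else 0)"
    unfolding normal_ordered_def prod.case Let_def
  proof (rule arg_cong[where f = Sum_any], rule ext)
    fix l :: int
    have e: "(of_int z + (of_int l + 0) + 1 = (0::real)) = (l = - z - 1)" by linarith
    have 0: "osc b m 0 = 0" for m by (simp add: osc_def)
    show "cscale (of_real (- (of_int l + 0) - 1 gchoose (nat \<lfloor>1\<rfloor> - 1)))
        (if of_int l + 0 < (0::real) then osc b (of_int l + 0) (exp_field (\<lambda>_ _. 1) R 0 (of_int z + (of_int l + 0) + 1) w)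
         else exp_field (\<lambda>_ _. 1) R 0 (of_int z + (of_int l + 0) + 1) (osc b (of_int l + 0) w)) =
        (if l = - z - 1 then osc b (- of_int z - 1) w else 0)"
      unfolding exp_field_zero[OF assms] exp_field_zero[OF osc_sector0[OF assms]] e by (auto simp: 0)
  qed
  then show ?thesis by (simp only: Sum_any.delta)
qed

text \<open>An oscillator of mode p is counted at l = p and at l = - p; the resulting 2 cancels the
  1/2 of the conformal vector. Finiteness is carried along because \<open>Sum_any.distrib\<close>
  needs it.\<close>

lemma energy_sum:
  fixes M :: "(real \<times> real) multiset"
  assumes "M \<in> modes TYPE(real)"
  defines "c \<equiv> \<lambda>M l. complex_of_real (\<bar>of_int l\<bar> * real (count M (1, \<bar>of_int l\<bar>)))"
  shows "finite {l::int. c M l \<noteq> 0} \<and> Sum_any (\<lambda>l::int. c M l) = 2 * of_real (energy M)"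
  using assms(1)
proof (induction M)
  case empty then show ?case by (simp add: c_def)
next
  case (add x M)
  obtain b n where x: "x = (b, n)" by (cases x)
  have M: "M \<in> modes TYPE(real)" and b: "b = 1" and n: "n \<in> \<nat>" "n > 0"
    using add.prems by (auto simp: modes_def x)
  from n obtain p :: nat where p: "n = real p" "p > 0" by (auto elim: Nats_cases)
  let ?d = "\<lambda>l::int. (if l = int p then of_nat p else 0) + (if l = - int p then complex_of_nat p else 0)"
  have eq: "c (add_mset x M) l = c M l + ?d l" for l :: int
    using p(2) by (auto simp: c_def x b p distrib_left)
  have f: "finite {l::int. c M l \<noteq> 0}" and s: "Sum_any (\<lambda>l::int. c M l) = 2 * of_real (energy M)"
    using add.IH[OF M] by auto
  have fd1: "finite {l. (if l = int p then complex_of_nat p else 0) \<noteq> 0}" 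
    by (rule finite_subset[of _ "{int p}"]) auto
  have fd2: "finite {l. (if l = - int p then complex_of_nat p else 0) \<noteq> 0}"
    by (rule finite_subset[of _ "{- int p}"]) auto
  have fd: "finite {l. ?d l \<noteq> 0}"
    by (rule finite_subset[of _ "{int p, - int p}"]) auto
  have "Sum_any (\<lambda>l. c (add_mset x M) l) = Sum_any (c M) + Sum_any ?d"
    unfolding eq by (rule Sum_any.distrib[OF f fd])
  also have "Sum_any ?d = 2 * of_nat p"
    unfolding Sum_any.distrib[OF fd1 fd2] by (simp only: Sum_any.delta) simp
  finally have "Sum_any (\<lambda>l. c (add_mset x M) l) = 2 * of_real (energy (add_mset x M))"
    by (simp add: s x p(1))
  moreover have "finite {l. c (add_mset x M) l \<noteq> 0}"
    by (rule finite_subset[OF _ finite_UnI[OF f fd]]) (auto simp: eq)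
  ultimately show ?case by blast
qed

lemma Sum_any_scale_single: "Sum_any (\<lambda>l. cscale (c l) (single x)) = cscale (Sum_any c) (single x)"
proof -
  have "cscale b (single x) = 0 \<longleftrightarrow> b = 0" for b
  proof
    assume "cscale b (single x) = 0"
    from fun_cong[OF this, of x] show "b = 0" by (simp add: cscale_def single_def)
  qed simp
  then show ?thesis unfolding Sum_any.expand_set cfun.scale_sum_left by simp
qed

text \<open>Exponent -2 belongs to the mode 1, since mode n is the coefficient of z^(-n-1). The
  terms with l \<noteq> 0 are number operators, and l = 0 contributes the squared momentum.\<close>

lemma normal_ordered_twice:
  assumes "M \<in> modes TYPE(real)"
  shows "normal_ordered 0 (1, 1) (normal_ordered 0 (1, 1) (exp_field (\<lambda>_ _. 1) R 0)) (-2) (single (Unt M \<gamma>)) =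
    cscale (2 * of_real (wt (Unt M \<gamma> :: (real, 't) fock))) (single (Unt M \<gamma> :: (real, 't) fock))"
proof -
  let ?y = "Unt M \<gamma> :: (real, 't) fock"
  let ?c = "\<lambda>l::int. complex_of_real (\<bar>of_int l\<bar> * real (count M (1, \<bar>of_int l\<bar>)))"
  let ?d = "\<lambda>l::int. if l = 0 then complex_of_real (\<gamma> * \<gamma>) else 0"
  have y: "single ?y \<in> fsp {x. sector x = 0}" by simp
  have "normal_ordered 0 (1, 1) (normal_ordered 0 (1, 1) (exp_field (\<lambda>_ _. 1) R 0)) (-2) (single ?y) =
     Sum_any (\<lambda>l. cscale (?c l + ?d l) (single ?y))"
    unfolding normal_ordered_def[of 0 "(1, 1)" "normal_ordered 0 (1, 1) (exp_field (\<lambda>_ _. 1) R 0)"] prod.case Let_def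
  proof (rule arg_cong[where f = Sum_any], rule ext)
    fix l :: int
    \<comment> \<open>The inner field is taken at exponent l - 1, for which
      \<open>normal_ordered_once\<close> returns b(-l).\<close>
    have x: "-2 + (of_int l + 0) + 1 = (of_int (l - 1) :: real)" by simp
    have "osc 1 (of_int l) (osc 1 (- of_int l) (single ?y)) = cscale (?c l) (single ?y)" if "l < 0"
      using osc_pair[of "of_int l" 1 ?y] that by simp
    moreover have "osc 1 (- of_int l) (osc 1 (of_int l) (single ?y)) = cscale (?c l) (single ?y)" if "l > 0"
      using osc_pair[of "of_int l" 1 ?y] that by simp
    moreover have "osc 1 0 (osc 1 0 (single ?y)) = cscale (of_real (\<gamma> * \<gamma>)) (single ?y)"
      by (simp add: osc_def lin_ext_cscale)
    ultimately show "cscale (of_real (- (of_int l + 0) - 1 gchoose (nat \<lfloor>1\<rfloor> - 1)))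
         (if of_int l + 0 < (0::real) then osc 1 (of_int l + 0) (normal_ordered 0 (1, 1) (exp_field (\<lambda>_ _. 1) R 0) (-2 + (of_int l + 0) + 1) (single ?y))
          else normal_ordered 0 (1, 1) (exp_field (\<lambda>_ _. 1) R 0) (-2 + (of_int l + 0) + 1) (osc 1 (of_int l + 0) (single ?y))) =
       cscale (?c l + ?d l) (single ?y)"
      unfolding x normal_ordered_once[OF y] normal_ordered_once[OF osc_sector0[OF y]]
      by (cases "l = 0"; cases "l < 0") (simp_all add: algebra_simps)
  qed
  also have "\<dots> = cscale (Sum_any ?c + Sum_any ?d) (single ?y)"
    unfolding Sum_any_scale_single
    by (rule arg_cong2[where f = cscale], rule Sum_any.distrib)
      (use energy_sum[OF assms] in \<open>auto intro: finite_subset[of _ "{0}"]\<close>)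
  also have "Sum_any ?c = 2 * of_real (energy M)" using energy_sum[OF assms] by blast
  also have "Sum_any ?d = of_real (\<gamma> * \<gamma>)" by (simp only: Sum_any.delta)
  also have "2 * of_real (energy M) + of_real (\<gamma> * \<gamma>) = (2 * of_real (wt ?y) :: complex)" by simp
  finally show ?thesis .
qed

section \<open>L(0) in rank one and on tensor powers\<close>

definition conf_index :: "(real, 't) fock" where
  "conf_index = Unt {#(1, 1), (1, 1)#} 0"

definition vac_index :: "(real, 't) fock" where
  "vac_index = Unt {#} 0"

lemma fock_conf_real: "fock_conf = cscale (1 / 2) (single conf_index)"
  by (simp add: fock_conf_def conf_index_def)

lemma rank1_mode_conf_index:
  assumes "x \<in> lat UNIV"
  shows "rank1_mode k \<rho> (single conf_index) 1 (single x) = cscale (2 * of_real (wt x)) (single x)"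
proof -
  obtain M \<gamma> where x: "x = Unt M \<gamma>" "M \<in> modes TYPE(real)" using assms by (auto simp: lat_def)
  \<comment> \<open>Both entries coincide, so the choice of an enumeration has a single
    candidate.\<close>
  have bs: "bs = [(1, 1), (1, 1)]" if "mset bs = {#(1, 1), (1, 1)#}" for bs :: "(real \<times> real) list"
  proof -
    have "size (mset bs) = 2" unfolding that by simp
    then obtain p q where "bs = [p, q]" by (auto simp: length_Suc_conv numeral_2_eq_2)
    with that show ?thesis by (auto simp: add_eq_conv_ex)
  qed
  have "(SOME bs. mset bs = {#(1, 1), (1, 1)#}) = [(1 :: real, 1 :: real), (1, 1)]"
    by (rule bs) (rule someI_ex[OF ex_mset])
  then show ?thesis
    unfolding rank1_mode_def fock_mode_def x(1) lin_ext_single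
    by (simp add: vertex_coeff_def conf_index_def normal_ordered_twice[OF x(2)] del: wt.simps)
qed

lemma rank1_mode_vac_index:
  assumes "x \<in> lat UNIV"
  shows "rank1_mode k \<rho> (single vac_index) n (single x) = (if n = -1 then single x else 0)"
proof -
  obtain M \<gamma> where x: "x = Unt M \<gamma>" using assms by (auto simp: lat_def)
  have "(- real_of_int n - 1 = 0) = (n = -1)" by linarith
  then show ?thesis
    unfolding rank1_mode_def fock_mode_def x lin_ext_single
    by (simp add: vertex_coeff_def vac_index_def exp_field_zero)
qed

lemma fock_mode_cscale: "fock_mode \<epsilon> R (cscale a v) p (cscale b w) = cscale (a * b) (fock_mode \<epsilon> R v p w)"
proof -
  have v: "vertex_coeff \<epsilon> R (cscale a u) x w = cscale a (vertex_coeff \<epsilon> R u x w)" for u x w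
    by (simp add: vertex_coeff_def lin_ext_cscale)
  have e: "op_exp delta_op r (cscale a v) = cscale a (op_exp delta_op r v)" for r
    by (rule op_exp_cscale) (simp add: delta_op_def osc_cscale cfun.scale_sum_right mult.commute)
  show ?thesis
    unfolding fock_mode_def lin_ext_cscale mult.commute[of a b] cfun.scale_scale[symmetric] lin_ext_scale_right[symmetric, of a]
    by (rule arg_cong[where f = "cscale b"], rule arg_cong[where f = "\<lambda>F. lin_ext F w"])
      (simp add: v e Sum_any_cscale fun_eq_iff split: fock.split)
qed

lemma rank1_mode_cscale: "rank1_mode k \<rho> (cscale a v) p (cscale b w) = cscale (a * b) (rank1_mode k \<rho> v p w)"
  unfolding rank1_mode_def by (rule fock_mode_cscale)

lemma rank1_L0:
  assumes "w \<in> fsp (lat UNIV)"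
  shows "rank1_mode k \<rho> fock_conf 1 w = (\<lambda>x. of_real (wt x) * w x)"
proof -
  have "rank1_mode k \<rho> fock_conf 1 w = lin_ext (\<lambda>x. rank1_mode k \<rho> fock_conf 1 (single x)) w"
    unfolding rank1_mode_def fock_mode_def lin_ext_single ..
  also have "\<dots> = (\<lambda>x. of_real (wt x) * w x)"
  proof (rule lin_ext_diag)
    fix x assume "w x \<noteq> 0"
    then have x: "x \<in> lat UNIV" using assms by (auto simp: fsp_def spt_def)
    show "rank1_mode k \<rho> fock_conf 1 (single x) = cscale (of_real (wt x)) (single x)"
      using rank1_mode_cscale[of k \<rho> "1 / 2" "single conf_index" 1 1 "single x"]
      unfolding rank1_mode_conf_index[OF x] fock_conf_real by simp
  qed (use assms in \<open>simp add: fsp_def\<close>)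
  finally show ?thesis .
qed

lemma eigenspace_diag:
  assumes "\<And>w. w \<in> fsp X \<Longrightarrow> f w = (\<lambda>x. of_real (d x) * w x)"
  shows "eigenspace f (fsp X) (of_nat n) = fsp {x \<in> X. d x = real n}"
proof -
  have "w \<in> eigenspace f (fsp X) (of_nat n) \<longleftrightarrow> w \<in> fsp {x \<in> X. d x = real n}" for w
  proof
    assume "w \<in> eigenspace f (fsp X) (of_nat n)"
    then have w: "w \<in> fsp X" "f w = cscale (of_nat n) w" by (auto simp: eigenspace_def)
    have "d x = real n" if "w x \<noteq> 0" for x
      using fun_cong[OF w(2), of x] that assms[OF w(1)] 
      by (auto simp: cscale_def) (metis of_real_eq_iff of_real_of_nat_eq)
    with w(1) show "w \<in> fsp {x \<in> X. d x = real n}" by (auto simp: fsp_def spt_def)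
  next
    assume w: "w \<in> fsp {x \<in> X. d x = real n}"
    then have "w \<in> fsp X" by (auto simp: fsp_def spt_def)
    moreover have "of_real (d x) * w x = of_nat n * w x" for x
      using w by (cases "w x = 0") (auto simp: fsp_def spt_def)
    ultimately show "w \<in> eigenspace f (fsp X) (of_nat n)"
      by (auto simp: eigenspace_def assms cscale_def)
  qed
  then show ?thesis by blast
qed

text \<open>Vacuum factors act only in mode -1, and the degree condition then forces mode 1 in
  factor i: one mode tuple survives. The 2 is due to \<open>conf_index\<close> lacking the 1/2 of
  the conformal vector.\<close>

lemma Y24_conf_single:
  assumes "\<And>j. g j \<in> lat UNIV"
  shows "tensor_mode (rank1_mode k \<rho>) (single (\<lambda>j. if j = i then conf_index else vac_index)) 1 (single g) =
    cscale (2 * of_real (wt (g i))) (single (g :: 'n::finite \<Rightarrow> _))"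
proof -
  let ?f = "\<lambda>j. if j = i then conf_index else vac_index"
  let ?\<nu>0 = "\<lambda>j. if j = i then 1 else -1 :: int"
  let ?F = "\<lambda>\<nu>. pure_tensor (\<lambda>j. rank1_mode k \<rho> (single (?f j)) (\<nu> j) (single (g j)))"
  have s: "(\<Sum>j\<in>UNIV. \<nu> j + 1) = \<nu> i + 1" if "\<And>j. j \<noteq> i \<Longrightarrow> \<nu> j = -1" for \<nu> :: "'n \<Rightarrow> int"
  proof -
    have "(\<Sum>j\<in>UNIV. \<nu> j + 1) = (\<Sum>j\<in>UNIV. if j = i then \<nu> i + 1 else 0)"
      by (rule sum.cong) (auto simp: that)
    then show ?thesis by simp
  qed
  have "(if (\<Sum>j\<in>UNIV. \<nu> j + 1) = 1 + 1 then ?F \<nu> else 0) = (if \<nu> = ?\<nu>0 then ?F ?\<nu>0 else 0)" for \<nu>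
  proof (cases "\<forall>j. j \<noteq> i \<longrightarrow> \<nu> j = -1")
    case True
    then have "(\<Sum>j\<in>UNIV. \<nu> j + 1) = 1 + 1 \<longleftrightarrow> \<nu> i = 1" using s[of \<nu>] by auto
    also have "\<dots> \<longleftrightarrow> \<nu> = ?\<nu>0" using True by (auto simp: fun_eq_iff)
    finally show ?thesis by auto
  next
    case False
    then obtain j where j: "j \<noteq> i" "\<nu> j \<noteq> -1" by blast
    have "rank1_mode k \<rho> (single (?f j)) (\<nu> j) (single (g j)) = 0"
      using j rank1_mode_vac_index[OF assms, of k \<rho> "\<nu> j" j] by (simp del: zero_fun_apply)
    then have "?F \<nu> h = 0" for h unfolding pure_tensor_def by (intro prod_zero bexI[of _ j]) auto
    then have "?F \<nu> = 0" by auto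
    then show ?thesis using j by auto
  qed
  then have "tensor_mode (rank1_mode k \<rho>) (single ?f) 1 (single g) = Sum_any (\<lambda>\<nu>. if \<nu> = ?\<nu>0 then ?F ?\<nu>0 else 0)"
    unfolding tensor_mode_def lin_ext_single by simp
  also have "\<dots> = ?F ?\<nu>0" by (simp only: Sum_any.delta)
  also have "\<dots> = pure_tensor (\<lambda>j. cscale (if j = i then 2 * of_real (wt (g i)) else 1) (single (g j)))"
    by (rule arg_cong[where f = pure_tensor], rule ext)
      (use rank1_mode_conf_index[OF assms] rank1_mode_vac_index[OF assms] in auto)
  also have "\<dots> = cscale (2 * of_real (wt (g i))) (single g)"
    unfolding pure_tensor_cscale pure_tensor_single by simp
  finally show ?thesis .
qed

lemma tensor_conf: "(\<Sum>i\<in>UNIV. pure_tensor (\<lambda>j. if j = i then fock_conf else fock_vac)) =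
   (\<Sum>i\<in>UNIV. cscale (1 / 2) (single (\<lambda>j::'n::finite. if j = i then conf_index else vac_index)))"
proof (rule sum.cong[OF refl])
  fix i :: 'n
  have "pure_tensor (\<lambda>j. if j = i then fock_conf else fock_vac) =
      pure_tensor (\<lambda>j. cscale (if j = i then 1 / 2 else 1) (single (if j = i then conf_index else vac_index)))"
    by (rule arg_cong[where f = pure_tensor]) (auto simp: fock_conf_real fock_vac_def vac_index_def)
  then show "pure_tensor (\<lambda>j. if j = i then fock_conf else fock_vac) =
     cscale (1 / 2) (single (\<lambda>j. if j = i then conf_index else vac_index))"
    unfolding pure_tensor_cscale pure_tensor_single by simp
qed

lemma tensor_mode_expand:
  assumes "w \<in> fin_supp"
  shows "tensor_mode Y u p w = lin_ext (\<lambda>g. tensor_mode Y u p (single g)) w"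
proof -
  have "lin_on fin_supp (tensor_mode Y u p)"
    unfolding lin_on_def by (intro conjI ballI allI tensor_mode_add tensor_mode_cscale)
  then have "tensor_mode Y u p (\<Sum>x | w x \<noteq> 0. cscale (w x) (single x)) =
     (\<Sum>x | w x \<noteq> 0. tensor_mode Y u p (cscale (w x) (single x)))"
    by (rule lin_on_sum[OF _ subspace_fin_supp]) (intro cfun.subspace_scale[OF subspace_fin_supp] single_fin_supp)
  then show ?thesis unfolding expansion[OF assms, symmetric] tensor_mode_cscale lin_ext_def .
qed

lemma tensor_L0:
  fixes w :: "('n::finite \<Rightarrow> (real, bit) fock) \<Rightarrow> complex"
  assumes "w \<in> fsp {g. \<forall>j. g j \<in> lat UNIV}"
  shows "tensor_mode (rank1_mode k \<rho>) (\<Sum>i\<in>UNIV. pure_tensor (\<lambda>j. if j = i then fock_conf else fock_vac)) 1 w =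
    (\<lambda>g. of_real (\<Sum>j\<in>UNIV. wt (g j)) * w g)"
proof -
  let ?\<omega> = "\<Sum>i\<in>UNIV. pure_tensor (\<lambda>j::'n. if j = i then fock_conf else fock_vac)"
  have "tensor_mode (rank1_mode k \<rho>) ?\<omega> 1 w = lin_ext (\<lambda>g. tensor_mode (rank1_mode k \<rho>) ?\<omega> 1 (single g)) w"
    using assms by (intro tensor_mode_expand) (simp add: fsp_def)
  also have "\<dots> = (\<lambda>g. of_real (\<Sum>j\<in>UNIV. wt (g j)) * w g)"
  proof (rule lin_ext_diag)
    fix g assume "w g \<noteq> 0"
    then have g: "\<And>j. g j \<in> lat UNIV" using assms by (auto simp: fsp_def spt_def)
    have "tensor_mode (rank1_mode k \<rho>) ?\<omega> 1 (single g) =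
      (\<Sum>i\<in>UNIV. cscale (1 / 2) (tensor_mode (rank1_mode k \<rho>) (single (\<lambda>j. if j = i then conf_index else vac_index)) 1 (single g)))"
      unfolding tensor_conf tensor_mode_def[of "rank1_mode k \<rho>"]
      by (subst lin_ext_sum) (auto simp: lin_ext_cscale intro: cfun.subspace_scale[OF subspace_fin_supp])
    also have "\<dots> = cscale (of_real (\<Sum>j\<in>UNIV. wt (g j))) (single g)"
      unfolding Y24_conf_single[OF g] by (simp add: cfun.scale_sum_left)
    finally show "tensor_mode (rank1_mode k \<rho>) ?\<omega> 1 (single g) = cscale (of_real (\<Sum>j\<in>UNIV. wt (g j))) (single g)" .
  qed (use assms in \<open>simp add: fsp_def\<close>)
  finally show ?thesis .
qed

section \<open>The automorphism \<open>\<theta>\<close> and the exchange of \<open>T\<^sub>0\<close> and \<open>T\<^sub>1\<close>\<close>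

lemma alpha_pos: "k > 0 \<Longrightarrow> alpha k > 0"
  by (simp add: alpha_def)

lemma coset_iff:
  assumes "k > 0"
  shows "\<gamma> \<in> rank1_coset k r \<longleftrightarrow>
    (\<exists>m::int. \<gamma> = of_int m * (alpha k / (2 * real k)) \<and> m mod (2 * int k) = r mod (2 * int k))"
proof
  assume "\<gamma> \<in> rank1_coset k r"
  then obtain j where "\<gamma> = of_int r * alpha k / (2 * real k) + of_int j * alpha k"
    by (auto simp: rank1_coset_def)
  then have "\<gamma> = of_int (r + j * (2 * int k)) * (alpha k / (2 * real k))"
    using assms by (simp add: field_simps)
  then show "\<exists>m::int. \<gamma> = of_int m * (alpha k / (2 * real k)) \<and> m mod (2 * int k) = r mod (2 * int k)"
    by (intro exI[of _ "r + j * (2 * int k)"]) simp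
next
  assume "\<exists>m::int. \<gamma> = of_int m * (alpha k / (2 * real k)) \<and> m mod (2 * int k) = r mod (2 * int k)"
  then obtain m where m: "\<gamma> = of_int m * (alpha k / (2 * real k))" "m mod (2 * int k) = r mod (2 * int k)" by blast
  then obtain j where "m = r + (2 * int k) * j" by (metis mod_eqE)
  then have "\<gamma> = of_int r * alpha k / (2 * real k) + of_int j * alpha k"
    using assms m(1) by (simp add: field_simps)
  then show "\<gamma> \<in> rank1_coset k r" by (auto simp: rank1_coset_def)
qed

lemma coset_mod: "k > 0 \<Longrightarrow> r mod (2 * int k) = s mod (2 * int k) \<Longrightarrow> rank1_coset k r = rank1_coset k s"
  by (auto simp: coset_iff)

lemma coset_uminus:
  assumes "k > 0"
  shows "- \<gamma> \<in> rank1_coset k (- r) \<longleftrightarrow> \<gamma> \<in> rank1_coset k r"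
proof -
  have 1: "- \<gamma> \<in> rank1_coset k (- r)" if \<gamma>: "\<gamma> \<in> rank1_coset k r" for \<gamma> r
  proof -
    obtain m where "\<gamma> = of_int m * (alpha k / (2 * real k))" "m mod (2 * int k) = r mod (2 * int k)"
      using \<gamma> unfolding coset_iff[OF assms] by blast
    then have "- \<gamma> = of_int (- m) * (alpha k / (2 * real k))" "(- m) mod (2 * int k) = (- r) mod (2 * int k)"
      by (auto intro: mod_minus_cong)
    then show ?thesis unfolding coset_iff[OF assms] by blast
  qed
  show ?thesis using 1[of \<gamma> r] 1[of "- \<gamma>" "- r"] by auto
qed

definition half_lat :: "nat \<Rightarrow> real set" where
  "half_lat k = {of_int j * alpha k / 2 | j. True}"

lemma coset_half:
  assumes "k > 0" "r = 0 \<or> r = int k"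
  shows "rank1_coset k r \<subseteq> half_lat k"
proof
  fix \<gamma> assume "\<gamma> \<in> rank1_coset k r"
  then obtain j where "\<gamma> = of_int r * alpha k / (2 * real k) + of_int j * alpha k"
    by (auto simp: rank1_coset_def)
  moreover have "of_int r * alpha k / (2 * real k) = (if r = 0 then 0 else alpha k / 2)"
    using assms by auto
  ultimately have "\<gamma> = of_int (2 * j + (if r = 0 then 0 else 1)) * alpha k / 2"
    by (auto simp: field_simps)
  then show "\<gamma> \<in> half_lat k" unfolding half_lat_def by blast
qed

lemma coset_zero_iff: "\<beta> \<in> rank1_coset k 0 \<longleftrightarrow> (\<exists>j. \<beta> = of_int j * alpha k)"
  by (auto simp: rank1_coset_def)

lemma of_int_bit_eq_0: "of_int z = (0 :: bit) \<longleftrightarrow> even z"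
proof (cases "even z")
  case True
  then show ?thesis by (auto elim: evenE)
next
  case False
  then obtain m where "z = 2 * m + 1" by (auto elim: oddE)
  then show ?thesis by simp
qed

locale rank1 =
  fixes k :: nat and \<rho> :: "real \<Rightarrow> complex"
  assumes k: "k > 0" and \<rho>: "rho_hom k \<rho>"
begin

lemma \<alpha>: "alpha k \<noteq> 0"
  using alpha_pos[OF k] by simp

lemma \<rho>_nz: "\<rho> (of_int j * alpha k) \<noteq> 0"
  using \<rho> unfolding rho_hom_def Let_def by (auto simp: coset_zero_iff)

lemma \<rho>_add: "\<rho> (of_int i * alpha k + of_int j * alpha k) = \<rho> (of_int i * alpha k) * \<rho> (of_int j * alpha k)"
  using \<rho> unfolding rho_hom_def Let_def by (auto simp: coset_zero_iff)

lemma \<rho>_zero: "\<rho> 0 = 1"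
  using \<rho>_add[of 0 0] \<rho>_nz[of 0] by simp

lemma \<rho>_powi: "\<rho> (of_int j * alpha k) = \<rho> (alpha k) powi j"
proof -
  have nat: "\<rho> (of_nat n * alpha k) = \<rho> (alpha k) ^ n" for n
  proof (induction n)
    case (Suc n)
    have "\<rho> (of_nat (Suc n) * alpha k) = \<rho> (of_int 1 * alpha k + of_int (int n) * alpha k)"
      by (simp add: algebra_simps)
    also have "\<dots> = \<rho> (alpha k) * \<rho> (of_nat n * alpha k)" unfolding \<rho>_add by simp
    finally show ?case using Suc by simp
  qed (simp add: \<rho>_zero)
  show ?thesis
  proof (cases "j \<ge> 0")
    case True
    then show ?thesis using nat[of "nat j"] by (simp add: power_int_def)
  next
    case False
    have "\<rho> (of_int j * alpha k) * \<rho> (of_nat (nat (- j)) * alpha k) = 1"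
      using \<rho>_add[of j "- j"] False \<rho>_zero by simp
    then have "inverse (\<rho> (alpha k) ^ nat (- j)) = \<rho> (of_int j * alpha k)"
      unfolding nat by (intro inverse_unique) (simp only: mult.commute)
    then show ?thesis using False by (simp add: power_int_def power_inverse)
  qed
qed

text \<open>
  Outside \<open>\<int>\<alpha>/2\<close> the value \<open>\<rho>(2\<gamma>)\<close> is not under control; any factor with \<open>g(\<beta> + \<gamma>) = \<rho>(2\<beta>) g(\<gamma>)\<close> for
  \<open>\<beta> \<in> L\<close> gives an isomorphism from \<open>V\<^bsub>\<gamma>+L\<^esub>\<close> to \<open>V\<^bsub>-\<gamma>+L\<^esub>\<close>.
\<close>

definition g\<theta> :: "real \<Rightarrow> complex" where
  "g\<theta> \<gamma> = (if \<gamma> \<in> half_lat k then \<rho> (2 * \<gamma>) else \<rho> (2 * alpha k) powi \<lfloor>\<gamma> / alpha k\<rfloor>)"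

lemma \<rho>_2: "\<rho> (2 * alpha k) = \<rho> (alpha k) powi 2" "\<rho> (2 * (of_int j * alpha k)) = \<rho> (alpha k) powi (2 * j)"
  using \<rho>_powi[of 2] \<rho>_powi[of "2 * j"] by (simp_all add: mult.assoc)

lemma g\<theta>_lattice: "g\<theta> (of_int j * alpha k) = \<rho> (alpha k) powi (2 * j)"
proof -
  have "of_int j * alpha k = of_int (2 * j) * alpha k / 2" by simp
  then have "of_int j * alpha k \<in> half_lat k" unfolding half_lat_def by blast
  then show ?thesis by (simp add: g\<theta>_def \<rho>_2)
qed

lemma \<rho>_\<alpha>_nz: "\<rho> (alpha k) \<noteq> 0"
  using \<rho>_nz[of 1] by simp

lemma g\<theta>_nz: "g\<theta> \<gamma> \<noteq> 0"
proof (cases "\<gamma> \<in> half_lat k")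
  case True
  then obtain j where "\<gamma> = of_int j * alpha k / 2" unfolding half_lat_def by blast
  then have "2 * \<gamma> = of_int j * alpha k" by simp
  then show ?thesis using True \<rho>_nz[of j] by (simp add: g\<theta>_def)
next
  case False
  then show ?thesis using \<rho>_nz[of 2] by (simp add: g\<theta>_def)
qed

text \<open>Adding i\<alpha> does not change membership in \<open>half_lat\<close>. It multiplies
  \<rho>(2\<gamma>) by \<rho>(\<alpha>)^(2i) and raises the floor by i, so both branches of
  \<open>g\<theta>\<close> gain the same factor.\<close>

lemma g\<theta>_add:
  assumes "\<beta> \<in> rank1_coset k 0"
  shows "g\<theta> (\<beta> + \<gamma>) = g\<theta> \<beta> * g\<theta> \<gamma>"
proof -
  obtain i where \<beta>: "\<beta> = of_int i * alpha k" using assms by (auto simp: coset_zero_iff)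
  have 1: "of_int i * alpha k + \<gamma> \<in> half_lat k" if \<gamma>: "\<gamma> \<in> half_lat k" for \<gamma> i
  proof -
    obtain j where "\<gamma> = of_int j * alpha k / 2" using \<gamma> unfolding half_lat_def by blast
    then have "of_int i * alpha k + \<gamma> = of_int (2 * i + j) * alpha k / 2" by (simp add: field_simps)
    then show ?thesis unfolding half_lat_def by blast
  qed
  show ?thesis
  proof (cases "\<gamma> \<in> half_lat k")
    case True
    then obtain j where j: "\<gamma> = of_int j * alpha k / 2" unfolding half_lat_def by blast
    have "g\<theta> (\<beta> + \<gamma>) = \<rho> (of_int (2 * i) * alpha k + of_int j * alpha k)"
      using 1[OF True, of i] by (simp add: g\<theta>_def \<beta> j algebra_simps)
    also have "\<dots> = \<rho> (alpha k) powi (2 * i) * \<rho> (2 * \<gamma>)"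
      unfolding \<rho>_add \<rho>_powi using \<rho>_powi[of j] by (simp add: j)
    finally show ?thesis using True by (simp add: \<beta> g\<theta>_lattice) (simp add: g\<theta>_def)
  next
    case False
    then have "of_int i * alpha k + \<gamma> \<notin> half_lat k" using 1[of "of_int i * alpha k + \<gamma>" "- i"] by auto
    moreover have "\<lfloor>(of_int i * alpha k + \<gamma>) / alpha k\<rfloor> = i + \<lfloor>\<gamma> / alpha k\<rfloor>"
      using \<alpha> by (simp add: add_divide_distrib)
    ultimately show ?thesis using False \<rho>_\<alpha>_nz
      by (simp add: \<beta> g\<theta>_lattice) (simp add: g\<theta>_def \<rho>_2 power_int_add power_int_mult)
  qed
qed

lemma bsgn_powi: "(bsgn t * z) powi (2 * j) = z powi (2 * j)"
  by (auto simp: bsgn_def power_int_minus_left)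

text \<open>The condition on the twisted factor holds because e^\<alpha> acts by z =
  \<plusminus>\<rho>(\<alpha>): the square of z is independent of the sign, and
  \<rho>(\<alpha>)^(2j) z^(-j) = z^j.\<close>

sublocale \<theta>: vertex_symmetry "-1" g\<theta> "\<lambda>t::bit. t" "rank1_coset k 0" "rank1_rep k \<rho>"
proof
  fix \<beta> :: real and t :: bit assume "\<beta> \<in> rank1_coset k 0"
  then obtain j where \<beta>: "\<beta> = of_int j * alpha k" by (auto simp: coset_zero_iff)
  have f: "\<lfloor>\<beta> / alpha k\<rfloor> = j" "\<lfloor>- \<beta> / alpha k\<rfloor> = - j" using \<alpha> by (simp_all add: \<beta>)
  have "z powi (2 * j) * z powi (- j) = z powi j" if "z \<noteq> 0" for z :: complex
    using that by (simp flip: power_int_add)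
  moreover have "bsgn t * \<rho> (alpha k) \<noteq> 0" for t using \<rho>_\<alpha>_nz by (simp add: bsgn_def)
  ultimately have "\<rho> (alpha k) powi (2 * j) * (bsgn t * \<rho> (alpha k)) powi (- j) = (bsgn t * \<rho> (alpha k)) powi j" for t
    by (metis bsgn_powi)
  then show "cscale (g\<theta> \<beta>) (rank1_rep k \<rho> ((-1) *\<^sub>R \<beta>) (single t)) = (\<lambda>t'. rank1_rep k \<rho> \<beta> (single t) t')"
    unfolding cscale_def rank1_rep_def scaleR_minus1_left f mult.assoc[symmetric] unfolding \<beta> g\<theta>_lattice by simp
qed (auto simp: g\<theta>_nz g\<theta>_add)

sublocale flip: vertex_symmetry "1" "\<lambda>_. 1" "\<lambda>t::bit. t + 1" "{0}" "rank1_rep k \<rho>"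
proof
  show "(t + 1) + 1 = t" for t :: bit by (simp add: add.assoc)
  fix \<beta> :: real and t :: bit assume \<beta>: "\<beta> \<in> {0}"
  have "(t' = t + 1) = (t' + 1 = t)" for t' by (cases t'; cases t) auto
  then show "cscale 1 (rank1_rep k \<rho> (1 *\<^sub>R \<beta>) (single (t + 1))) = (\<lambda>t'. rank1_rep k \<rho> \<beta> (single t) (t' + 1))"
    using \<beta> by (simp add: rank1_rep_def single_def fun_eq_iff)
qed auto

lemma \<theta>_covariant:
  assumes "x \<in> unt_over (rank1_coset k 0)"
  shows "\<theta>.P (rank1_mode k \<rho> (single x) n w) = rank1_mode k \<rho> (\<theta>.P (single x)) n (\<theta>.P w)"
  unfolding rank1_mode_def using assms by (intro \<theta>.fock_mode_P[symmetric]) simp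

lemma flip_covariant:
  assumes "x \<in> unt_over {0}"
  shows "flip.P (rank1_mode k \<rho> (single x) n w) = rank1_mode k \<rho> (flip.P (single x)) n (flip.P w)"
  unfolding rank1_mode_def using assms by (intro flip.fock_mode_P[symmetric]) simp

text \<open>Links the map of the statement, given by \<open>lin_ext\<close>, with the injective
  pullback; \<open>g\<theta>\<close> is \<rho>(2\<gamma>) on \<open>half_lat\<close>.\<close>

lemma rank1_theta_eq:
  assumes "w \<in> fin_supp" "w \<in> spt (unt_over (half_lat k))"
  shows "rank1_theta \<rho> w = \<theta>.P w"
proof -
  have "\<theta>.P w = \<theta>.P (\<Sum>x | w x \<noteq> 0. cscale (w x) (single x))" using expansion[OF assms(1)] by simp
  also have "\<dots> = (\<Sum>x | w x \<noteq> 0. cscale (w x) (cscale (\<theta>.co x) (single (\<theta>.\<pi> x))))"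
    by (simp add: \<theta>.P_sum \<theta>.P_scale \<theta>.P_single)
  also have "\<dots> = rank1_theta \<rho> w"
    unfolding rank1_theta_def theta_def lin_ext_def
  proof (rule sum.cong[OF refl])
    fix x assume "x \<in> {x. w x \<noteq> 0}"
    then have "x \<in> unt_over (half_lat k)" using assms(2) by (auto simp: spt_def)
    then show "cscale (w x) (cscale (\<theta>.co x) (single (\<theta>.\<pi> x))) =
       cscale (w x) (case x of Unt M \<gamma> \<Rightarrow> cscale ((-1) ^ size M * \<rho> (2 * \<gamma>)) (single (Unt M (- \<gamma>)))
          | Tw M t \<Rightarrow> cscale ((-1) ^ size M * 1) (single (Tw M t)))"
      by (cases x) (auto simp: unt_over_def g\<theta>_def)
  qed
  finally show ?thesis by simp
qed

lemma V_pm_eq: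
  assumes "r = 0 \<or> r = int k"
  shows "V_pm k \<rho> r e = {w \<in> V_coset k r. \<theta>.P w = cscale (psgn e) w}"
proof -
  have "rank1_theta \<rho> w = \<theta>.P w" if "w \<in> V_coset k r" for w
    using that coset_half[OF k assms]
    by (intro rank1_theta_eq) (auto simp: V_coset_def lattice_space_eq fsp_def spt_def lat_def unt_over_def)
  then show ?thesis by (auto simp: V_pm_def eigenspace_def)
qed

lemma VT_pm_eq: "VT_pm \<rho> t e = {w \<in> twisted_space {t}. \<theta>.P w = cscale (psgn e) w}"
proof -
  have "rank1_theta \<rho> w = \<theta>.P w" if "w \<in> twisted_space {t}" for w
    using that by (intro rank1_theta_eq) (auto simp: twisted_space_eq fsp_def spt_def twb_def unt_over_def)
  then show ?thesis by (auto simp: VT_pm_def eigenspace_def)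
qed

lemma \<theta>_lat: "\<theta>.\<pi> ` lat (rank1_coset k r) = lat (rank1_coset k (- r))"
proof -
  have 1: "\<theta>.\<pi> x \<in> lat (rank1_coset k (- r))" if "x \<in> lat (rank1_coset k r)" for x :: "(real, bit) fock" and r
    using that by (auto simp: lat_def coset_uminus[OF k])
  show ?thesis
  proof
    show "lat (rank1_coset k (- r)) \<subseteq> \<theta>.\<pi> ` lat (rank1_coset k r)"
    proof
      fix x :: "(real, bit) fock" assume "x \<in> lat (rank1_coset k (- r))"
      from 1[OF this] have "\<theta>.\<pi> x \<in> lat (rank1_coset k r)" unfolding minus_minus .
      then show "x \<in> \<theta>.\<pi> ` lat (rank1_coset k r)" by (metis \<theta>.invol imageI)
    qed
  qed (use 1 in blast)
qed

lemma \<theta>_V_coset: "\<theta>.P ` V_coset k r = V_coset k (- r)"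
  unfolding V_coset_def lattice_space_eq \<theta>.P_image_fsp \<theta>_lat ..

lemma half_coset_uminus:
  assumes "r = 0 \<or> r = int k"
  shows "rank1_coset k (- r) = rank1_coset k r"
proof (rule coset_mod[OF k])
  have "(- int k) mod (2 * int k) = (- int k + 2 * int k) mod (2 * int k)" by (simp only: mod_add_self2)
  then show "(- r) mod (2 * int k) = r mod (2 * int k)" using assms by auto
qed

lemma co_half:
  assumes "x \<in> unt_over (half_lat k)"
  shows "\<theta>.co x * \<theta>.co (\<theta>.\<pi> x) = 1"
proof (cases x)
  case (Unt M \<gamma>)
  then obtain j where j: "\<gamma> = of_int j * alpha k / 2" using assms unfolding Unt unt_over_def half_lat_def by blast
  then have "- \<gamma> = of_int (- j) * alpha k / 2" by simp
  then have "- \<gamma> \<in> half_lat k" "\<gamma> \<in> half_lat k" unfolding half_lat_def using j by blast+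
  moreover have "\<rho> (2 * \<gamma>) * \<rho> (2 * (- \<gamma>)) = 1"
    using \<rho>_add[of j "- j"] \<rho>_zero by (simp add: j)
  ultimately show ?thesis by (simp add: Unt g\<theta>_def mult_ac flip: power_mult_distrib) 
next
  case (Tw M t)
  then show ?thesis by (simp flip: power_mult_distrib)
qed

lemma \<theta>_invol:
  assumes "w \<in> spt (unt_over (half_lat k))"
  shows "\<theta>.P (\<theta>.P w) = w"
proof
  fix x
  have "\<theta>.P (\<theta>.P w) x = (\<theta>.co x * \<theta>.co (\<theta>.\<pi> x)) * w x" by (simp add: monomap_def mult_ac)
  also have "\<dots> = w x" using assms co_half[of x] by (cases "w x = 0") (auto simp: spt_def)
  finally show "\<theta>.P (\<theta>.P w) x = w x" .
qed

text \<open>The sign is ignored at coordinates other than 0 and k, so different e may give the same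
  space; only the span of all of them matters.\<close>

definition upart :: "('n \<Rightarrow> int) \<Rightarrow> ('n \<Rightarrow> bool) \<Rightarrow> 'n \<Rightarrow> (real, bit) fvec set" where
  "upart c e j = (if c j = 0 \<or> c j = int k then V_pm k \<rho> (c j) (e j) else V_coset k (c j))"

abbreviation "\<Theta> T \<equiv> monomap (\<lambda>(f::'n::finite \<Rightarrow> (real, bit) fock) j. if j \<in> T then \<theta>.\<pi> (f j) else f j)
  (\<lambda>f. \<Prod>j\<in>UNIV. if j \<in> T then \<theta>.co (f j) else 1)"

abbreviation "Yt \<equiv> tensor_mode (rank1_mode k \<rho>)"
abbreviation "At \<equiv> tensor (\<lambda>_::'n::finite. V_pm k \<rho> 0 True)"

lemma V_coset_half: "r = 0 \<or> r = int k \<Longrightarrow> V_coset k r \<subseteq> spt (unt_over (half_lat k))"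
proof -
  assume "r = 0 \<or> r = int k"
  from coset_half[OF k this] have "(lat (rank1_coset k r) :: (real, bit) fock set) \<subseteq> unt_over (half_lat k)"
    by (auto simp: lat_def unt_over_def)
  then show ?thesis unfolding V_coset_def lattice_space_eq fsp_def spt_def by blast
qed

section \<open>Sign parts of untwisted and twisted modules\<close>

lemma sign_split_untwisted:
  "sign_split (\<lambda>_::'n::finite. \<theta>.\<pi>) (\<lambda>_. \<theta>.co) (\<lambda>j. V_coset k (c j)) {j. c j = 0 \<or> c j = int k}"
proof
  show "cfun.subspace (V_coset k (c j))" for j
    unfolding V_coset_def lattice_space_eq by (rule subspace_fsp)
  fix j w assume j: "j \<in> {j. c j = 0 \<or> c j = int k}" and w: "w \<in> V_coset k (c j)"
  have "\<theta>.P w \<in> V_coset k (- c j)" using w \<theta>_V_coset by blast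
  then show "\<theta>.P w \<in> V_coset k (c j)" using half_coset_uminus[of "c j"] j by (simp add: V_coset_def)
  show "\<theta>.P (\<theta>.P w) = w" using V_coset_half[of "c j"] j w by (intro \<theta>_invol) auto
qed

lemma upart_eq: "sign_split.part (\<lambda>_::'n::finite. \<theta>.\<pi>) (\<lambda>_. \<theta>.co) (\<lambda>j. V_coset k (c j)) {j. c j = 0 \<or> c j = int k} = upart c"
proof -
  interpret sign_split "\<lambda>_::'n. \<theta>.\<pi>" "\<lambda>_. \<theta>.co" "\<lambda>j. V_coset k (c j)" "{j. c j = 0 \<or> c j = int k}"
    by (rule sign_split_untwisted)
  show ?thesis by (intro ext) (auto simp: part_def upart_def V_pm_eq)
qed

lemma sign_split_twisted:
  "sign_split (\<lambda>_::'n::finite. \<theta>.\<pi>) (\<lambda>_. \<theta>.co) (\<lambda>j. twisted_space {t j}) UNIV"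
proof
  show "cfun.subspace (twisted_space {t j})" for j
    unfolding twisted_space_eq by (rule subspace_fsp)
  fix j and w :: "(real, bit) fvec" assume w: "w \<in> twisted_space {t j}"
  have fixed: "\<theta>.\<pi> x = x" if "x \<in> twb {t j}" for x
    using that by (auto simp: twb_def)
  have "\<theta>.\<pi> ` twb {t j} = (\<lambda>x. x) ` twb {t j}" by (rule image_cong[OF refl fixed])
  then have "\<theta>.\<pi> ` twb {t j} = twb {t j}" by simp
  then have "\<theta>.P ` twisted_space {t j} = twisted_space {t j}"
    unfolding twisted_space_eq \<theta>.P_image_fsp by simp
  then show "\<theta>.P w \<in> twisted_space {t j}" using w by blast
  show "\<theta>.P (\<theta>.P w) = w"
  proof (rule \<theta>_invol)
    have "twb {t j} \<subseteq> unt_over (half_lat k)" by (auto simp: twb_def unt_over_def)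
    then show "w \<in> spt (unt_over (half_lat k))"
      using w unfolding twisted_space_eq fsp_def spt_def by blast
  qed
qed

lemma tpart_eq: "sign_split.part (\<lambda>_::'n::finite. \<theta>.\<pi>) (\<lambda>_. \<theta>.co) (\<lambda>j. twisted_space {t j}) UNIV = (\<lambda>e j. VT_pm \<rho> (t j) (e j))"
proof -
  interpret sign_split "\<lambda>_::'n. \<theta>.\<pi>" "\<lambda>_. \<theta>.co" "\<lambda>j. twisted_space {t j}" UNIV
    by (rule sign_split_twisted)
  show ?thesis by (intro ext) (auto simp: part_def VT_pm_eq)
qed

lemma At_spt:
  assumes "u \<in> (At :: (('n::finite \<Rightarrow> _) \<Rightarrow> complex) set)"
  shows "u \<in> spt {f. \<forall>j. f j \<in> unt_over (rank1_coset k 0)}"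
proof -
  have "V_pm k \<rho> 0 True \<subseteq> fsp (lat (rank1_coset k 0))"
    by (auto simp: V_pm_eq V_coset_def lattice_space_eq)
  then have "(At :: (('n \<Rightarrow> _) \<Rightarrow> complex) set) \<subseteq> tensor (\<lambda>_. fsp (lat (rank1_coset k 0)))" by (intro tensor_mono)
  with assms have "u \<in> fsp {f. \<forall>j. f j \<in> lat (rank1_coset k 0)}" unfolding tensor_fsp by blast
  moreover have "(lat L :: (real, bit) fock set) \<subseteq> unt_over L" for L
    by (auto simp: lat_def unt_over_def)
  ultimately show ?thesis unfolding fsp_def spt_def by blast
qed

text \<open>For c = 0 every coordinate carries a sign, and the part with all signs + is the acting
  algebra.\<close>

lemma \<Theta>_At:
  assumes "u \<in> (At :: (('n::finite \<Rightarrow> _) \<Rightarrow> complex) set)"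
  shows "\<Theta> T u = u"
proof -
  interpret sign_split "\<lambda>_::'n. \<theta>.\<pi>" "\<lambda>_. \<theta>.co" "\<lambda>j. V_coset k ((\<lambda>_. 0 :: int) j)"
      "{j. (\<lambda>_. 0 :: int) j = 0 \<or> (\<lambda>_. 0 :: int) j = int k}"
    by (rule sign_split_untwisted[of "\<lambda>_. 0"])
  have "part (\<lambda>_. True) = (\<lambda>_. V_pm k \<rho> 0 True)"
    unfolding upart_eq[of "\<lambda>_. 0"] by (simp add: upart_def fun_eq_iff)
  then have "u \<in> tensor (part (\<lambda>_. True))" using assms by simp
  from PP_part[OF this, of T] show ?thesis by (simp add: psgn_def)
qed

text \<open>The acting vectors are fixed by \<theta> in each tensor factor separately, so applying
  \<theta> in the factors of T alone is already a module map.\<close>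

lemma \<Theta>_covariant:
  assumes "u \<in> At"
  shows "\<Theta> T (Yt u n w) = Yt u n (\<Theta> T w)"
proof -
  interpret tensor_monomial "\<lambda>j. if j \<in> T then \<theta>.\<pi> else id" "\<lambda>j. if j \<in> T then \<theta>.co else (\<lambda>_. 1)"
    by unfold_locales auto
  have id: "monomap id (\<lambda>_. 1) = (\<lambda>w. w :: (real, bit) fvec)" by (auto simp: monomap_def fun_eq_iff)
  have eq: "P w = \<Theta> T w" for w
    unfolding monomap_def by (intro ext arg_cong2[where f = "(*)"] prod.cong arg_cong[where f = w]) auto
  have "Yt (P u) n (P w) = P (Yt u n w)"
  proof (rule tensor_mode_P[OF rank1_mode_cscale _ At_spt[OF assms]])
    fix j m and x y :: "(real, bit) fock" assume "x \<in> unt_over (rank1_coset k 0)"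
    then show "monomap (if j \<in> T then \<theta>.\<pi> else id) (if j \<in> T then \<theta>.co else (\<lambda>_. 1)) (rank1_mode k \<rho> (single x) m (single y)) =
      rank1_mode k \<rho> (monomap (if j \<in> T then \<theta>.\<pi> else id) (if j \<in> T then \<theta>.co else (\<lambda>_. 1)) (single x)) m
        (monomap (if j \<in> T then \<theta>.\<pi> else id) (if j \<in> T then \<theta>.co else (\<lambda>_. 1)) (single y))"
      using \<theta>_covariant[of x m "single y"] by (cases "j \<in> T") (simp_all add: id)
  qed
  then show ?thesis unfolding eq \<Theta>_At[OF assms] by simp
qed

text \<open>The eigenvalue equations of all partial \<Theta> pass through the mode. Membership in
  \<open>tensor X\<close> is a premise because it will be read off from the given module
  isomorphism.\<close>

lemma part_stable:
  fixes X :: "'n::finite \<Rightarrow> (real, bit) fvec set"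
  assumes "sign_split (\<lambda>_. \<theta>.\<pi>) (\<lambda>_. \<theta>.co) X S" "u \<in> At"
    and "w \<in> tensor (sign_split.part (\<lambda>_. \<theta>.\<pi>) (\<lambda>_. \<theta>.co) X S e)" "Yt u n w \<in> tensor X"
  shows "Yt u n w \<in> tensor (sign_split.part (\<lambda>_. \<theta>.\<pi>) (\<lambda>_. \<theta>.co) X S e)"
proof -
  interpret sign_split "\<lambda>_. \<theta>.\<pi>" "\<lambda>_. \<theta>.co" X S by (rule assms(1))
  have "\<Theta> T (Yt u n w) = cscale (\<Prod>j\<in>T. psgn (e j)) (Yt u n w)" if "T \<subseteq> S" for T
    using PP_part[OF assms(3) that] unfolding \<Theta>_covariant[OF assms(2)] by (simp add: tensor_mode_cscale)
  then show ?thesis using assms(4) unfolding tensor_part_iff by blast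
qed

lemmas upart_stable = part_stable[OF sign_split_untwisted, unfolded upart_eq]
lemmas tpart_stable = part_stable[OF sign_split_twisted, unfolded tpart_eq]

text \<open>The list of irreducibles has the cosets r\<alpha>/2k + L for r < k only; a larger
  coordinate is represented by its negative.\<close>

definition urep :: "('n \<Rightarrow> int) \<Rightarrow> ('n \<Rightarrow> bool) \<Rightarrow> 'n \<Rightarrow> irrep" where
  "urep c e j = (if c j = 0 then IrrL (e j) else if c j = int k then IrrHalf (e j)
     else if c j < int k then IrrCoset (nat (c j)) else IrrCoset (nat (2 * int k - c j)))"

lemma urep_irreps: "c \<in> zmod_space k \<Longrightarrow> urep c e j \<in> irreps k"
proof -
  assume "c \<in> zmod_space k"
  then have "0 \<le> c j" "c j < 2 * int k" by (auto simp: zmod_space_def)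
  moreover have "IrrCoset r \<in> irreps k" if "1 \<le> r" "r \<le> k - 1" for r
    using that unfolding irreps_def by simp
  moreover have "IrrL s \<in> irreps k" "IrrHalf s \<in> irreps k" for s
    unfolding irreps_def by simp_all
  ultimately show ?thesis unfolding urep_def by (simp split: if_split)
qed

text \<open>The reflection r \<mapsto> 2k - r keeps parity, and since k is odd the values at 0 and k
  follow the same parity rule.\<close>

lemma mu_urep: "odd k \<Longrightarrow> c \<in> zmod_space k \<Longrightarrow> mu (urep c e j) = bsgn (tau j c)"
proof -
  assume "odd k" "c \<in> zmod_space k"
  then have "0 \<le> c j" "c j < 2 * int k" by (auto simp: zmod_space_def)
  moreover have "bsgn (tau j c) = (if even (c j) then 1 else -1)"
    by (simp add: bsgn_def tau_def of_int_bit_eq_0)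
  moreover have "even (nat (2 * int k - c j)) = even (c j)" "even (nat (c j)) = even (c j)"
    using \<open>0 \<le> c j\<close> \<open>c j < 2 * int k\<close> by (auto simp: even_nat_iff)
  ultimately show ?thesis using \<open>odd k\<close> by (auto simp: urep_def)
qed

text \<open>Q applies \<theta> in the factors with c j > k, which takes the coset of c j to that of
  2k - c j; the other factors are on the list already.\<close>

lemma upart_iso:
  fixes c :: "'n::finite \<Rightarrow> int"
  assumes "c \<in> zmod_space k"
  shows "\<exists>Q. lin_map Q \<and> inj Q \<and> Q ` tensor (upart c e) = tensor (\<lambda>j. irr_space k \<rho> (urep c e j)) \<and>
    (\<forall>u\<in>At. \<forall>n w. Q (Yt u n w) = Yt u n (Q w))"
proof -
  define T where "T = {j. c j > int k}"
  interpret tensor_monomial "\<lambda>j. if j \<in> T then \<theta>.\<pi> else id" "\<lambda>j. if j \<in> T then \<theta>.co else (\<lambda>_. 1)"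
    by unfold_locales auto
  have id: "monomap id (\<lambda>_. 1) = (\<lambda>w. w :: (real, bit) fvec)" by (auto simp: monomap_def fun_eq_iff)
  have eq: "P w = \<Theta> T w" for w
    unfolding monomap_def by (intro ext arg_cong2[where f = "(*)"] prod.cong arg_cong[where f = w]) auto
  have im: "monomap (if j \<in> T then \<theta>.\<pi> else id) (if j \<in> T then \<theta>.co else (\<lambda>_. 1)) ` upart c e j = irr_space k \<rho> (urep c e j)" for j
  proof -
    have b: "0 \<le> c j" "c j < 2 * int k" using assms by (auto simp: zmod_space_def)
    show ?thesis
    proof (cases "j \<in> T")
      case True
      have "V_coset k (2 * int k - c j) = V_coset k (- c j)"
        unfolding V_coset_def by (subst coset_mod[OF k, of "2 * int k - c j" "- c j"]) (auto simp: mod_diff_left_eq[symmetric] simp flip: mod_diff_left_eq)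
      then show ?thesis using True b by (simp add: T_def upart_def urep_def \<theta>_V_coset)
    next
      case False
      then show ?thesis using b by (auto simp: T_def upart_def urep_def id)
    qed
  qed
  have "P ` tensor (upart c e) = tensor (\<lambda>j. irr_space k \<rho> (urep c e j))"
    unfolding P_tensor im ..
  moreover have "inj P" by (auto intro: injI simp: P_eq_iff)
  moreover have "P (Yt u n w) = Yt u n (P w)" if "u \<in> At" for u n w
    unfolding eq by (rule \<Theta>_covariant[OF that])
  ultimately show ?thesis using lin_map_monomap by blast
qed

end

section \<open>Graded dimensions\<close>

lemma fps_power_nth_cong:
  fixes F G :: "'a::comm_ring_1 fps"
  assumes "\<And>m. m \<le> n \<Longrightarrow> fps_nth F m = fps_nth G m"
  shows "fps_nth (F ^ p) n = fps_nth (G ^ p) n"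
proof -
  have "\<forall>m\<le>n. fps_nth (F ^ p) m = fps_nth (G ^ p) m"
    by (induction p) (auto simp: fps_mult_nth assms intro!: sum.cong)
  then show ?thesis by blast
qed

lemma fps_const_prod: "(\<Prod>x\<in>A. fps_const (h x)) = fps_const (\<Prod>x\<in>A. h x)"
  for h :: "'x \<Rightarrow> complex"
  by (induction A rule: infinite_finite_induct) auto

text \<open>A power of a generating function enumerates tuples, with the coefficients s multiplied.
  B may be infinite, so the n-th coefficient is computed with the elements of weight at most
  n.\<close>

lemma fps_power_card_nth:
  fixes s :: "'x \<Rightarrow> complex" and w :: "'x \<Rightarrow> nat"
  assumes "\<And>n. finite {x \<in> B. w x = n}"
  shows "fps_nth (Abs_fps (\<lambda>n. \<Sum>x | x \<in> B \<and> w x = n. s x) ^ CARD('n::finite)) n =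
    (\<Sum>f | (\<forall>j::'n. f j \<in> B) \<and> (\<Sum>j\<in>UNIV. w (f j)) = n. \<Prod>j\<in>UNIV. s (f j))"
proof -
  define B' where "B' = {x \<in> B. w x \<le> n}"
  have "B' = (\<Union>m\<le>n. {x \<in> B. w x = m})" by (auto simp: B'_def)
  then have fin: "finite B'" using assms by simp
  define G where "G = (\<Sum>x\<in>B'. fps_const (s x) * fps_X ^ w x)"
  have G: "fps_nth G m = (\<Sum>x | x \<in> B \<and> w x = m. s x)" if "m \<le> n" for m
  proof -
    have "fps_nth G m = (\<Sum>x\<in>B'. if w x = m then s x else 0)"
      unfolding G_def by (simp add: fps_sum_nth fps_X_power_nth if_distrib[of "(*) _"] eq_commute cong: if_cong)
    also have "\<dots> = (\<Sum>x\<in>{x\<in>B'. w x = m}. s x)" by (rule sum.inter_filter[OF fin, symmetric])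
    also have "{x\<in>B'. w x = m} = {x. x \<in> B \<and> w x = m}" using that by (auto simp: B'_def)
    finally show ?thesis .
  qed
  have finP: "finite (PiE UNIV (\<lambda>_::'n. B'))" using fin by (intro finite_PiE) auto
  have "fps_nth (Abs_fps (\<lambda>n. \<Sum>x | x \<in> B \<and> w x = n. s x) ^ CARD('n)) n = fps_nth (G ^ CARD('n)) n"
    by (rule fps_power_nth_cong) (simp add: G)
  also have "G ^ CARD('n) = (\<Prod>j\<in>(UNIV :: 'n set). G)" by simp
  also have "\<dots> = (\<Sum>f\<in>PiE UNIV (\<lambda>_. B'). \<Prod>j\<in>(UNIV :: 'n set). fps_const (s (f j)) * fps_X ^ w (f j))"
    unfolding G_def by (rule prod_sum_PiE) (auto simp: fin)
  also have "\<dots> = (\<Sum>f\<in>PiE UNIV (\<lambda>_. B'). fps_const (\<Prod>j\<in>(UNIV :: 'n set). s (f j)) * fps_X ^ (\<Sum>j\<in>UNIV. w (f j)))"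
    by (simp add: prod.distrib power_sum fps_const_prod)
  also have "fps_nth \<dots> n = (\<Sum>f\<in>PiE UNIV (\<lambda>_. B'). if (\<Sum>j\<in>(UNIV :: 'n set). w (f j)) = n then \<Prod>j\<in>UNIV. s (f j) else 0)"
    by (simp add: fps_sum_nth fps_X_power_nth if_distrib[of "(*) _"] eq_commute cong: if_cong)
  also have "\<dots> = (\<Sum>f\<in>{f\<in>PiE UNIV (\<lambda>_. B'). (\<Sum>j\<in>(UNIV :: 'n set). w (f j)) = n}. \<Prod>j\<in>UNIV. s (f j))"
    by (rule sum.inter_filter[OF finP, symmetric])
  also have "{f\<in>PiE UNIV (\<lambda>_. B'). (\<Sum>j\<in>(UNIV :: 'n set). w (f j)) = n} =
     {f. (\<forall>j::'n. f j \<in> B) \<and> (\<Sum>j\<in>UNIV. w (f j)) = n}"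
  proof -
    have "w (f j) \<le> (\<Sum>j\<in>UNIV. w (f j))" for f and j :: 'n by (rule member_le_sum) auto
    then show ?thesis by (auto simp: B'_def)
  qed
  finally show ?thesis .
qed

section \<open>Finiteness of the weight spaces\<close>

lemma energy_modes:
  assumes "M \<in> modes TYPE(real)"
  shows "energy M \<in> \<nat>" "size M \<le> energy M" "(b, n) \<in># M \<Longrightarrow> n \<le> energy M"
proof -
  have "energy M \<in> \<nat> \<and> size M \<le> energy M \<and> (\<forall>(b, n)\<in>#M. n \<le> energy M)"
    using assms
  proof (induction M)
    case (add x M)
    obtain b n where x: "x = (b, n)" by (cases x)
    have M: "M \<in> modes TYPE(real)" and n: "n \<in> \<nat>" "n > 0"
      using add.prems by (auto simp: modes_def x)
    have "n \<ge> 1" using n by (auto elim!: Nats_cases)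
    moreover have "energy M \<ge> 0" using add.IH[OF M] by linarith
    ultimately show ?case using add.IH[OF M] n by (auto simp: x)
  qed simp
  then show "energy M \<in> \<nat>" "size M \<le> energy M" "(b, n) \<in># M \<Longrightarrow> n \<le> energy M" by auto
qed

text \<open>Every oscillator has mode at least 1, so the energy bounds both the number of
  oscillators and each mode; in rank one the direction is always 1.\<close>

lemma finite_modes: "finite {M \<in> modes TYPE(real). energy M \<le> real N}"
proof -
  let ?A = "{1} \<times> real ` {..N}"
  have "{M \<in> modes TYPE(real). energy M \<le> real N} \<subseteq> (\<Union>n\<le>N. multisets_of_size ?A n)"
  proof
    fix M assume "M \<in> {M \<in> modes TYPE(real). energy M \<le> real N}"
    then have M: "M \<in> modes TYPE(real)" "energy M \<le> real N" by auto
    have "size M \<le> N" using energy_modes(2)[OF M(1)] M(2) by linarith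
    moreover have "set_mset M \<subseteq> ?A"
    proof
      fix x assume x: "x \<in># M"
      obtain b n where bn: "x = (b, n)" by (cases x)
      have "b = 1" "n \<in> \<nat>" using M(1) x by (auto simp: modes_def bn)
      moreover have "n \<le> real N" using energy_modes(3)[OF M(1)] x M(2) by (force simp: bn)
      ultimately show "x \<in> ?A" by (auto simp: bn elim!: Nats_cases)
    qed
    ultimately show "M \<in> (\<Union>n\<le>N. multisets_of_size ?A n)" by (auto simp: multisets_of_size_def)
  qed
  then show ?thesis by (rule finite_subset) auto
qed

lemma wt_nonneg: "x \<in> lat (X :: real set) \<Longrightarrow> wt x \<ge> 0"
proof -
  assume "x \<in> lat X"
  then obtain M \<gamma> where x: "x = Unt M \<gamma>" "M \<in> modes TYPE(real)" by (auto simp: lat_def)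
  have "energy M \<ge> 0" using energy_modes(2)[OF x(2)] by linarith
  then show ?thesis by (simp add: x)
qed

lemma subspace_eigenspace:
  assumes "lin_on W f" "cfun.subspace W"
  shows "cfun.subspace (eigenspace f W a)"
proof -
  have "f 0 = 0" using lin_on_zero[OF assms(1)] cfun.subspace_0[OF assms(2)] by blast
  then show ?thesis
    using assms unfolding cfun.subspace_def eigenspace_def lin_on_def
    by (auto simp: cfun.scale_right_distrib mult.commute)
qed

lemma lin_on_tensor_mode: "W \<subseteq> fin_supp \<Longrightarrow> lin_on W (tensor_mode Y u p)"
  unfolding lin_on_def by (intro conjI ballI allI tensor_mode_add tensor_mode_cscale) auto

definition conf24 :: "(('n::finite \<Rightarrow> (real, bit) fock) \<Rightarrow> complex)" where
  "conf24 = (\<Sum>i\<in>UNIV. pure_tensor (\<lambda>j. if j = i then fock_conf else fock_vac))"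

lemma VLplus24_simps: "vcarrier (VLplus24 k \<rho>) = tensor (\<lambda>_. V_pm k \<rho> 0 True)"
  "vmode (VLplus24 k \<rho>) = tensor_mode (rank1_mode k \<rho>)" "vconf (VLplus24 k \<rho>) = conf24"
  by (simp_all add: VLplus24_def tensor_power_voa_def VLplus_def conf24_def cong: if_cong)

context rank1
begin

lemma finite_coset_bounded: "finite {\<gamma> \<in> rank1_coset k r. \<gamma> * \<gamma> \<le> B}"
proof -
  let ?a = "alpha k / (2 * real k)"
  have a: "?a > 0" using alpha_pos[OF k] k by simp
  define N where "N = \<lceil>(B + 1) / ?a\<rceil> + 1"
  have "{\<gamma> \<in> rank1_coset k r. \<gamma> * \<gamma> \<le> B} \<subseteq> (\<lambda>m. of_int m * ?a) ` {-N..N}"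
  proof
    fix \<gamma> assume "\<gamma> \<in> {\<gamma> \<in> rank1_coset k r. \<gamma> * \<gamma> \<le> B}"
    then obtain m where m: "\<gamma> = of_int m * ?a" and B: "\<gamma> * \<gamma> \<le> B" unfolding mem_Collect_eq coset_iff[OF k] by blast
    \<comment> \<open>A bound by the square itself, which avoids a square root.\<close>
    have "\<bar>\<gamma>\<bar> \<le> \<gamma> * \<gamma> + 1"
    proof -
      have "0 \<le> (\<bar>\<gamma>\<bar> - 1) * (\<bar>\<gamma>\<bar> - 1) + \<bar>\<gamma>\<bar>" by simp
      then show ?thesis by (simp add: algebra_simps)
    qed
    then have "\<bar>of_int m * ?a\<bar> \<le> B + 1" using B m by linarith
    then have "\<bar>of_int m\<bar> * ?a \<le> B + 1" using a by (simp only: abs_mult abs_of_pos)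
    then have "\<bar>of_int m\<bar> \<le> (B + 1) / ?a" using a by (simp only: pos_le_divide_eq)
    then have "\<bar>m\<bar> \<le> N" unfolding N_def by linarith
    then show "\<gamma> \<in> (\<lambda>m. of_int m * ?a) ` {-N..N}" unfolding m by (intro imageI) auto
  qed
  then show ?thesis by (rule finite_subset) auto
qed

lemma finite_lat_bounded: "finite {x \<in> lat (rank1_coset k r). wt x \<le> real N}"
proof -
  let ?A = "{M \<in> modes TYPE(real). energy M \<le> real N}" and ?B = "{\<gamma> \<in> rank1_coset k r. \<gamma> * \<gamma> \<le> 2 * real N}"
  have "{x \<in> lat (rank1_coset k r). wt x \<le> real N} \<subseteq> (\<lambda>(M, \<gamma>). Unt M \<gamma>) ` (?A \<times> ?B)"
  proof
    fix x :: "(real, 'b) fock" assume "x \<in> {x \<in> lat (rank1_coset k r). wt x \<le> real N}"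
    then obtain M \<gamma> where x: "x = Unt M \<gamma>" "M \<in> modes TYPE(real)" "\<gamma> \<in> rank1_coset k r" and wt: "wt x \<le> real N"
      by (auto simp: lat_def)
    have "energy M \<ge> 0" using energy_modes(2)[OF x(2)] by linarith
    moreover have "\<gamma> * \<gamma> / 2 + energy M \<le> real N" using wt by (simp add: x(1))
    moreover have "\<gamma> * \<gamma> \<ge> 0" by simp
    ultimately have "energy M \<le> real N" "\<gamma> * \<gamma> \<le> 2 * real N" by linarith+
    with x have "(M, \<gamma>) \<in> ?A \<times> ?B" by blast
    then show "x \<in> (\<lambda>(M, \<gamma>). Unt M \<gamma>) ` (?A \<times> ?B)" unfolding x(1) by (rule rev_image_eqI) simp
  qed
  then show ?thesis by (rule finite_subset) (intro finite_imageI finite_cartesian_product finite_modes finite_coset_bounded)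
qed

text \<open>Indices of the standard basis of the weight-n space of M(c), as
  \<open>eigenspace_code\<close> shows.\<close>

definition states :: "('n::finite \<Rightarrow> int) \<Rightarrow> nat \<Rightarrow> ('n \<Rightarrow> (real, bit) fock) set" where
  "states c n = {f. (\<forall>j. f j \<in> lat (rank1_coset k (c j))) \<and> (\<Sum>j\<in>UNIV. wt (f j)) = real n}"

lemma finite_states: "finite (states c n)"
proof -
  have "states c n \<subseteq> PiE UNIV (\<lambda>j. {x \<in> lat (rank1_coset k (c j)). wt x \<le> real n})"
  proof
    fix f assume f: "f \<in> states c n"
    have "wt (f j) \<le> (\<Sum>j\<in>UNIV. wt (f j))" for j
      using f by (intro member_le_sum) (auto simp: states_def intro: wt_nonneg)
    then show "f \<in> PiE UNIV (\<lambda>j. {x \<in> lat (rank1_coset k (c j)). wt x \<le> real n})"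
      using f by (auto simp: states_def)
  qed
  then show ?thesis by (rule finite_subset) (intro finite_PiE finite_lat_bounded finite)
qed

abbreviation "L0t \<equiv> Yt conf24 1"

lemma eigenspace_code:
  fixes c :: "'n::finite \<Rightarrow> int"
  shows "eigenspace L0t (tensor (\<lambda>j. V_coset k (c j))) (of_nat n) = fsp (states c n)"
proof -
  have "eigenspace L0t (fsp {f. \<forall>j. f j \<in> lat (rank1_coset k (c j))}) (of_nat n) =
    fsp {f \<in> {f. \<forall>j. f j \<in> lat (rank1_coset k (c j))}. (\<Sum>j\<in>UNIV. wt (f j)) = real n}"
  proof (rule eigenspace_diag)
    fix w :: "('n \<Rightarrow> (real, bit) fock) \<Rightarrow> complex"
    assume "w \<in> fsp {f. \<forall>j. f j \<in> lat (rank1_coset k (c j))}"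
    moreover have "lat (rank1_coset k r) \<subseteq> lat UNIV" for r by (auto simp: lat_def)
    ultimately have "w \<in> fsp {f. \<forall>j. f j \<in> lat UNIV}" unfolding fsp_def spt_def by blast
    then show "L0t w = (\<lambda>f. of_real (\<Sum>j\<in>UNIV. wt (f j)) * w f)"
      unfolding conf24_def by (rule tensor_L0)
  qed
  then show ?thesis by (simp add: V_coset_def lattice_space_eq tensor_fsp states_def)
qed

lemma wt_\<theta>: "wt (\<theta>.\<pi> x) = wt x"
  by (cases x) auto

lemma \<theta>_lat_iff: "\<theta>.\<pi> x \<in> lat (rank1_coset k (- r)) \<longleftrightarrow> x \<in> lat (rank1_coset k r)"
  by (cases x) (auto simp: lat_def coset_uminus[OF k])

lemma card_states_uminus: "card (states (\<lambda>j. (- c j) mod (2 * int k)) n) = card (states c n)"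
proof -
  have c: "rank1_coset k ((- c j) mod (2 * int k)) = rank1_coset k (- c j)" for j
    by (rule coset_mod[OF k]) simp
  have "bij_betw (\<lambda>f j. \<theta>.\<pi> (f j)) (states c n) (states (\<lambda>j. (- c j) mod (2 * int k)) n)"
    by (rule bij_betwI[where g = "\<lambda>f j. \<theta>.\<pi> (f j)"])
      (use \<theta>_lat_iff[of "\<theta>.\<pi> _"] in \<open>auto simp: states_def c wt_\<theta> \<theta>_lat_iff\<close>)
  then show ?thesis by (simp add: bij_betw_same_card)
qed

section \<open>Traces of \<theta> on weight spaces\<close>

lemma fixed_states_half:
  assumes "x \<in> lat (rank1_coset k (int k))"
  shows "\<theta>.\<pi> x \<noteq> x"
proof
  assume fx: "\<theta>.\<pi> x = x"
  obtain M \<gamma> where x: "x = Unt M \<gamma>" "\<gamma> \<in> rank1_coset k (int k)" using assms by (auto simp: lat_def)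
  have "\<gamma> = 0" using fx by (simp add: x)
  moreover obtain m where "\<gamma> = of_int m * (alpha k / (2 * real k))" "m mod (2 * int k) = int k mod (2 * int k)"
    using x(2) unfolding coset_iff[OF k] by blast
  ultimately show False using \<alpha> k by auto
qed

lemma states_half:
  assumes "\<And>j. c j = 0 \<or> c j = int k" "f \<in> states c n"
  shows "(\<lambda>j. \<theta>.\<pi> (f j)) \<in> states c n" and "f j \<in> unt_over (half_lat k)"
proof -
  have f: "f j \<in> lat (rank1_coset k (c j))" for j using assms(2) by (auto simp: states_def)
  have "\<theta>.\<pi> (f j) \<in> lat (rank1_coset k (c j))" for j
    using \<theta>_lat_iff[of "f j" "c j"] f half_coset_uminus[OF assms(1)] by simp
  then show "(\<lambda>j. \<theta>.\<pi> (f j)) \<in> states c n" using assms(2) by (simp add: states_def wt_\<theta>)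
  show "f j \<in> unt_over (half_lat k)" using f[of j] coset_half[OF k assms(1)[of j]] by (auto simp: lat_def unt_over_def)
qed

text \<open>For an involution, twice the dimension of the fixed space is the dimension plus the
  trace. By \<open>even_parts_eq\<close> U is the fixed space of \<theta> applied in all factors,
  and its trace lives on the fixed tuples.\<close>

lemma dim_M_plus:
  assumes c: "\<And>j::'n::finite. c j = 0 \<or> c j = int k"
  defines "U \<equiv> cfun.span (\<Union>e\<in>{e. (\<Prod>j\<in>UNIV. psgn (e j)) = 1}. tensor (\<lambda>j. V_pm k \<rho> (c j) (e j)))"
  shows "2 * of_nat (cfun.dim (eigenspace L0t U (of_nat n))) = of_nat (card (states c n)) +
    (\<Sum>f | f \<in> states c n \<and> (\<forall>j. \<theta>.\<pi> (f j) = f j). \<Prod>j\<in>UNIV. \<theta>.co (f j))"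
proof -
  interpret sign_split "\<lambda>_::'n. \<theta>.\<pi>" "\<lambda>_. \<theta>.co" "\<lambda>j. V_coset k (c j)" "{j. c j = 0 \<or> c j = int k}"
    by (rule sign_split_untwisted)
  have S: "{j. c j = 0 \<or> c j = int k} = UNIV" using c by auto
  have "upart c = (\<lambda>e j. V_pm k \<rho> (c j) (e j))" using c by (intro ext) (auto simp: upart_def)
  then have part: "part = (\<lambda>e j. V_pm k \<rho> (c j) (e j))" unfolding upart_eq .
  let ?\<pi> = "\<lambda>(f :: 'n \<Rightarrow> (real, bit) fock) j. \<theta>.\<pi> (f j)" and ?a = "\<lambda>f :: 'n \<Rightarrow> (real, bit) fock. \<Prod>j\<in>UNIV. \<theta>.co (f j)"
  have U: "U = {w \<in> tensor (\<lambda>j. V_coset k (c j)). monomap ?\<pi> ?a w = w}"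
    using even_parts_eq[OF S] unfolding part U_def by simp
  have E: "eigenspace L0t U (of_nat n) = {w \<in> fsp (states c n). monomap ?\<pi> ?a w = cscale (psgn True) w}"
    unfolding eigenspace_code[symmetric] U by (auto simp: eigenspace_def psgn_def)
  interpret tm: tensor_monomial "\<lambda>_::'n. \<theta>.\<pi>" "\<lambda>_. \<theta>.co"
    by unfold_locales
  have m: "monomial ?\<pi> ?a"
    by (rule tm.monomial_axioms)
  have closed: "?\<pi> ` states c n \<subseteq> states c n" using states_half(1)[of c, OF c] by blast
  have a1: "?a f * ?a (?\<pi> f) = 1" if "f \<in> states c n" for f
    using states_half(2)[of c, OF c that] by (simp add: co_half flip: prod.distrib)
  note D = dims_monomial_involution[of ?\<pi> ?a "states c n", OF m finite_states closed a1]
  have fx: "{f \<in> states c n. ?\<pi> f = f} = {f. f \<in> states c n \<and> (\<forall>j. \<theta>.\<pi> (f j) = f j)}"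
    by (auto simp: fun_eq_iff)
  have "2 * of_nat (cfun.dim (eigenspace L0t U (of_nat n))) =
    (of_nat (card (states c n)) + (\<Sum>f\<in>{f \<in> states c n. ?\<pi> f = f}. ?a f) :: complex)"
    unfolding E using arg_cong[OF D(1), of "of_nat :: nat \<Rightarrow> complex"] D(2) by (simp add: algebra_simps)
  then show ?thesis unfolding fx .
qed

text \<open>By definition b is the graded trace of \<theta> on V_L, which localises at the fixed
  basis vectors; these have momentum 0.\<close>

lemma b_series_nth:
  "fps_nth (b_series k \<rho>) n = (\<Sum>x | x \<in> lat (rank1_coset k 0) \<and> \<theta>.\<pi> x = x \<and> wt x = real n. \<theta>.co x)"
proof -
  let ?X = "{x \<in> lat (rank1_coset k 0). wt x = real n}"
  have L: "eigenspace (rank1_mode k \<rho> fock_conf 1) (V_coset k 0) (of_nat n) = fsp ?X"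
    unfolding V_coset_def lattice_space_eq
  proof (rule eigenspace_diag)
    fix w :: "(real, bit) fvec" assume "w \<in> fsp (lat (rank1_coset k 0))"
    then have "w \<in> fsp (lat UNIV)" unfolding fsp_def spt_def lat_def by blast
    then show "rank1_mode k \<rho> fock_conf 1 w = (\<lambda>x. of_real (wt x) * w x)" by (rule rank1_L0)
  qed
  have E: "eigenspace (rank1_mode k \<rho> fock_conf 1) (V_pm k \<rho> 0 e) (of_nat n) = {w \<in> fsp ?X. \<theta>.P w = cscale (psgn e) w}" for e
    unfolding L[symmetric] V_pm_eq[OF disjI1[OF refl]] by (auto simp: eigenspace_def)
  have fin: "finite ?X" using finite_lat_bounded[of 0 n] by (rule rev_finite_subset) auto
  have closed: "\<theta>.\<pi> ` ?X \<subseteq> ?X" using \<theta>_lat_iff[of _ 0] by (auto simp: wt_\<theta>)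
  have a1: "\<theta>.co x * \<theta>.co (\<theta>.\<pi> x) = 1" if "x \<in> ?X" for x
    using that coset_half[OF k, of 0] by (intro co_half) (auto simp: lat_def unt_over_def)
  have "fps_nth (b_series k \<rho>) n = of_nat (cfun.dim {w \<in> fsp ?X. \<theta>.P w = cscale (psgn True) w}) -
      of_nat (cfun.dim {w \<in> fsp ?X. \<theta>.P w = cscale (psgn False) w})"
    by (simp add: b_series_def character_def Let_def E)
  also have "\<dots> = (\<Sum>x\<in>{x \<in> ?X. \<theta>.\<pi> x = x}. \<theta>.co x)"
    by (rule dims_monomial_involution(2)[of \<theta>.\<pi> \<theta>.co ?X, OF \<theta>.monomial_axioms fin closed a1])
  also have "{x \<in> ?X. \<theta>.\<pi> x = x} = {x. x \<in> lat (rank1_coset k 0) \<and> \<theta>.\<pi> x = x \<and> wt x = real n}" by auto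
  finally show ?thesis .
qed

lemma b_series_power:
  "fps_nth (b_series k \<rho> ^ CARD('n::finite)) n =
    (\<Sum>f | f \<in> states (\<lambda>_::'n. 0) n \<and> (\<forall>j. \<theta>.\<pi> (f j) = f j). \<Prod>j\<in>UNIV. \<theta>.co (f j))"
proof -
  define B where "B = {x :: (real, bit) fock. x \<in> lat (rank1_coset k 0) \<and> \<theta>.\<pi> x = x}"
  \<comment> \<open>Fixed vectors have momentum 0, so their weight is the energy, a natural number,
    and rounding loses nothing.\<close>
  define w where "w = (\<lambda>x :: (real, bit) fock. nat \<lfloor>wt x\<rfloor>)"
  have w: "wt x = real (w x)" if "x \<in> B" for x
  proof -
    have "x \<in> lat (rank1_coset k 0)" using that by (simp add: B_def)
    then obtain M \<gamma> where x: "x = Unt M \<gamma>" "M \<in> modes TYPE(real)" by (auto simp: lat_def)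
    have "\<gamma> = 0" using that by (simp add: x B_def)
    then show ?thesis using energy_modes(1)[OF x(2)] by (auto simp: x w_def elim!: Nats_cases)
  qed
  have eq: "{x \<in> B. w x = n} = {x. x \<in> lat (rank1_coset k 0) \<and> \<theta>.\<pi> x = x \<and> wt x = real n}" for n
    using w unfolding B_def by auto
  have fin: "finite {x \<in> B. w x = n}" for n
    unfolding eq by (rule finite_subset[OF _ finite_lat_bounded[of 0 n]]) auto
  have "b_series k \<rho> = Abs_fps (\<lambda>n. \<Sum>x | x \<in> B \<and> w x = n. \<theta>.co x)"
    by (rule fps_ext) (simp add: b_series_nth eq)
  then have "fps_nth (b_series k \<rho> ^ CARD('n)) n =
      (\<Sum>f | (\<forall>j::'n. f j \<in> B) \<and> (\<Sum>j\<in>UNIV. w (f j)) = n. \<Prod>j\<in>UNIV. \<theta>.co (f j))"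
    using fps_power_card_nth[OF fin] by simp
  also have "{f. (\<forall>j::'n. f j \<in> B) \<and> (\<Sum>j\<in>UNIV. w (f j)) = n} =
     {f. f \<in> states (\<lambda>_::'n. 0) n \<and> (\<forall>j. \<theta>.\<pi> (f j) = f j)}"
  proof -
    have "(\<Sum>j\<in>UNIV. wt (f j)) = real n \<longleftrightarrow> (\<Sum>j\<in>UNIV. w (f j)) = n" if "\<forall>j::'n. f j \<in> B" for f
    proof -
      have "(\<Sum>j\<in>UNIV. wt (f j)) = real (\<Sum>j\<in>UNIV. w (f j))" using that w by simp
      then show ?thesis by linarith
    qed
    note weights = this
    have taut: "(q \<and> r) = p" if "p = (q \<and> r')" "q \<Longrightarrow> r' = r" for p q r r' :: bool
      using that by blast
    show ?thesis
    proof (rule Collect_cong)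
      fix f :: "'n \<Rightarrow> (real, bit) fock"
      have "f \<in> states (\<lambda>_. 0) n \<and> (\<forall>j. \<theta>.\<pi> (f j) = f j) \<longleftrightarrow> (\<forall>j. f j \<in> B) \<and> (\<Sum>j\<in>UNIV. wt (f j)) = real n"
        by (auto simp: states_def B_def)
      then show "(\<forall>j. f j \<in> B) \<and> (\<Sum>j\<in>UNIV. w (f j)) = n \<longleftrightarrow> f \<in> states (\<lambda>_. 0) n \<and> (\<forall>j. \<theta>.\<pi> (f j) = f j)"
        by (rule taut) (rule weights)
    qed
  qed
  finally show ?thesis .
qed

lemma conf24_At: "conf24 \<in> At"
proof -
  have "(0::real) = of_int 0 * alpha k" by simp
  then have 0: "0 \<in> rank1_coset k 0" unfolding coset_zero_iff by blast
  have g0: "g\<theta> 0 = 1" using g\<theta>_lattice[of 0] by simp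
  have "conf_index \<in> (lat (rank1_coset k 0) :: (real, bit) fock set)" "vac_index \<in> (lat (rank1_coset k 0) :: (real, bit) fock set)"
    using 0 by (auto simp: lat_def conf_index_def vac_index_def modes_def)
  then have "single conf_index \<in> V_pm k \<rho> 0 True" "single vac_index \<in> V_pm k \<rho> 0 True"
    unfolding V_pm_eq[OF disjI1[OF refl]] V_coset_def lattice_space_eq mem_Collect_eq \<theta>.P_single
    by (simp_all add: conf_index_def vac_index_def psgn_def g0)
  moreover have "cfun.subspace (V_pm k \<rho> 0 True)"
    unfolding V_pm_eq[OF disjI1[OF refl]] V_coset_def lattice_space_eq
    using subspace_fsp[of "lat (rank1_coset k 0)"] unfolding cfun.subspace_def
    by (simp add: \<theta>.P_add \<theta>.P_scale cfun.scale_right_distrib mult.commute) blast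
  ultimately have "fock_conf \<in> V_pm k \<rho> 0 True" "fock_vac \<in> V_pm k \<rho> 0 True"
    unfolding fock_conf_real by (auto simp: fock_vac_def vac_index_def intro: cfun.subspace_scale)
  then show ?thesis
    unfolding conf24_def by (intro cfun.subspace_sum tensor_subspace pure_tensor_in_tensor) simp
qed

section \<open>The exchange of T_0 and T_1 on weight spaces\<close>

lemma flip_VT_pm: "flip.P ` VT_pm \<rho> t e = VT_pm \<rho> (t + 1) e"
proof -
  have tw: "flip.P w \<in> twisted_space {t + 1}" if "w \<in> twisted_space {t}" for w t
  proof -
    have "flip.P w \<in> fsp (flip.\<pi> ` twb {t})" using that unfolding flip.P_image_fsp[symmetric] twisted_space_eq by (rule imageI)
    moreover have "flip.\<pi> ` twb {t} \<subseteq> twb {t + 1}" by (auto simp: twb_def)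
    ultimately show ?thesis unfolding twisted_space_eq fsp_def spt_def by blast
  qed
  have comm: "flip.P (\<theta>.P w) = \<theta>.P (flip.P w)" if "w \<in> twisted_space {t}" for w t
  proof
    fix x show "flip.P (\<theta>.P w) x = \<theta>.P (flip.P w) x"
    proof (cases x)
      case (Unt M \<gamma>)
      then show ?thesis using that by (auto simp: monomap_def twisted_space_eq fsp_def spt_def twb_def)
    qed (simp add: monomap_def)
  qed
  have 1: "flip.P w \<in> VT_pm \<rho> (t + 1) e" if "w \<in> VT_pm \<rho> t e" for w t
  proof -
    have w: "w \<in> twisted_space {t}" "\<theta>.P w = cscale (psgn e) w" using that by (auto simp: VT_pm_eq)
    have "\<theta>.P (flip.P w) = cscale (psgn e) (flip.P w)"
      unfolding comm[OF w(1), symmetric] w(2) flip.P_scale ..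
    with tw[OF w(1)] show ?thesis unfolding VT_pm_eq by blast
  qed
  have ff: "flip.P (flip.P w) = w" if "w \<in> VT_pm \<rho> t e" for w t
  proof
    fix x show "flip.P (flip.P w) x = w x" by (cases x) (auto simp: monomap_def add.assoc)
  qed
  show ?thesis
  proof
    show "VT_pm \<rho> (t + 1) e \<subseteq> flip.P ` VT_pm \<rho> t e"
    proof
      fix w assume w: "w \<in> VT_pm \<rho> (t + 1) e"
      have "flip.P w \<in> VT_pm \<rho> (t + 1 + 1) e" by (rule 1[OF w])
      moreover have "t + 1 + 1 = t" by (simp add: add.assoc)
      ultimately have "flip.P w \<in> VT_pm \<rho> t e" by (simp only:)
      then show "w \<in> flip.P ` VT_pm \<rho> t e" using ff[OF w] by (metis imageI)
    qed
  qed (use 1 in blast)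
qed

lemma MT_minus_fin_supp: "MT_minus \<rho> c \<subseteq> fin_supp"
  unfolding MT_minus_def
proof (rule cfun.span_minimal[OF _ subspace_fin_supp], rule UN_least)
  fix e
  have "tensor (\<lambda>i. VT_pm \<rho> (c $ i) (e i)) \<subseteq> tensor (\<lambda>i. fsp (twb {c $ i}))"
    by (intro tensor_mono) (auto simp: VT_pm_eq twisted_space_eq)
  then show "tensor (\<lambda>i. VT_pm \<rho> (c $ i) (e i)) \<subseteq> fin_supp"
    unfolding tensor_fsp by (auto simp: fsp_def)
qed

text \<open>The conformal vector has momentum zero and is fixed by the exchange, which therefore
  commutes with L(0) and maps eigenspaces bijectively. No twisted weight has to be known.\<close>

lemma dim_MT_minus_flip:
  "cfun.dim (eigenspace L0t (MT_minus \<rho> (\<chi> i. c $ i + 1)) a) = cfun.dim (eigenspace L0t (MT_minus \<rho> c) a)"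
proof -
  interpret tensor_monomial "\<lambda>_::24. flip.\<pi>" "\<lambda>_. flip.co"
    by unfold_locales
  have "P ` (\<Union>e\<in>E. tensor (\<lambda>i. VT_pm \<rho> (c $ i) (e i))) = (\<Union>e\<in>E. tensor (\<lambda>i. VT_pm \<rho> (c $ i + 1) (e i)))" for E
    unfolding image_UN P_tensor flip_VT_pm ..
  then have im: "P ` MT_minus \<rho> c = MT_minus \<rho> (\<chi> i. c $ i + 1)"
    unfolding MT_minus_def lin_map_span[OF lin_map_monomap] by simp
  have c: "(conf24 :: (24 \<Rightarrow> _) \<Rightarrow> complex) = (\<Sum>i\<in>UNIV. cscale (1 / 2) (single (\<lambda>j. if j = i then conf_index else vac_index)))"
    unfolding conf24_def tensor_conf ..
  have spt: "(conf24 :: (24 \<Rightarrow> _) \<Rightarrow> complex) \<in> spt {f. \<forall>j. f j \<in> unt_over {0}}"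
    unfolding c by (intro spt_intros) (simp add: unt_over_def conf_index_def vac_index_def)
  have fixed: "(\<lambda>j. flip.\<pi> (if j = i then conf_index else vac_index)) = (\<lambda>j. if j = i then conf_index else vac_index)"
    "(\<Prod>j\<in>UNIV. flip.co (if j = i then conf_index else vac_index)) = 1" for i :: 24
    by (auto simp: conf_index_def vac_index_def intro: prod.neutral)
  have Pc: "P conf24 = conf24"
    unfolding c P_sum P_scale P_single fixed by simp
  have L: "P (L0t w) = L0t (P w)" for w
    using tensor_mode_P[of "rank1_mode k \<rho>" "unt_over {0}" conf24 1 w, OF rank1_mode_cscale flip_covariant spt] Pc by simp
  have sub: "cfun.subspace (eigenspace L0t (MT_minus \<rho> c) a)"
    using MT_minus_fin_supp by (intro subspace_eigenspace lin_on_tensor_mode) (auto simp: MT_minus_def)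
  have "P ` eigenspace L0t (MT_minus \<rho> c) a = eigenspace L0t (MT_minus \<rho> (\<chi> i. c $ i + 1)) a"
  proof -
    have "L0t (P w) = cscale a (P w) \<longleftrightarrow> L0t w = cscale a w" for w
      unfolding L[symmetric] P_scale[symmetric] P_eq_iff ..
    then show ?thesis unfolding eigenspace_def im[symmetric] by auto
  qed
  moreover have "inj_on P (eigenspace L0t (MT_minus \<rho> c) a)" by (intro inj_onI) (simp only: P_eq_iff)
  ultimately show ?thesis by (intro dim_lin_on_bij[OF sub lin_map_on[OF lin_map_monomap]])
qed

end

section \<open>Decompositions of modules\<close>

definition summand :: "'j \<Rightarrow> ('i \<Rightarrow> complex) \<Rightarrow> 'j \<times> 'i \<Rightarrow> complex" where
  "summand j u = (\<lambda>(i, x). if i = j then u x else 0)"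

definition component :: "'j \<Rightarrow> ('j \<times> 'i \<Rightarrow> complex) \<Rightarrow> 'i \<Rightarrow> complex" where
  "component j f = (\<lambda>x. f (j, x))"

lemma component_summand: "component i (summand j u) = (if i = j then u else 0)"
  by (auto simp: component_def summand_def)

lemma component_lin: "lin_map (component j)"
  by (auto simp: lin_map_def component_def cscale_def)

lemma summand_lin: "lin_map (summand j)"
  by (auto simp: lin_map_def summand_def cscale_def)

lemma component_ext: "(\<And>j. component j f = component j g) \<Longrightarrow> f = g"
  by (rule ext) (auto simp: component_def fun_eq_iff)

lemma dsum_iff: "f \<in> dsum J D \<longleftrightarrow> (\<forall>j\<in>J. component j f \<in> D j) \<and> (\<forall>j. j \<notin> J \<longrightarrow> component j f = 0)"
  unfolding dsum_def component_def by auto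

lemma component_dsum_act: "component j (dsum_act Y a n f) = Y a n (component j f)"
  by (simp add: component_def dsum_act_def)

text \<open>Common frame of the untwisted and the twisted decomposition; below, K j embeds the model
  D j by inverting the given isomorphism.\<close>

locale module_sum =
  fixes A :: "'v set" and act :: "'v \<Rightarrow> int \<Rightarrow> ('k \<Rightarrow> complex) \<Rightarrow> 'k \<Rightarrow> complex" and W :: "('k \<Rightarrow> complex) set"
    and Y :: "'v \<Rightarrow> int \<Rightarrow> ('i \<Rightarrow> complex) \<Rightarrow> 'i \<Rightarrow> complex" and J :: "'j set" and D :: "'j \<Rightarrow> ('i \<Rightarrow> complex) set"
    and F :: "('k \<Rightarrow> complex) \<Rightarrow> 'j \<times> 'i \<Rightarrow> complex"
  assumes W: "cfun.subspace W" and F: "lin_on W F" "bij_betw F W (dsum J D)"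
    and intertwine: "a \<in> A \<Longrightarrow> w \<in> W \<Longrightarrow> F (act a n w) = dsum_act Y a n (F w)"
    and stable: "a \<in> A \<Longrightarrow> w \<in> W \<Longrightarrow> act a n w \<in> W"
    and Y0: "Y a n 0 = 0" and D: "cfun.subspace (D j)" and J: "finite J"
begin

definition K :: "'j \<Rightarrow> ('i \<Rightarrow> complex) \<Rightarrow> 'k \<Rightarrow> complex" where
  "K j u = inv_into W F (summand j u)"

lemma F_inj: "v \<in> W \<Longrightarrow> w \<in> W \<Longrightarrow> F v = F w \<Longrightarrow> v = w"
  using F(2) by (auto simp: bij_betw_def dest: inj_onD)

lemma F_dsum: "w \<in> W \<Longrightarrow> F w \<in> dsum J D"
  using F(2) by (auto simp: bij_betw_def)

lemma summand_dsum: "j \<in> J \<Longrightarrow> u \<in> D j \<Longrightarrow> summand j u \<in> dsum J D"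
  using cfun.subspace_0[OF D] by (auto simp: dsum_iff component_summand)

lemma K_W: "j \<in> J \<Longrightarrow> u \<in> D j \<Longrightarrow> K j u \<in> W"
  and F_K: "j \<in> J \<Longrightarrow> u \<in> D j \<Longrightarrow> F (K j u) = summand j u"
proof -
  assume "j \<in> J" "u \<in> D j"
  then have "summand j u \<in> F ` W" using summand_dsum F(2) by (auto simp: bij_betw_def)
  then show "K j u \<in> W" "F (K j u) = summand j u" unfolding K_def by (rule inv_into_into, rule f_inv_into_f)
qed

lemma K_lin: "j \<in> J \<Longrightarrow> lin_on (D j) (K j)"
proof -
  assume j: "j \<in> J"
  have Fl: "F (v + w) = F v + F w" "F (cscale c v) = cscale c (F v)" if "v \<in> W" "w \<in> W" for v w c
    using F(1) that by (auto simp: lin_on_def)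
  have sl: "summand j (v + w) = summand j v + summand j w" "summand j (cscale c v) = cscale c (summand j v)" for v w c
    using summand_lin[of j] unfolding lin_map_def by blast+
  show ?thesis
    unfolding lin_on_def
  proof (intro conjI ballI allI)
    fix v w assume vw: "v \<in> D j" "w \<in> D j"
    have "v + w \<in> D j" by (rule cfun.subspace_add[OF D vw])
    moreover have "F (K j v + K j w) = summand j (v + w)"
      unfolding Fl(1)[OF K_W[OF j vw(1)] K_W[OF j vw(2)]] F_K[OF j vw(1)] F_K[OF j vw(2)] sl ..
    moreover have "K j v + K j w \<in> W" using K_W[OF j] vw W by (intro cfun.subspace_add)
    ultimately show "K j (v + w) = K j v + K j w" by (intro F_inj K_W j) (simp_all only: F_K[OF j])
  next
    fix c v assume v: "v \<in> D j"
    have "cscale c v \<in> D j" using v D by (intro cfun.subspace_scale)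
    moreover have "F (cscale c (K j v)) = summand j (cscale c v)"
      unfolding Fl(2)[OF K_W[OF j v] K_W[OF j v]] F_K[OF j v] sl ..
    moreover have "cscale c (K j v) \<in> W" using K_W[OF j] v W by (intro cfun.subspace_scale)
    ultimately show "K j (cscale c v) = cscale c (K j v)" by (intro F_inj K_W j) (simp_all only: F_K[OF j])
  qed
qed

text \<open>act keeps W, and F maps W into the external sum. The image of a vector of one summand
  has the single component \<open>Y a n u\<close>, which is thereby forced into D j.\<close>

lemma act_K:
  assumes "j \<in> J" "u \<in> D j" "a \<in> A"
  shows "Y a n u \<in> D j" "act a n (K j u) = K j (Y a n u)"
proof -
  have "F (act a n (K j u)) = dsum_act Y a n (summand j u)"
    using intertwine[OF assms(3) K_W[OF assms(1,2)]] F_K[OF assms(1,2)] by simp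
  also have "\<dots> = summand j (Y a n u)"
    by (rule component_ext) (simp add: component_dsum_act component_summand Y0 del: zero_fun_apply)
  finally have eq: "F (act a n (K j u)) = summand j (Y a n u)" .
  have st: "act a n (K j u) \<in> W" using stable[OF assms(3) K_W[OF assms(1,2)]] .
  from F_dsum[OF this] show Y: "Y a n u \<in> D j" unfolding eq dsum_iff component_summand using assms(1) by auto
  show "act a n (K j u) = K j (Y a n u)"
    using st K_W[OF assms(1) Y] eq F_K[OF assms(1) Y] by (intro F_inj) simp_all
qed

lemma component_sum: "component i (\<Sum>j\<in>J. summand j (u j)) = (if i \<in> J then u i else 0)"
proof -
  have "component i (\<Sum>j\<in>J. summand j (u j)) = (\<Sum>j\<in>J. if j = i then u i else 0)"
    unfolding lin_map_sum[OF component_lin] component_summand by (rule sum.cong) auto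
  then show ?thesis using J by (simp add: sum.delta)
qed

lemma K_uniq:
  assumes "\<And>j. j \<in> J \<Longrightarrow> u j \<in> D j" "(\<Sum>j\<in>J. K j (u j)) = 0" "j \<in> J"
  shows "u j = 0"
proof -
  have "F (\<Sum>j\<in>J. K j (u j)) = (\<Sum>j\<in>J. F (K j (u j)))"
    by (rule lin_on_sum[OF F(1) W]) (rule K_W, assumption, rule assms(1))
  also have "\<dots> = (\<Sum>j\<in>J. summand j (u j))"
    by (rule sum.cong[OF refl]) (rule F_K, assumption, rule assms(1))
  finally have "(\<Sum>j\<in>J. summand j (u j)) = 0"
    unfolding assms(2) using lin_on_zero[OF F(1) cfun.subspace_0[OF W]] by simp
  from arg_cong[OF this, of "component j"] show ?thesis
    unfolding component_sum lin_map_zero[OF component_lin] using assms(3) by simp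
qed

lemma K_surj:
  assumes "w \<in> W"
  shows "w = (\<Sum>j\<in>J. K j (component j (F w)))" "j \<in> J \<Longrightarrow> component j (F w) \<in> D j"
proof -
  have d: "component j (F w) \<in> D j" if "j \<in> J" for j
    using F_dsum[OF assms] that by (simp add: dsum_iff)
  then show "j \<in> J \<Longrightarrow> component j (F w) \<in> D j" .
  have sW: "(\<Sum>j\<in>J. K j (component j (F w))) \<in> W"
    by (intro cfun.subspace_sum W K_W d)
  have "F (\<Sum>j\<in>J. K j (component j (F w))) = (\<Sum>j\<in>J. F (K j (component j (F w))))"
    by (rule lin_on_sum[OF F(1) W]) (intro K_W d)
  also have "\<dots> = (\<Sum>j\<in>J. summand j (component j (F w)))"
    by (rule sum.cong[OF refl]) (intro F_K d)
  also have "\<dots> = F w"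
    by (rule component_ext) (use F_dsum[OF assms] in \<open>auto simp: component_sum dsum_iff\<close>)
  finally show "w = (\<Sum>j\<in>J. K j (component j (F w)))" using sW assms by (intro F_inj) simp_all
qed

text \<open>Supplies the two premises of \<open>acts_by_mu\<close> for a piece N of a model; Q
  carries the isomorphism to the listed irreducibles.\<close>

lemma summand_submodule:
  assumes j: "j \<in> J" and N: "cfun.subspace N" "N \<subseteq> D j" and st: "\<And>a n u. a \<in> A \<Longrightarrow> u \<in> N \<Longrightarrow> Y a n u \<in> N"
    and V: "W \<subseteq> V" and Q: "lin_map Q" "inj Q" "Q ` N = T" "\<And>a n u. a \<in> A \<Longrightarrow> u \<in> N \<Longrightarrow> Q (Y a n u) = Y a n (Q u)"
  shows "submodule A act V (K j ` N)" "module_iso A act (K j ` N) Y T"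
proof -
  have ND: "u \<in> D j" if "u \<in> N" for u using that N(2) by blast
  show "submodule A act V (K j ` N)"
    unfolding submodule_def
  proof (intro conjI ballI allI)
    show "cfun.subspace (K j ` N)" by (intro lin_on_subspace_image[OF N(1)] lin_on_subset[OF K_lin[OF j] N(2)])
    show "K j ` N \<subseteq> V" using K_W[OF j ND] V by blast
    fix a n w assume a: "a \<in> A" and "w \<in> K j ` N"
    then obtain u where u: "w = K j u" "u \<in> N" by blast
    show "act a n w \<in> K j ` N" unfolding u(1) act_K(2)[OF j ND[OF u(2)] a] using st[OF a u(2)] by (rule imageI)
  qed
  \<comment> \<open>Taking the component after F undoes K j.\<close>
  define G where "G = (\<lambda>v. Q (component j (F v)))"
  have G: "G (K j u) = Q u" if "u \<in> N" for u
    unfolding G_def F_K[OF j ND[OF that]] component_summand by simp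
  have "K j ` N \<subseteq> W" using K_W[OF j ND] by blast
  then have FN: "lin_on (K j ` N) F" by (rule lin_on_subset[OF F(1)])
  have lin: "lin_on (K j ` N) G"
    unfolding G_def
    by (rule lin_on_compose[OF lin_on_compose[OF FN lin_map_on[OF component_lin, of UNIV]] lin_map_on[OF Q(1), of UNIV]]) simp_all
  have bij: "bij_betw G (K j ` N) T"
    unfolding bij_betw_def
  proof
    show "inj_on G (K j ` N)"
    proof (rule inj_onI)
      fix v w assume "v \<in> K j ` N" "w \<in> K j ` N" and eq: "G v = G w"
      then obtain x y where "v = K j x" "w = K j y" "x \<in> N" "y \<in> N" by blast
      with eq G Q(2) show "v = w" by (simp add: inj_eq)
    qed
    show "G ` K j ` N = T" unfolding Q(3)[symmetric] image_image by (rule image_cong[OF refl G])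
  qed
  have "G (act a n w) = Y a n (G w)" if a: "a \<in> A" and "w \<in> K j ` N" for a n w
  proof -
    obtain u where u: "w = K j u" "u \<in> N" using \<open>w \<in> K j ` N\<close> by blast
    show ?thesis unfolding u(1) act_K(2)[OF j ND[OF u(2)] a] G[OF u(2)] G[OF st[OF a u(2)]] by (rule Q(4)[OF a u(2)])
  qed
  with lin bij show "module_iso A act (K j ` N) Y T" unfolding module_iso_def by blast
qed

text \<open>\<sigma> is known on irreducible pieces only. When they share the eigenvalue, linearity
  extends it to the summand that they span, even if the pieces overlap.\<close>

lemma scalar_on_span:
  assumes j: "j \<in> J" and "lin_on V \<sigma>" "W \<subseteq> V" and P: "D j \<subseteq> cfun.span P" "P \<subseteq> D j"
    and "\<And>u. u \<in> P \<Longrightarrow> \<sigma> (K j u) = cscale s (K j u)" and u: "u \<in> D j"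
  shows "\<sigma> (K j u) = cscale s (K j u)"
proof -
  have V: "K j u \<in> V" if "u \<in> D j" for u using K_W[OF j that] assms(3) by blast
  have Kl: "K j (v + w) = K j v + K j w" "K j (cscale c v) = cscale c (K j v)" if "v \<in> D j" "w \<in> D j" for v w c
    using K_lin[OF j] that by (auto simp: lin_on_def)
  have sl: "\<sigma> (v + w) = \<sigma> v + \<sigma> w" "\<sigma> (cscale c v) = cscale c (\<sigma> v)" if "v \<in> V" "w \<in> V" for v w c
    using assms(2) that by (auto simp: lin_on_def)
  let ?S = "{u \<in> D j. \<sigma> (K j u) = cscale s (K j u)}"
  have "cfun.subspace ?S"
    unfolding cfun.subspace_def
  proof (intro conjI ballI allI)
    have z: "0 \<in> D j" using D by (rule cfun.subspace_0)
    then have "K j 0 = 0" by (rule lin_on_zero[OF K_lin[OF j]])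
    moreover have "\<sigma> 0 = 0" using lin_on_zero[OF assms(2)] V[OF z] calculation by simp
    ultimately show "0 \<in> ?S" using z by simp
  next
    fix v w assume "v \<in> ?S" "w \<in> ?S"
    then have v: "v \<in> D j" "\<sigma> (K j v) = cscale s (K j v)" and w: "w \<in> D j" "\<sigma> (K j w) = cscale s (K j w)" by blast+
    have "\<sigma> (K j (v + w)) = cscale s (K j (v + w))"
      unfolding Kl(1)[OF v(1) w(1)] sl(1)[OF V[OF v(1)] V[OF w(1)]] v(2) w(2) by (simp only: cfun.scale_right_distrib)
    moreover have "v + w \<in> D j" using v(1) w(1) D by (intro cfun.subspace_add)
    ultimately show "v + w \<in> ?S" by blast
  next
    fix c v assume "v \<in> ?S"
    then have v: "v \<in> D j" "\<sigma> (K j v) = cscale s (K j v)" by blast+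
    have "\<sigma> (K j (cscale c v)) = cscale s (K j (cscale c v))"
      unfolding Kl(2)[OF v(1) v(1)] sl(2)[OF V[OF v(1)] V[OF v(1)]] v(2) by (simp only: cfun.scale_scale mult.commute)
    moreover have "cscale c v \<in> D j" using v(1) D by (intro cfun.subspace_scale)
    ultimately show "cscale c v \<in> ?S" by blast
  qed
  moreover have "P \<subseteq> ?S" using assms(6) P(2) by blast
  ultimately have "cfun.span P \<subseteq> ?S" by (intro cfun.span_minimal)
  then show ?thesis using P(1) u by blast
qed

lemma eigenspace_K:
  assumes "a \<in> A" "j \<in> J" "u \<in> D j"
  shows "Y a n u = cscale c u \<longleftrightarrow> act a n (K j u) = cscale c (K j u)"
proof -
  have "cscale c (K j u) = K j (cscale c u)" using K_lin[OF assms(2)] assms(3) by (simp add: lin_on_def)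
  moreover have "cscale c u \<in> D j" using D assms(3) by (intro cfun.subspace_scale)
  then have "K j (Y a n u) = K j (cscale c u) \<longleftrightarrow> Y a n u = cscale c u"
    using F_K[OF assms(2)] act_K(1)[OF assms(2,3,1)] by (metis component_summand)
  ultimately show ?thesis unfolding act_K(2)[OF assms(2,3,1)] by metis
qed

end

section \<open>The moonshine module\<close>

lemma fock_theta_lin: "lin_on fin_supp (theta f s)"
  unfolding lin_on_def theta_def by (intro conjI ballI allI lin_ext_add lin_ext_cscale)

lemma VLambda_plus_props:
  "cfun.subspace (VLambda_plus \<Lambda> \<epsilon>)" "VLambda_plus \<Lambda> \<epsilon> \<subseteq> spt (in_sector 0)"
  and VLambdaT_plus_props:
  "cfun.subspace (VLambdaT_plus \<epsilon>)" "VLambdaT_plus \<epsilon> \<subseteq> spt (in_sector (1 / 2))"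
proof -
  show "cfun.subspace (VLambda_plus \<Lambda> \<epsilon>)" "cfun.subspace (VLambdaT_plus \<epsilon>)"
    unfolding VLambda_plus_def VLambdaT_plus_def leech_theta_def lattice_space_eq twisted_space_eq
    by (intro subspace_eigenspace lin_on_subset[OF fock_theta_lin] subspace_fsp, simp add: fsp_def)+
  have "lat \<Lambda> \<subseteq> in_sector 0" "twb UNIV \<subseteq> in_sector (1 / 2)" by (auto simp: lat_def twb_def in_sector_def)
  then show "VLambda_plus \<Lambda> \<epsilon> \<subseteq> spt (in_sector 0)" "VLambdaT_plus \<epsilon> \<subseteq> spt (in_sector (1 / 2))"
    unfolding VLambda_plus_def VLambdaT_plus_def lattice_space_eq twisted_space_eq eigenspace_def fsp_def spt_def
    by blast+
qed

lemma sectors_disjoint: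
  assumes "u \<in> spt (in_sector 0)" "v \<in> spt (in_sector (1 / 2))" "u + v = 0"
  shows "u = 0" "v = 0"
proof -
  have "u x = 0 \<and> v x = 0" for x
  proof -
    have "u x \<noteq> 0 \<Longrightarrow> sector x = 0" "v x \<noteq> 0 \<Longrightarrow> sector x = 1 / 2"
      using assms(1,2) unfolding spt_def in_sector_def by blast+
    moreover have "u x + v x = 0" using fun_cong[OF assms(3), of x] by simp
    ultimately show ?thesis by (cases "v x = 0"; cases "u x = 0") auto
  qed
  then show "u = 0" "v = 0" by auto
qed

lemma sum_in_sector:
  assumes "u \<in> spt (in_sector 0)" "v \<in> spt (in_sector (1 / 2))"
  shows "u + v \<in> spt (in_sector 0) \<Longrightarrow> v = 0" "u + v \<in> spt (in_sector (1 / 2)) \<Longrightarrow> u = 0"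
proof -
  have d: "x - y = 0" if "x \<in> spt X" "y \<in> spt X" "x - y \<in> spt Z" "X \<inter> Z = {}" for x y :: "('a, 'b) fvec" and X Z
    using cfun.subspace_diff[OF subspace_spt that(1,2)] that(3,4) by (force simp: spt_def)
  have e: "in_sector 0 \<inter> in_sector (1 / 2) = {}" "in_sector (1 / 2) \<inter> in_sector 0 = {}" by (auto simp: in_sector_def)
  show "u + v \<in> spt (in_sector 0) \<Longrightarrow> v = 0" using d[of "u + v" _ u, OF _ assms(1) _ e(1)] assms(2) by simp
  show "u + v \<in> spt (in_sector (1 / 2)) \<Longrightarrow> u = 0" using d[of "u + v" _ v, OF _ assms(2) _ e(2)] assms(1) by simp
qed

section \<open>Weight spaces of a sum of two stable halves\<close>

locale graded_sum =
  fixes V W1 W2 :: "('k \<Rightarrow> complex) set" and L0 :: "('k \<Rightarrow> complex) \<Rightarrow> 'k \<Rightarrow> complex" and a :: complex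
    and J1 :: "'j1 set" and U1 :: "'j1 \<Rightarrow> ('i \<Rightarrow> complex) set" and K1 :: "'j1 \<Rightarrow> ('i \<Rightarrow> complex) \<Rightarrow> 'k \<Rightarrow> complex"
    and J2 :: "'j2 set" and U2 :: "'j2 \<Rightarrow> ('i \<Rightarrow> complex) set" and K2 :: "'j2 \<Rightarrow> ('i \<Rightarrow> complex) \<Rightarrow> 'k \<Rightarrow> complex"
  assumes V: "cfun.subspace V" "lin_on V L0" and W: "cfun.subspace W1" "cfun.subspace W2" "W1 \<subseteq> V" "W2 \<subseteq> V"
    and direct: "\<And>u v. u \<in> W1 \<Longrightarrow> v \<in> W2 \<Longrightarrow> u + v = 0 \<Longrightarrow> u = 0 \<and> v = 0"
    and cover: "\<And>v. v \<in> V \<Longrightarrow> \<exists>u\<in>W1. \<exists>w\<in>W2. v = u + w"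
    and L0: "\<And>w. w \<in> W1 \<Longrightarrow> L0 w \<in> W1" "\<And>w. w \<in> W2 \<Longrightarrow> L0 w \<in> W2"
    and d1: "decomposition J1 U1 K1 (eigenspace L0 W1 a)"
    and d2: "decomposition J2 U2 K2 (eigenspace L0 W2 a)"
begin

text \<open>L0 preserves both halves and their sum is direct, so the eigenvalue equation
  splits.\<close>

lemma eig_split:
  assumes "v \<in> eigenspace L0 V a"
  shows "\<exists>u\<in>eigenspace L0 W1 a. \<exists>w\<in>eigenspace L0 W2 a. v = u + w"
proof -
  obtain u w where uw: "u \<in> W1" "w \<in> W2" "v = u + w"
    using cover[of v] assms unfolding eigenspace_def by blast
  have uV: "u \<in> V" "w \<in> V" using uw W by blast+
  have "L0 u + L0 w = cscale a u + cscale a w"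
    using assms V(2) uV unfolding eigenspace_def uw(3) lin_on_def by (simp add: cfun.scale_right_distrib)
  then have "(L0 u + cscale (- a) u) + (L0 w + cscale (- a) w) = 0"
    by (simp add: algebra_simps)
  moreover have "L0 u + cscale (- a) u \<in> W1" "L0 w + cscale (- a) w \<in> W2"
    using uw L0 W by (auto intro!: cfun.subspace_add cfun.subspace_scale simp del: cfun.scale_minus_left)
  ultimately have "L0 u + cscale (- a) u = 0" "L0 w + cscale (- a) w = 0" using direct by blast+
  then have "L0 u = cscale a u" "L0 w = cscale a w" by simp_all
  with uw show ?thesis unfolding eigenspace_def by blast
qed

definition UU :: "'j1 + 'j2 \<Rightarrow> ('i \<Rightarrow> complex) set" where "UU = case_sum U1 U2"
definition KK :: "'j1 + 'j2 \<Rightarrow> ('i \<Rightarrow> complex) \<Rightarrow> 'k \<Rightarrow> complex" where "KK = case_sum K1 K2"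

lemma sum_Plus: "(\<Sum>j\<in>J1 <+> J2. F j) = (\<Sum>j\<in>J1. F (Inl j)) + (\<Sum>j\<in>J2. F (Inr j))"
  for F :: "'j1 + 'j2 \<Rightarrow> 'b::comm_monoid_add"
  using decomposition.J[OF d1] decomposition.J[OF d2] by (simp add: sum.Plus)

text \<open>The twist by \<open>h\<close> makes the decomposition adapted to conjugates of a given automorphism.\<close>

lemma decomposition_twisted:
  assumes h: "lin_on V h" "inj_on h V" "h ` V = V" "\<And>v. v \<in> V \<Longrightarrow> L0 (h v) = h (L0 v)"
  shows "decomposition (J1 <+> J2) UU (\<lambda>j u. h (KK j u)) (eigenspace L0 V a)"
proof -
  interpret d1: decomposition J1 U1 K1 "eigenspace L0 W1 a" by (rule d1)
  interpret d2: decomposition J2 U2 K2 "eigenspace L0 W2 a" by (rule d2)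
  have sub: "eigenspace L0 W1 a \<subseteq> eigenspace L0 V a" "eigenspace L0 W2 a \<subseteq> eigenspace L0 V a"
    using W by (auto simp: eigenspace_def)
  have KV: "KK j u \<in> eigenspace L0 V a" if "j \<in> J1 <+> J2" "u \<in> UU j" for j u
    using that d1.K_in d2.K_in sub unfolding KK_def UU_def by (cases j) (auto simp: subset_iff)
  have eV: "eigenspace L0 V a \<subseteq> V" by (auto simp: eigenspace_def)
  have heig: "h v \<in> eigenspace L0 V a" if "v \<in> eigenspace L0 V a" for v
  proof -
    have v: "v \<in> V" "L0 v = cscale a v" using that by (auto simp: eigenspace_def)
    have "L0 (h v) = cscale a (h v)" using h(4)[OF v(1)] v h(1) by (simp add: lin_on_def)
    moreover have "h v \<in> V" using h(3) v(1) by blast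
    ultimately show ?thesis by (simp add: eigenspace_def)
  qed
  have KKlin: "lin_on (UU j) (KK j)" if "j \<in> J1 <+> J2" for j
    using that d1.K(1) d2.K(1) by (auto simp: UU_def KK_def)
  have sum1: "(\<Sum>j\<in>J1. K1 j (u j)) \<in> eigenspace L0 W1 a" if "\<And>j. j \<in> J1 \<Longrightarrow> u j \<in> U1 j" for u
    by (intro cfun.subspace_sum d1.V d1.K_in that)
  have sum2: "(\<Sum>j\<in>J2. K2 j (u j)) \<in> eigenspace L0 W2 a" if "\<And>j. j \<in> J2 \<Longrightarrow> u j \<in> U2 j" for u
    by (intro cfun.subspace_sum d2.V d2.K_in that)
  show ?thesis
  proof
    show "finite (J1 <+> J2)" using d1.J d2.J by simp
    show "cfun.subspace (UU j)" if "j \<in> J1 <+> J2" for j using that d1.U d2.U by (auto simp: UU_def)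
    show "cfun.subspace (eigenspace L0 V a)" by (rule subspace_eigenspace[OF V(2,1)])
    fix j assume j: "j \<in> J1 <+> J2"
    have im: "KK j ` UU j \<subseteq> V" using KV[OF j] eV by blast
    show "lin_on (UU j) (\<lambda>u. h (KK j u))" by (rule lin_on_compose[OF KKlin[OF j] h(1) im])
    show "(\<lambda>u. h (KK j u)) ` UU j \<subseteq> eigenspace L0 V a" using KV[OF j] heig by blast
  next
    fix u j assume u: "\<And>j. j \<in> J1 <+> J2 \<Longrightarrow> u j \<in> UU j" and 0: "(\<Sum>j\<in>J1 <+> J2. h (KK j (u j))) = 0"
      and j: "j \<in> J1 <+> J2"
    have u1: "u (Inl j) \<in> U1 j" if "j \<in> J1" for j using u[OF InlI[OF that]] by (simp add: UU_def)
    have u2: "u (Inr j) \<in> U2 j" if "j \<in> J2" for j using u[OF InrI[OF that]] by (simp add: UU_def)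
    have KuV: "KK j (u j) \<in> V" if "j \<in> J1 <+> J2" for j using KV[OF that u[OF that]] eV by blast
    have "h (\<Sum>j\<in>J1 <+> J2. KK j (u j)) = 0" 
      using lin_on_sum[of V h "J1 <+> J2" "\<lambda>j. KK j (u j)", OF h(1) V(1) KuV] 0 by simp
    moreover have "h 0 = 0" by (rule lin_on_zero[OF h(1) cfun.subspace_0[OF V(1)]])
    moreover have "(\<Sum>j\<in>J1 <+> J2. KK j (u j)) \<in> V" by (intro cfun.subspace_sum V(1) KuV)
    ultimately have "(\<Sum>j\<in>J1 <+> J2. KK j (u j)) = 0"
      using inj_onD[OF h(2), of "\<Sum>j\<in>J1 <+> J2. KK j (u j)" 0] cfun.subspace_0[OF V(1)] by simp
    then have "(\<Sum>j\<in>J1. K1 j (u (Inl j))) + (\<Sum>j\<in>J2. K2 j (u (Inr j))) = 0"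
      unfolding sum_Plus by (simp add: KK_def)
    moreover have "(\<Sum>j\<in>J1. K1 j (u (Inl j))) \<in> W1" "(\<Sum>j\<in>J2. K2 j (u (Inr j))) \<in> W2"
      using sum1[of "\<lambda>j. u (Inl j)", OF u1] sum2[of "\<lambda>j. u (Inr j)", OF u2] by (simp_all add: eigenspace_def)
    ultimately have z: "(\<Sum>j\<in>J1. K1 j (u (Inl j))) = 0" "(\<Sum>j\<in>J2. K2 j (u (Inr j))) = 0"
      using direct by blast+
    show "u j = 0"
    proof (cases j)
      case (Inl i)
      have "i \<in> J1" using j Inl by auto
      with d1.uniq[of "\<lambda>j. u (Inl j)", OF u1 z(1)] show ?thesis by (simp add: Inl)
    next
      case (Inr i)
      have "i \<in> J2" using j Inr by auto
      with d2.uniq[of "\<lambda>j. u (Inr j)", OF u2 z(2)] show ?thesis by (simp add: Inr)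
    qed
  next
    fix v assume v: "v \<in> eigenspace L0 V a"
    then have "v \<in> h ` V" using h(3) eV by blast
    then obtain x where x: "x \<in> V" "v = h x" by blast
    have "L0 x \<in> V"
    proof -
      obtain u w where uw: "u \<in> W1" "w \<in> W2" "x = u + w" using cover[OF x(1)] by blast
      have "L0 x = L0 u + L0 w" using V(2) uw W unfolding lin_on_def by blast
      moreover have "L0 u \<in> V" "L0 w \<in> V" using L0 uw W by blast+
      ultimately show ?thesis using V(1) by (simp only: cfun.subspace_add)
    qed
    moreover have "cscale a x \<in> V" using V(1) x(1) by (rule cfun.subspace_scale)
    \<comment> \<open>The eigenvalue equation of v = h x is pulled back to x, since h commutes with
      L0 and is injective.\<close>
    moreover have "h (L0 x) = h (cscale a x)"
      using v h(4)[OF x(1)] h(1) x unfolding eigenspace_def lin_on_def by simp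
    ultimately have "L0 x = cscale a x" using inj_onD[OF h(2)] by blast
    then have "x \<in> eigenspace L0 V a" using x(1) by (simp add: eigenspace_def)
    from eig_split[OF this] obtain p q where pq: "p \<in> eigenspace L0 W1 a" "q \<in> eigenspace L0 W2 a" "x = p + q" by blast
    from d1.surj[OF pq(1)] obtain u1 where u1: "\<forall>j\<in>J1. u1 j \<in> U1 j" "p = (\<Sum>j\<in>J1. K1 j (u1 j))" by blast
    from d2.surj[OF pq(2)] obtain u2 where u2: "\<forall>j\<in>J2. u2 j \<in> U2 j" "q = (\<Sum>j\<in>J2. K2 j (u2 j))" by blast
    let ?u = "case_sum u1 u2"
    have u: "?u j \<in> UU j" if "j \<in> J1 <+> J2" for j using that u1(1) u2(1) by (auto simp: UU_def)
    have "x = (\<Sum>j\<in>J1 <+> J2. KK j (?u j))" unfolding sum_Plus pq(3) u1(2) u2(2) by (simp add: KK_def)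
    then have "v = (\<Sum>j\<in>J1 <+> J2. h (KK j (?u j)))"
      unfolding x(2) using lin_on_sum[OF h(1) V(1), of "J1 <+> J2" "\<lambda>j. KK j (?u j)"] KV[OF _ u] eV by blast
    then show "\<exists>u. (\<forall>j\<in>J1 <+> J2. u j \<in> UU j) \<and> v = (\<Sum>j\<in>J1 <+> J2. h (KK j (u j)))"
      using u by (intro exI[of _ ?u] conjI ballI)
  qed
qed

end

context module_sum
begin

lemma eigenspace_decomposition:
  assumes a: "a \<in> A" and lin: "\<And>j. j \<in> J \<Longrightarrow> lin_on (D j) (Y a n)" and linW: "lin_on W (act a n)"
  shows "decomposition J (\<lambda>j. eigenspace (Y a n) (D j) c) K (eigenspace (act a n) W c)"
proof
  show "finite J" by (rule J)
  show "cfun.subspace (eigenspace (Y a n) (D j) c)" if "j \<in> J" for j by (rule subspace_eigenspace[OF lin[OF that] D])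
  show "cfun.subspace (eigenspace (act a n) W c)" by (rule subspace_eigenspace[OF linW W])
  fix j assume j: "j \<in> J"
  show "lin_on (eigenspace (Y a n) (D j) c) (K j)"
    by (rule lin_on_subset[OF K_lin[OF j]]) (auto simp: eigenspace_def)
  show "K j ` eigenspace (Y a n) (D j) c \<subseteq> eigenspace (act a n) W c"
  proof (rule image_subsetI)
    fix u assume "u \<in> eigenspace (Y a n) (D j) c"
    then have u: "u \<in> D j" "Y a n u = cscale c u" by (auto simp: eigenspace_def)
    then show "K j u \<in> eigenspace (act a n) W c"
      using eigenspace_K[OF a j u(1)] K_W[OF j u(1)] by (simp add: eigenspace_def)
  qed
next
  fix u j assume u: "\<And>j. j \<in> J \<Longrightarrow> u j \<in> eigenspace (Y a n) (D j) c" and 0: "(\<Sum>j\<in>J. K j (u j)) = 0" and j: "j \<in> J"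
  have "u j \<in> D j" if "j \<in> J" for j using u[OF that] by (simp add: eigenspace_def)
  then show "u j = 0" by (rule K_uniq[OF _ 0 j])
next
  fix w assume "w \<in> eigenspace (act a n) W c"
  then have w: "w \<in> W" "act a n w = cscale c w" by (auto simp: eigenspace_def)
  have "component j (F w) \<in> eigenspace (Y a n) (D j) c" if j: "j \<in> J" for j
  proof -
    have "Y a n (component j (F w)) = component j (F (act a n w))"
      unfolding intertwine[OF a w(1)] component_dsum_act ..
    also have "\<dots> = component j (cscale c (F w))" using F(1) w by (simp add: lin_on_def)
    also have "\<dots> = cscale c (component j (F w))" by (simp add: component_def cscale_def)
    finally show ?thesis using K_surj(2)[OF w(1) j] by (simp add: eigenspace_def)
  qed
  then show "\<exists>u. (\<forall>j\<in>J. u j \<in> eigenspace (Y a n) (D j) c) \<and> w = (\<Sum>j\<in>J. K j (u j))"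
    by (intro exI[of _ "\<lambda>j. component j (F w)"] conjI ballI K_surj(1)[OF w(1)])
qed

end

section \<open>Codes\<close>

lemma finite_bit_vec: "finite (D :: (bit ^ 'n::finite) set)"
proof -
  have "x \<in> vec_lambda ` PiE UNIV (\<lambda>_::'n. {0, 1})" for x :: "bit ^ 'n"
  proof (rule image_eqI[of _ _ "vec_nth x"])
    have "b = 0 \<or> b = 1" for b :: bit by (cases b) auto
    then show "vec_nth x \<in> PiE UNIV (\<lambda>_::'n. {0, 1})" by auto
  qed simp
  then have "D \<subseteq> vec_lambda ` PiE UNIV (\<lambda>_::'n. {0, 1})" by blast
  then show ?thesis by (rule finite_subset) (intro finite_imageI finite_PiE, auto)
qed

lemma type_II_zmod: "type_II_code k C \<Longrightarrow> C \<subseteq> zmod_space k"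
  by (simp add: type_II_code_def linear_code_def)

lemma finite_zmod: "finite (zmod_space k :: ('n::finite \<Rightarrow> int) set)"
proof -
  have "zmod_space k \<subseteq> PiE UNIV (\<lambda>_::'n. {0..<2 * int k})" by (auto simp: zmod_space_def)
  then show ?thesis by (rule finite_subset) (intro finite_PiE finite finite_atLeastLessThan_int)
qed

definition half_word :: "nat \<Rightarrow> bit ^ 'n::finite \<Rightarrow> 'n \<Rightarrow> int" where
  "half_word k d = (\<lambda>j. if d $ j = 0 then 0 else int k)"

lemma in_C2_values:
  assumes "c \<in> zmod_space k" "in_C2 k c" "k > 0"
  shows "c j = 0 \<or> c j = int k"
proof -
  obtain m where m: "c j = int k * m" using assms(2) by (auto simp: in_C2_def dvd_def)
  have "0 \<le> c j" "c j < int k * 2" using assms(1) by (auto simp: zmod_space_def mult.commute)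
  then have "0 \<le> int k * m" "int k * m < int k * 2" unfolding m .
  then have "0 \<le> m" "m < 2" using assms(3) by (auto simp: zero_le_mult_iff mult_less_cancel_left)
  then have "m = 0 \<or> m = 1" by linarith
  then show ?thesis using m by auto
qed

lemma half_word_bij:
  assumes C: "C \<subseteq> zmod_space k" and k: "k > 0"
  shows "bij_betw (half_word k) (C2 k C) {c \<in> C. in_C2 k c}"
proof (rule bij_betwI[where g = "\<lambda>c. \<chi> i. if c i = 0 then 0 else 1"])
  have hw: "half_word k (\<chi> i. if c i = 0 then 0 else 1) = c" if "c \<in> C" "in_C2 k c" for c
    using in_C2_values[of c k, OF _ that(2) k] that(1) C by (fastforce simp: half_word_def)
  then show "half_word k \<in> C2 k C \<rightarrow> {c \<in> C. in_C2 k c}" by (auto simp: C2_def)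
  show "(\<lambda>c. \<chi> i. if c i = 0 then 0 else 1) \<in> {c \<in> C. in_C2 k c} \<rightarrow> C2 k C" by (auto simp: C2_def)
  show "half_word k (\<chi> i. if c i = 0 then 0 else 1) = c" if "c \<in> {c \<in> C. in_C2 k c}" for c using hw that by blast
  have b: "b = 0 \<or> b = 1" for b :: bit by (cases b) auto
  show "(\<chi> i. if half_word k d i = 0 then 0 else 1) = d" if "d \<in> C2 k C" for d
    using k b by (auto simp: half_word_def vec_eq_iff)
qed

lemma bsgn_half_word: "odd k \<Longrightarrow> bsgn (tau i (half_word k d)) = bsgn (d $ i)" for d :: "bit ^ 'n::finite"
  by (simp add: tau_def half_word_def bsgn_def of_int_bit_eq_0)

text \<open>For odd \<open>k\<close> the weights of \<open>C\<^sub>2\<close> are divisible by four, so that its dual contains the all-one word.\<close>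

lemma C2_even:
  fixes d :: "bit ^ 'n::finite"
  assumes "type_II_code k C" "odd k" "d \<in> C2 k C"
  shows "(\<Sum>i\<in>UNIV. d $ i) = 0"
proof -
  have k: "k > 0" using assms(2) by (cases k) auto
  obtain c where c: "c \<in> C" "in_C2 k c" and d: "d = (\<chi> i. if c i = 0 then 0 else 1)"
    using assms(3) by (auto simp: C2_def)
  have v: "c j = 0 \<or> c j = int k" for j using in_C2_values[OF _ c(2) k] c(1) type_II_zmod[OF assms(1)] by blast
  have "(if c i \<le> int k then c i else c i - 2 * int k)\<^sup>2 = (if c i \<noteq> 0 then (int k)\<^sup>2 else 0)" for i
    using v[of i] by auto
  then have "euclidean_weight k c = (\<Sum>i\<in>UNIV. if c i \<noteq> 0 then (int k)\<^sup>2 else 0)"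
    unfolding euclidean_weight_def by simp
  also have "\<dots> = (\<Sum>i\<in>{i\<in>UNIV. c i \<noteq> 0}. (int k)\<^sup>2)" by (rule sum.inter_filter[symmetric]) simp
  also have "\<dots> = int (card {i. c i \<noteq> 0}) * (int k)\<^sup>2" by simp
  finally have "4 * int k dvd int (card {i. c i \<noteq> 0}) * (int k)\<^sup>2"
    using assms(1) c(1) unfolding type_II_code_def by metis
  \<comment> \<open>Parity is enough: k is odd, so the support has even size, which is orthogonality
    to the all-one word.\<close>
  then have "even (int (card {i. c i \<noteq> 0}) * (int k)\<^sup>2)" by (metis dvd_mult_left dvd_trans even_numeral)
  then have "even (int (card {i. c i \<noteq> 0}))" using assms(2) by simp
  moreover have "(\<Sum>i\<in>UNIV. d $ i) = of_int (int (card {i. c i \<noteq> 0}))"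
  proof -
    have "(\<Sum>i\<in>UNIV. d $ i) = (\<Sum>i\<in>UNIV. if c i \<noteq> 0 then 1 else 0)" unfolding d by (rule sum.cong) auto
    also have "\<dots> = (\<Sum>i\<in>{i\<in>UNIV. c i \<noteq> 0}. 1)" by (rule sum.inter_filter[symmetric]) simp
    finally show ?thesis by simp
  qed
  ultimately show ?thesis by (metis of_int_bit_eq_0)
qed

lemma binary_dual_shift:
  fixes x :: "bit ^ 'n::finite"
  assumes "type_II_code k C" "odd k" "x \<in> binary_dual (C2 k C)"
  shows "(\<chi> i. x $ i + 1) \<in> binary_dual (C2 k C)"
  unfolding binary_dual_def mem_Collect_eq
proof
  fix d assume d: "d \<in> C2 k C"
  have "(\<Sum>i\<in>UNIV. (\<chi> i. x $ i + 1) $ i * d $ i) = (\<Sum>i\<in>UNIV. x $ i * d $ i) + (\<Sum>i\<in>UNIV. d $ i)"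
    by (simp only: vec_lambda_beta distrib_right sum.distrib mult_1)
  also have "\<dots> = 0" using assms(3) d C2_even[OF assms(1,2) d] unfolding binary_dual_def by simp
  finally show "(\<Sum>i\<in>UNIV. (\<chi> i. x $ i + 1) $ i * d $ i) = 0" .
qed

lemma twisted_trace_zero:
  fixes i :: "'n::finite"
  assumes "type_II_code k C" "odd k" and h: "\<And>c :: bit ^ 'n. h (\<chi> i. c $ i + 1) = (h c :: nat)"
  shows "(\<Sum>(c, j)\<in>binary_dual (C2 k C) \<times> {..<N::nat}. (if c $ i = 0 then \<i> else - \<i>) * of_nat (h c)) = 0"
proof -
  let ?D = "binary_dual (C2 k C)" and ?s = "\<lambda>c :: bit ^ 'n. if c $ i = 0 then \<i> else - \<i>"
  let ?p = "\<lambda>c :: bit ^ 'n. \<chi> i. c $ i + 1"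
  have pp: "?p (?p c) = c" for c by (simp add: vec_eq_iff add.assoc)
  have "bij_betw ?p ?D ?D"
    by (rule bij_betwI[where g = ?p]) (use binary_dual_shift[OF assms(1,2)] pp in auto)
  then have "(\<Sum>c\<in>?D. ?s c * of_nat (h c)) = (\<Sum>c\<in>?D. ?s (?p c) * of_nat (h (?p c)))"
    by (rule sum.reindex_bij_betw[symmetric])
  also have "\<dots> = (\<Sum>c\<in>?D. - (?s c * of_nat (h c)))"
  proof (rule sum.cong[OF refl])
    fix c :: "bit ^ 'n"
    have "b + 1 = 0 \<longleftrightarrow> b \<noteq> 0" for b :: bit by (cases b) auto
    then have "?s (?p c) = - ?s c" by simp
    then show "?s (?p c) * of_nat (h (?p c)) = - (?s c * of_nat (h c))" unfolding h by (simp only: mult_minus_left)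
  qed
  also have "\<dots> = - (\<Sum>c\<in>?D. ?s c * of_nat (h c))" by (rule sum_negf)
  finally have "(\<Sum>c\<in>?D. ?s c * of_nat (h c)) = 0" by simp
  then show ?thesis by (subst sum.cartesian_product[symmetric]) (simp add: sum_distrib_left[symmetric])
qed

text \<open>R contains exactly one of c and -c, so negation maps R bijectively onto the rest of the
  words outside C_2.\<close>

lemma sum_half_system:
  fixes q :: "('n::finite \<Rightarrow> int) \<Rightarrow> complex"
  assumes C: "linear_code k C" and k: "k > 0" and R: "half_system k C R"
    and q: "\<And>c. c \<in> C \<Longrightarrow> q (\<lambda>i. (- c i) mod (2 * int k)) = q c"
  shows "2 * (\<Sum>c\<in>R. q c) = (\<Sum>c\<in>{c \<in> C. \<not> in_C2 k c}. q c)"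
proof -
  let ?n = "\<lambda>(c :: 'n \<Rightarrow> int) i. (- c i) mod (2 * int k)" and ?E = "{c \<in> C. \<not> in_C2 k c}"
  have z: "C \<subseteq> zmod_space k" using C by (simp add: linear_code_def)
  then have fin: "finite C" using finite_zmod finite_subset by blast
  have nC: "?n c \<in> C" if "c \<in> C" for c
  proof -
    have "(\<lambda>i. ((-1) * c i) mod (2 * int k)) \<in> C" using C that unfolding linear_code_def by blast
    then show ?thesis by simp
  qed
  have nn: "?n (?n c) = c" if "c \<in> C" for c
  proof
    fix i
    have "0 \<le> c i" "c i < 2 * int k" using that z by (auto simp: zmod_space_def)
    then show "?n (?n c) i = c i" by (simp add: mod_minus_eq)
  qed
  have nE: "\<not> in_C2 k (?n c)" if "\<not> in_C2 k c" for c
  proof -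
    have "int k dvd (- c i) mod (2 * int k) \<longleftrightarrow> int k dvd c i" for i by (simp add: dvd_mod_iff)
    then show ?thesis using that by (simp add: in_C2_def)
  qed
  have alt: "c \<in> R \<longleftrightarrow> ?n c \<notin> R" if "c \<in> ?E" for c
    using R that by (auto simp: half_system_def)
  have RE: "R \<subseteq> ?E" using R by (auto simp: half_system_def)
  have "bij_betw ?n R (?E - R)"
  proof (rule bij_betwI[where g = ?n])
    show "?n \<in> R \<rightarrow> ?E - R"
    proof
      fix c assume c: "c \<in> R"
      then have "c \<in> ?E" using RE by blast
      then show "?n c \<in> ?E - R" using alt[of c] c nC[of c] nE[of c] by blast
    qed
    show "?n \<in> ?E - R \<rightarrow> R"
    proof
      fix c assume "c \<in> ?E - R"
      then show "?n c \<in> R" using alt[of c] by blast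
    qed
  qed (use nn RE in blast)+
  then have "(\<Sum>c\<in>?E - R. q c) = (\<Sum>c\<in>R. q (?n c))" by (rule sum.reindex_bij_betw[symmetric])
  also have "\<dots> = (\<Sum>c\<in>R. q c)" by (rule sum.cong[OF refl]) (rule q, use RE in blast)
  finally have "(\<Sum>c\<in>?E - R. q c) = (\<Sum>c\<in>R. q c)" .
  moreover have "(\<Sum>c\<in>?E. q c) = (\<Sum>c\<in>?E - R. q c) + (\<Sum>c\<in>R. q c)"
    using fin RE by (intro sum.subset_diff) auto
  ultimately show ?thesis by simp
qed

section \<open>Graded trace of the untwisted part\<close>

context rank1
begin

lemma ch_M_nth: "fps_nth (ch_M k \<rho> c) n = of_nat (card (states c n))"
  unfolding ch_M_def character_def VLplus24_simps M_code_def by (simp add: eigenspace_code dim_fsp)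

lemma dim_M_code: "cfun.dim (eigenspace L0t (M_code k c) (of_nat n)) = card (states c n)"
  unfolding M_code_def eigenspace_code dim_fsp ..

lemma dim_M_plus_code:
  "2 * of_nat (cfun.dim (eigenspace L0t (M_plus k \<rho> d) (of_nat n))) =
    of_nat (card (states (half_word k d) n)) + (if d = 0 then fps_nth (b_series k \<rho> ^ 24) n else 0)"
proof -
  have hw: "half_word k d j = 0 \<or> half_word k d j = int k" for j by (simp add: half_word_def)
  have M: "M_plus k \<rho> d = cfun.span (\<Union>e\<in>{e. (\<Prod>j\<in>UNIV. psgn (e j)) = 1}. tensor (\<lambda>j. V_pm k \<rho> (half_word k d j) (e j)))"
    by (simp add: M_plus_def half_word_def)
  note D = dim_M_plus[of "half_word k d" n, OF hw, folded M]
  show ?thesis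
  proof (cases "d = 0")
    case True
    then have "half_word k d = (\<lambda>_. 0)" by (simp add: half_word_def)
    then show ?thesis using D b_series_power[where 'n = 24, of n] True by simp
  next
    case False
    \<comment> \<open>A coordinate in \<alpha>/2 + L never has momentum 0, so no tuple is fixed and
      the trace of \<theta> vanishes.\<close>
    then obtain j where "d $ j \<noteq> 0" by (auto simp: vec_eq_iff)
    then have "half_word k d j = int k" by (simp add: half_word_def)
    have "f \<in> states (half_word k d) n \<and> (\<forall>j. \<theta>.\<pi> (f j) = f j) \<longleftrightarrow> False" for f
    proof -
      have "f j \<in> lat (rank1_coset k (half_word k d j))" if "f \<in> states (half_word k d) n"
        using that unfolding states_def by blast
      then have "f j \<in> lat (rank1_coset k (int k))" if "f \<in> states (half_word k d) n"
        using that unfolding \<open>half_word k d j = int k\<close> by blast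
      then show ?thesis using fixed_states_half by blast
    qed
    then have E: "{f. f \<in> states (half_word k d) n \<and> (\<forall>j. \<theta>.\<pi> (f j) = f j)} = {}"
      by (simp only: Collect_empty_eq simp_thms)
    show ?thesis using D unfolding E by (simp add: False)
  qed
qed

text \<open>Everything is doubled first: M(c)^+ is half of M(c) up to the trace of \<theta>, and R
  is half of the words outside C_2, so all of C enters with one common factor 1/2.\<close>

lemma untwisted_trace:
  assumes C: "type_II_code k C" and "odd k" and R: "half_system k C R"
  shows "(\<Sum>d\<in>C2 k C. bsgn (d $ i) * of_nat (cfun.dim (eigenspace L0t (M_plus k \<rho> d) (of_nat n)))) +
      (\<Sum>c\<in>R. bsgn (tau i c) * of_nat (cfun.dim (eigenspace L0t (M_code k c) (of_nat n)))) =
    fps_nth (fps_const (1 / 2) * (\<Sum>c\<in>C. fps_const (bsgn (tau i c)) * ch_M k \<rho> c) +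
      fps_const (1 / 2) * b_series k \<rho> ^ 24) n" (is "?L1 + ?L2 = ?r")
proof -
  let ?q = "\<lambda>c. bsgn (tau i c) * of_nat (card (states c n))"
  have lin: "linear_code k C" and z: "C \<subseteq> zmod_space k" using C by (auto simp: type_II_code_def linear_code_def)
  then have fin: "finite C" using finite_zmod finite_subset by blast
  have zero: "0 \<in> C2 k C"
    using lin unfolding C2_def linear_code_def in_C2_def by (force simp: vec_eq_iff)
  have finC2: "finite (C2 k C)" by (rule finite_bit_vec)
  have q: "?q (\<lambda>i. (- c i) mod (2 * int k)) = ?q c" if "c \<in> C" for c
  proof -
    have "even ((- c i) mod (2 * int k)) \<longleftrightarrow> even (c i)" by (simp add: dvd_mod_iff)
    then show ?thesis by (simp add: card_states_uminus bsgn_def tau_def of_int_bit_eq_0)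
  qed
  have R2: "2 * ?L2 = (\<Sum>c\<in>{c \<in> C. \<not> in_C2 k c}. ?q c)"
    unfolding dim_M_code by (rule sum_half_system[of k C R ?q, OF lin k R q])
  have "2 * ?L1 = (\<Sum>d\<in>C2 k C. bsgn (d $ i) * (2 * of_nat (cfun.dim (eigenspace L0t (M_plus k \<rho> d) (of_nat n)))))"
    by (simp add: sum_distrib_left mult_ac)
  \<comment> \<open>The correction survives at d = 0 only, where the sign is 1; this is why b^24
    enters unsigned.\<close>
  also have "\<dots> = (\<Sum>d\<in>C2 k C. ?q (half_word k d) + (if d = 0 then fps_nth (b_series k \<rho> ^ 24) n else 0))"
    unfolding dim_M_plus_code bsgn_half_word[OF \<open>odd k\<close>] distrib_left
    by (intro sum.cong refl arg_cong2[where f = "(+)"]) (auto simp: bsgn_def)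
  also have "\<dots> = (\<Sum>d\<in>C2 k C. ?q (half_word k d)) + fps_nth (b_series k \<rho> ^ 24) n"
    using finC2 zero by (simp add: sum.distrib sum.delta)
  also have "(\<Sum>d\<in>C2 k C. ?q (half_word k d)) = (\<Sum>c\<in>{c \<in> C. in_C2 k c}. ?q c)"
    by (rule sum.reindex_bij_betw[OF half_word_bij[OF z k]])
  finally have L1: "2 * ?L1 = (\<Sum>c\<in>{c \<in> C. in_C2 k c}. ?q c) + fps_nth (b_series k \<rho> ^ 24) n" .
  have "(\<Sum>c\<in>C. ?q c) = (\<Sum>c\<in>{c \<in> C. in_C2 k c} \<union> {c \<in> C. \<not> in_C2 k c}. ?q c)"
    by (rule sum.cong) auto
  also have "\<dots> = (\<Sum>c\<in>{c \<in> C. in_C2 k c}. ?q c) + (\<Sum>c\<in>{c \<in> C. \<not> in_C2 k c}. ?q c)"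
    using fin by (intro sum.union_disjoint) auto
  finally have "2 * (?L1 + ?L2) = (\<Sum>c\<in>C. ?q c) + fps_nth (b_series k \<rho> ^ 24) n"
    unfolding distrib_left L1 R2 by simp
  moreover have "x = y / 2" if "2 * x = y" for x y :: complex using that by auto
  ultimately have "?L1 + ?L2 = ((\<Sum>c\<in>C. ?q c) + fps_nth (b_series k \<rho> ^ 24) n) / 2" by blast
  also have "\<dots> = ?r"
    by (simp add: fps_sum_nth ch_M_nth add_divide_distrib)
  finally show ?thesis .
qed

end

section \<open>The action of \<open>\<sigma>\<close> and its trace\<close>

context rank1
begin

lemma Yt_lin: "W \<subseteq> fin_supp \<Longrightarrow> lin_on W (Yt u n)"
  by (rule lin_on_tensor_mode)

lemma subspace_code: "cfun.subspace (M_code k c)" "cfun.subspace (M_plus k \<rho> d)" "cfun.subspace (MT_minus \<rho> d)"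
  unfolding M_code_def M_plus_def MT_minus_def by (simp_all add: tensor_subspace)

lemma M_code_fin_supp: "M_code k c \<subseteq> fin_supp"
  unfolding M_code_def V_coset_def lattice_space_eq tensor_fsp by (auto simp: fsp_def)

lemma M_plus_subset: "M_plus k \<rho> d \<subseteq> M_code k (half_word k d)"
  unfolding M_plus_def M_code_def
proof (rule cfun.span_minimal[OF _ tensor_subspace], rule UN_least)
  fix e
  have "V_pm k \<rho> r s \<subseteq> V_coset k r" for r s by (auto simp: V_pm_def eigenspace_def)
  then show "tensor (\<lambda>i. V_pm k \<rho> (if d $ i = 0 then 0 else int k) (e i)) \<subseteq> tensor (\<lambda>i. V_coset k (half_word k d i))"
    unfolding half_word_def by (intro tensor_mono)
qed

lemma MT_minus_subset: "MT_minus \<rho> d \<subseteq> tensor (\<lambda>j. twisted_space {d $ j})"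
  unfolding MT_minus_def
  by (rule cfun.span_minimal[OF _ tensor_subspace], rule UN_least, rule tensor_mono) (auto simp: VT_pm_def eigenspace_def)

lemma M_code_span: "M_code k c \<subseteq> cfun.span (\<Union>e. tensor (upart c e))" "tensor (upart c e) \<subseteq> M_code k c"
proof -
  interpret sign_split "\<lambda>_::24. \<theta>.\<pi>" "\<lambda>_. \<theta>.co" "\<lambda>j. V_coset k (c j)" "{j. c j = 0 \<or> c j = int k}"
    by (rule sign_split_untwisted)
  show "M_code k c \<subseteq> cfun.span (\<Union>e. tensor (upart c e))"
    using tensor_in_span_parts unfolding upart_eq M_code_def .
  show "tensor (upart c e) \<subseteq> M_code k c" unfolding M_code_def
    by (rule tensor_mono) (auto simp: upart_def V_pm_def eigenspace_def)
qed

lemma half_word_zmod: "half_word k d \<in> zmod_space k"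
  using k by (auto simp: half_word_def zmod_space_def)

end

lemma acts_by_mu_image:
  assumes "acts_by_mu k \<rho> i act V \<sigma>" "\<And>j. w j \<in> irreps k"
    and "submodule (vcarrier (VLplus24 k \<rho>)) act V N"
    and "module_iso (vcarrier (VLplus24 k \<rho>)) act N (vmode (VLplus24 k \<rho>)) (tensor (\<lambda>j. irr_space k \<rho> (w j)))"
    and "v \<in> N"
  shows "\<sigma> v = cscale (mu (w i)) v"
  using assms unfolding acts_by_mu_def Let_def by blast

theorem corollary3p8:
  fixes k :: nat and C R :: "(24 \<Rightarrow> int) set" and \<rho> :: "real \<Rightarrow> complex"
    and \<Lambda> :: "(real ^ 24) set" and \<epsilon> :: "real ^ 24 \<Rightarrow> real ^ 24 \<Rightarrow> complex"
    and T :: "real ^ 24 \<Rightarrow> ('t::finite \<Rightarrow> complex) \<Rightarrow> 't \<Rightarrow> complex"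
    and Vnat :: "(real ^ 24, 't) fvec voa"
    and \<iota> :: "((24 \<Rightarrow> (real, bit) fock) \<Rightarrow> complex) \<Rightarrow> (real ^ 24, 't) fvec"
    and i :: 24 and \<sigma> :: "(real ^ 24, 't) fvec \<Rightarrow> (real ^ 24, 't) fvec"
  assumes "k \<ge> 2" and "odd k" and "extremal_type_II_code k C"
    and "rho_hom k \<rho>"
    and "leech_lattice \<Lambda>" and "central_extension \<Lambda> \<epsilon>" and "twisted_rep \<Lambda> \<epsilon> T"
    and "moonshine_voa \<Lambda> \<epsilon> T Vnat"
    and "voa_embedding (VLplus24 k \<rho>) Vnat \<iota>"
    and "\<iota> ` vcarrier (VLplus24 k \<rho>) \<subseteq> VLambda_plus \<Lambda> \<epsilon>"
    and "half_system k C R"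
    and "untwisted_decomposition k \<rho> C R (vcarrier (VLplus24 k \<rho>)) (natural_act Vnat \<iota>) (VLambda_plus \<Lambda> \<epsilon>)"
    and "twisted_decomposition k \<rho> C (vcarrier (VLplus24 k \<rho>)) (natural_act Vnat \<iota>) (VLambdaT_plus \<epsilon>)"
    and "\<sigma> \<in> voa_aut Vnat"
    and "acts_by_mu k \<rho> i (natural_act Vnat \<iota>) (vcarrier Vnat) \<sigma>"
  shows "\<forall>g\<in>aut_conj_class Vnat \<sigma>. mckay_thompson Vnat g =
    fls_X_inv * fps_to_fls
      (fps_const (1 / 2) * (\<Sum>c\<in>C. fps_const (bsgn (tau i c)) * ch_M k \<rho> c)
        + fps_const (1 / 2) * b_series k \<rho> ^ 24)"
proof -
  interpret rank1 k \<rho> using assms(1,4) by unfold_locales auto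
  define V where "V = vcarrier Vnat"
  define W1 where "W1 = (VLambda_plus \<Lambda> \<epsilon> :: (real ^ 24, 't) fvec set)"
  define W2 where "W2 = (VLambdaT_plus \<epsilon> :: (real ^ 24, 't) fvec set)"
  define act where "act = natural_act Vnat \<iota>"
  define A where "A = (At :: ((24 \<Rightarrow> (real, bit) fock) \<Rightarrow> complex) set)"
  define L0 where "L0 = vmode Vnat (vconf Vnat) 1"
  note VL = VLplus24_simps[of k \<rho>]
  have A: "vcarrier (VLplus24 k \<rho>) = A" by (simp add: VL A_def)
  have tII: "type_II_code k C" using assms(3) by (simp add: extremal_type_II_code_def)
  have mv: "is_voa Vnat" "V = {u + v | u v. u \<in> W1 \<and> v \<in> W2}"
    "\<And>u n w. u \<in> W1 \<Longrightarrow> w \<in> V \<Longrightarrow> vmode Vnat u n w = fock_mode \<epsilon> T u n w"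
    using assms(8) unfolding moonshine_voa_def V_def W1_def W2_def by blast+
  have W: "cfun.subspace W1" "W1 \<subseteq> spt (in_sector 0)" "cfun.subspace W2" "W2 \<subseteq> spt (in_sector (1 / 2))"
    unfolding W1_def W2_def by (rule VLambda_plus_props VLambdaT_plus_props)+
  have V: "cfun.subspace V" "\<And>u v n. u \<in> V \<Longrightarrow> v \<in> V \<Longrightarrow> vmode Vnat u n v \<in> V"
    "\<And>u n. u \<in> V \<Longrightarrow> lin_on V (vmode Vnat u n)" "vconf Vnat \<in> V"
    "\<And>n. \<exists>B. finite B \<and> cfun.span B = weight_space Vnat n"
    using mv(1) unfolding is_voa_def Let_def V_def by auto
  have WV: "W1 \<subseteq> V" "W2 \<subseteq> V"
  proof -
    have "0 \<in> W1" "0 \<in> W2" using W(1,3) by (auto intro: cfun.subspace_0)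
    then show "W1 \<subseteq> V" "W2 \<subseteq> V" unfolding mv(2) by force+
  qed
  have cover: "\<exists>u\<in>W1. \<exists>w\<in>W2. v = u + w" if "v \<in> V" for v
    using that unfolding mv(2) by blast
  have sect: "x \<in> W1" if "x \<in> V" "x \<in> spt (in_sector 0)" for x
  proof -
    from cover[OF that(1)] obtain u v where uv: "x = u + v" "u \<in> W1" "v \<in> W2" by blast
    have "v = 0" using sum_in_sector(1)[of u v] uv W that(2) by blast
    then show ?thesis using uv by simp
  qed
  have sectT: "x \<in> W2" if "x \<in> V" "x \<in> spt (in_sector (1 / 2))" for x
  proof -
    from cover[OF that(1)] obtain u v where uv: "x = u + v" "u \<in> W1" "v \<in> W2" by blast
    have "u = 0" using sum_in_sector(2)[of u v] uv W that(2) by blast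
    then show ?thesis using uv by simp
  qed
  have \<iota>A: "\<iota> a \<in> W1" if "a \<in> A" for a using assms(10) that unfolding A W1_def by blast
  have act_eq: "act a n w = fock_mode \<epsilon> T (\<iota> a) n w" if "a \<in> A" "w \<in> V" for a n w
    unfolding act_def natural_act_def using mv(3)[OF \<iota>A[OF that(1)] that(2)] .
  have act_V: "act a n w \<in> V" if "a \<in> A" "w \<in> V" for a n w
    unfolding act_def natural_act_def using V(2) \<iota>A[OF that(1)] that(2) WV by blast
  have stable: "act a n w \<in> W1" if "a \<in> A" "w \<in> W1" for a n w
  proof (rule sect)
    have "w \<in> V" using that(2) WV by blast
    then show "act a n w \<in> V" by (rule act_V[OF that(1)])
    show "act a n w \<in> spt (in_sector 0)"
      unfolding act_eq[OF that(1) \<open>w \<in> V\<close>] using that(2) W(2) by (intro fock_mode_in_sector) blast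
  qed
  have stableT: "act a n w \<in> W2" if "a \<in> A" "w \<in> W2" for a n w
  proof (rule sectT)
    have "w \<in> V" using that(2) WV by blast
    then show "act a n w \<in> V" by (rule act_V[OF that(1)])
    show "act a n w \<in> spt (in_sector (1 / 2))"
      unfolding act_eq[OF that(1) \<open>w \<in> V\<close>] using that(2) W(4) by (intro fock_mode_in_sector) blast
  qed
  \<comment> \<open>The embedding preserves the Virasoro element, so the grading of the moonshine
    module is given by the action of \<open>conf24\<close> and can be computed in the
    models.\<close>
  have conf: "conf24 \<in> A" "\<iota> conf24 = vconf Vnat"
    using conf24_At assms(9) unfolding A_def voa_embedding_def VL by auto
  have L0_act: "act conf24 1 = L0" unfolding act_def natural_act_def L0_def conf(2) by (rule ext) simp
  have L0_lin: "lin_on V L0" unfolding L0_def by (rule V(3)[OF V(4)])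

  define J1 where "J1 = C2 k C <+> R"
  define D1 where "D1 = (\<lambda>j. case j of Inl c \<Rightarrow> M_plus k \<rho> c | Inr c \<Rightarrow> M_code k c)"
  define J2 where "J2 = binary_dual (C2 k C) \<times> {..<2 ^ (vec.dim (C2 k C) - 12) :: nat}"
  define D2 where "D2 = (\<lambda>(c, j::nat). MT_minus \<rho> (c :: bit ^ 24))"
  have finJ: "finite J1" "finite J2"
  proof -
    have "R \<subseteq> zmod_space k" using assms(11) type_II_zmod[OF tII] by (auto simp: half_system_def)
    then have "finite R" using finite_zmod by (rule finite_subset)
    then show "finite J1" "finite J2" unfolding J1_def J2_def using finite_bit_vec by auto
  qed
  obtain F1 where F1: "lin_on W1 F1" "bij_betw F1 W1 (dsum J1 D1)"
    "\<And>a n w. a \<in> A \<Longrightarrow> w \<in> W1 \<Longrightarrow> F1 (act a n w) = dsum_act Yt a n (F1 w)"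
    using assms(12) unfolding untwisted_decomposition_def module_iso_def A VL(2) W1_def act_def J1_def D1_def by blast
  obtain F2 where F2: "lin_on W2 F2" "bij_betw F2 W2 (dsum J2 D2)"
    "\<And>a n w. a \<in> A \<Longrightarrow> w \<in> W2 \<Longrightarrow> F2 (act a n w) = dsum_act Yt a n (F2 w)"
    using assms(13) unfolding twisted_decomposition_def module_iso_def A VL(2) W2_def act_def J2_def D2_def by blast
  have subD: "cfun.subspace (D1 j)" "cfun.subspace (D2 l)" for j l
    unfolding D1_def D2_def by (auto simp: subspace_code split: sum.split prod.split)
  have finD: "D1 j \<subseteq> fin_supp" "D2 l \<subseteq> fin_supp" for j l
    unfolding D1_def D2_def using M_code_fin_supp M_plus_subset MT_minus_fin_supp
    by (auto split: sum.split prod.split)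
  interpret m1: module_sum A act W1 Yt J1 D1 F1
    using W F1 stable subD finJ by unfold_locales (simp_all add: tensor_mode_zero)
  interpret m2: module_sum A act W2 Yt J2 D2 F2
    using W F2 stableT subD finJ by unfold_locales (simp_all add: tensor_mode_zero)
  have acts: "acts_by_mu k \<rho> i act V \<sigma>" using assms(15) by (simp add: act_def V_def)
  have mu: "\<sigma> v = cscale (mu (w i)) v" if "\<And>j. w j \<in> irreps k" "submodule A act V N"
    "module_iso A act N Yt (tensor (\<lambda>j. irr_space k \<rho> (w j)))" "v \<in> N" for w N v
    using acts_by_mu_image[OF acts, of w N v] that unfolding A VL(2) by blast
  have \<sigma>: "lin_on V \<sigma>" using assms(14) unfolding voa_aut_def voa_embedding_def V_def by blast

  \<comment> \<open>One sign part of one summand, where c is a word of R or a half word. The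
    inclusion D together with \<open>act_K\<close> yields the membership premise of
    \<open>upart_stable\<close>.\<close>
  have untw: "\<sigma> (m1.K j u) = cscale (bsgn (tau i c)) (m1.K j u)"
    if j: "j \<in> J1" and c: "c \<in> zmod_space k" and D: "D1 j \<subseteq> M_code k c" and N: "tensor (upart c e) \<subseteq> D1 j" and u: "u \<in> tensor (upart c e)"
    for j c e u
  proof -
    have st: "Yt a n w \<in> tensor (upart c e)" if "a \<in> A" "w \<in> tensor (upart c e)" for a n w
    proof (rule upart_stable[OF _ that(2)])
      show "a \<in> At" using that(1) by (simp add: A_def)
      have "Yt a n w \<in> D1 j" using m1.act_K(1)[OF j subsetD[OF N that(2)] that(1)] .
      from subsetD[OF D this] show "Yt a n w \<in> tensor (\<lambda>j. V_coset k (c j))" unfolding M_code_def .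
    qed
    from upart_iso[OF c, of e] obtain Q where
      Q: "lin_map Q" "inj Q" "Q ` tensor (upart c e) = tensor (\<lambda>j. irr_space k \<rho> (urep c e j))"
      and Q_act: "\<forall>a\<in>At. \<forall>n w. Q (Yt a n w) = Yt a n (Q w)"
      by (elim exE conjE)
    have Q4: "Q (Yt a n w) = Yt a n (Q w)" if "a \<in> A" for a n w
      using Q_act that unfolding A_def by (simp only: Ball_def)
    have S1: "submodule A act V (m1.K j ` tensor (upart c e))"
      by (rule m1.summand_submodule(1)[OF j tensor_subspace N _ WV(1) Q(1,2,3)]) (rule st Q4; assumption)+
    have S2: "module_iso A act (m1.K j ` tensor (upart c e)) Yt (tensor (\<lambda>j. irr_space k \<rho> (urep c e j)))"
      by (rule m1.summand_submodule(2)[OF j tensor_subspace N _ WV(1) Q(1,2,3)]) (rule st Q4; assumption)+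
    have "\<sigma> (m1.K j u) = cscale (mu (urep c e i)) (m1.K j u)"
      by (rule mu[of "urep c e", OF urep_irreps[OF c] S1 S2 imageI[OF u]])
    then show ?thesis unfolding mu_urep[OF assms(2) c] .
  qed
  define s1 where "s1 = (\<lambda>j. case j of Inl d \<Rightarrow> bsgn (d $ i) | Inr c \<Rightarrow> bsgn (tau i c))"
  have s1: "\<sigma> (m1.K j u) = cscale (s1 j) (m1.K j u)" if j: "j \<in> J1" and u: "u \<in> D1 j" for j u
  proof (cases j)
    case (Inl d)
    let ?E = "{e. (\<Prod>i\<in>UNIV. psgn (e i)) = (1::complex)}"
    \<comment> \<open>All coordinates of a half word are 0 or k, so its sign parts are exactly the
      terms of M(c)^+.\<close>
    have up: "tensor (upart (half_word k d) e) = tensor (\<lambda>i. V_pm k \<rho> (if d $ i = 0 then 0 else int k) (e i))" for e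
      by (rule arg_cong[where f = tensor], rule ext) (auto simp: upart_def half_word_def)
    have D: "D1 j = cfun.span (\<Union>e\<in>?E. tensor (upart (half_word k d) e))"
      unfolding up by (simp add: D1_def Inl M_plus_def)
    have DM: "D1 j \<subseteq> M_code k (half_word k d)" using M_plus_subset by (simp add: D1_def Inl)
    have "\<sigma> (m1.K j u) = cscale (bsgn (tau i (half_word k d))) (m1.K j u)"
    proof (rule m1.scalar_on_span[where P = "\<Union>e\<in>?E. tensor (upart (half_word k d) e)", OF j \<sigma> WV(1) _ _ _ u])
      show "D1 j \<subseteq> cfun.span (\<Union>e\<in>?E. tensor (upart (half_word k d) e))" by (simp only: D order_refl)
      show sub: "(\<Union>e\<in>?E. tensor (upart (half_word k d) e)) \<subseteq> D1 j" unfolding D by (rule cfun.span_superset)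
      fix u assume "u \<in> (\<Union>e\<in>?E. tensor (upart (half_word k d) e))"
      then obtain e where e: "e \<in> ?E" "u \<in> tensor (upart (half_word k d) e)" by blast
      have "tensor (upart (half_word k d) e) \<subseteq> D1 j" by (rule order_trans[OF UN_upper[OF e(1)] sub])
      then show "\<sigma> (m1.K j u) = cscale (bsgn (tau i (half_word k d))) (m1.K j u)"
        by (rule untw[OF j half_word_zmod DM _ e(2)])
    qed
    then show ?thesis by (simp add: s1_def Inl bsgn_half_word[OF assms(2)])
  next
    case (Inr c)
    have c: "c \<in> zmod_space k"
      using j assms(11) type_II_zmod[OF tII] by (auto simp: J1_def Inr half_system_def)
    have D: "D1 j = M_code k c" by (simp add: D1_def Inr)
    have "\<sigma> (m1.K j u) = cscale (bsgn (tau i c)) (m1.K j u)"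
    proof (rule m1.scalar_on_span[where P = "\<Union>e. tensor (upart c e)", OF j \<sigma> WV(1) _ _ _ u])
      show "D1 j \<subseteq> cfun.span (\<Union>e. tensor (upart c e))" unfolding D by (rule M_code_span)
      show "(\<Union>e. tensor (upart c e)) \<subseteq> D1 j" unfolding D by (intro UN_least M_code_span(2))
      fix u assume "u \<in> (\<Union>e. tensor (upart c e))"
      then obtain e where e: "u \<in> tensor (upart c e)" by blast
      show "\<sigma> (m1.K j u) = cscale (bsgn (tau i c)) (m1.K j u)"
        by (rule untw[OF j c _ _ e]) (simp_all only: D order_refl M_code_span(2))
    qed
    then show ?thesis by (simp add: s1_def Inr)
  qed
  \<comment> \<open>The value of \<open>mu\<close> on a twisted irreducible does not depend on its
    sign, so all terms of M^T(c)^- share one eigenvalue.\<close>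
  define s2 where "s2 = (\<lambda>(c :: bit ^ 24, l::nat). if c $ i = 0 then \<i> else - \<i>)"
  have s2: "\<sigma> (m2.K j u) = cscale (s2 j) (m2.K j u)" if j: "j \<in> J2" and u: "u \<in> D2 j" for j u
  proof -
    obtain c l where cl: "j = (c, l)" by (cases j)
    let ?E = "{e. (\<Prod>i\<in>UNIV. psgn (e i)) = (-1::complex)}" and ?P = "\<lambda>e. tensor (\<lambda>i. VT_pm \<rho> (c $ i) (e i))"
    have D: "D2 j = cfun.span (\<Union>e\<in>?E. ?P e)" by (simp add: D2_def cl MT_minus_def)
    have D': "D2 j \<subseteq> tensor (\<lambda>i. twisted_space {c $ i})" using MT_minus_subset by (simp add: D2_def cl)
    show ?thesis
    proof (rule m2.scalar_on_span[where P = "\<Union>e\<in>?E. ?P e", OF j \<sigma> WV(2) _ _ _ u])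
      show "D2 j \<subseteq> cfun.span (\<Union>e\<in>?E. ?P e)" by (simp only: D order_refl)
      show sub: "(\<Union>e\<in>?E. ?P e) \<subseteq> D2 j" unfolding D by (rule cfun.span_superset)
      fix u assume "u \<in> (\<Union>e\<in>?E. ?P e)"
      then obtain e where e: "e \<in> ?E" "u \<in> ?P e" by blast
      have N: "?P e \<subseteq> D2 j" by (rule order_trans[OF UN_upper[OF e(1)] sub])
      have st: "Yt a n w \<in> ?P e" if "a \<in> A" "w \<in> ?P e" for a n w
      proof (rule tpart_stable[OF _ that(2)])
        show "a \<in> At" using that(1) by (simp add: A_def)
        show "Yt a n w \<in> tensor (\<lambda>i. twisted_space {c $ i})"
          by (rule subsetD[OF D' m2.act_K(1)[OF j subsetD[OF N that(2)] that(1)]])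
      qed
      \<comment> \<open>These terms are tensor products of listed irreducibles as they
        stand.\<close>
      have idQ: "lin_map (\<lambda>w. w)" "inj (\<lambda>w. w)" "(\<lambda>w. w) ` ?P e = tensor (\<lambda>i. irr_space k \<rho> (IrrTw (c $ i) (e i)))"
        by (simp_all add: lin_map_def)
      have S1: "submodule A act V (m2.K j ` ?P e)"
        by (rule m2.summand_submodule(1)[OF j tensor_subspace N _ WV(2) idQ]) (rule st refl; assumption)+
      have S2: "module_iso A act (m2.K j ` ?P e) Yt (tensor (\<lambda>i. irr_space k \<rho> (IrrTw (c $ i) (e i))))"
        by (rule m2.summand_submodule(2)[OF j tensor_subspace N _ WV(2) idQ]) (rule st refl; assumption)+
      have "IrrTw t s \<in> irreps k" for t s by (auto simp: irreps_def)
      then have "\<sigma> (m2.K j u) = cscale (mu (IrrTw (c $ i) (e i))) (m2.K j u)"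
        by (rule mu[of "\<lambda>i. IrrTw (c $ i) (e i)", OF _ S1 S2 imageI[OF e(2)]])
      then show "\<sigma> (m2.K j u) = cscale (s2 j) (m2.K j u)" by (simp add: s2_def cl)
    qed
  qed

  show ?thesis
  proof
    fix g assume "g \<in> aut_conj_class Vnat \<sigma>"
    then obtain h where g: "g \<in> voa_aut Vnat" and h: "h \<in> voa_aut Vnat" and gh: "\<And>v. v \<in> V \<Longrightarrow> g (h v) = h (\<sigma> v)"
      unfolding aut_conj_class_def V_def by blast
    have gl: "lin_on V g" using g unfolding voa_aut_def voa_embedding_def V_def by blast
    have hV: "lin_on V h" "inj_on h V" "h ` V = V"
      "\<And>u v n. u \<in> V \<Longrightarrow> v \<in> V \<Longrightarrow> h (vmode Vnat u n v) = vmode Vnat (h u) n (h v)" "h (vconf Vnat) = vconf Vnat"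
      using h unfolding voa_aut_def voa_embedding_def V_def by blast+
    have hL: "L0 (h v) = h (L0 v)" if "v \<in> V" for v
      unfolding L0_def using hV(4)[OF V(4) that] hV(5) by simp
    have coeff: "trace_on (weight_space Vnat (int n)) g =
        fps_nth (fps_const (1 / 2) * (\<Sum>c\<in>C. fps_const (bsgn (tau i c)) * ch_M k \<rho> c)
          + fps_const (1 / 2) * b_series k \<rho> ^ 24) n" for n
    proof -
      let ?U1 = "\<lambda>j. eigenspace L0t (D1 j) (of_nat n)" and ?U2 = "\<lambda>j. eigenspace L0t (D2 j) (of_nat n)"
      have L1: "lin_on W1 (act conf24 1)" "lin_on W2 (act conf24 1)"
        unfolding L0_act using lin_on_subset[OF L0_lin] WV by blast+
      have d1: "decomposition J1 ?U1 m1.K (eigenspace L0 W1 (of_nat n))"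
        using m1.eigenspace_decomposition[OF conf(1) Yt_lin[OF finD(1)] L1(1)] unfolding L0_act .
      have d2: "decomposition J2 ?U2 m2.K (eigenspace L0 W2 (of_nat n))"
        using m2.eigenspace_decomposition[OF conf(1) Yt_lin[OF finD(2)] L1(2)] unfolding L0_act .
      interpret gs: graded_sum V W1 W2 L0 "of_nat n" J1 ?U1 m1.K J2 ?U2 m2.K
      proof (rule graded_sum.intro)
        fix u v assume "u \<in> W1" "v \<in> W2" "u + v = 0"
        then show "u = 0 \<and> v = 0" using sectors_disjoint[of u v] W by blast
      next
        fix w
        show "w \<in> W1 \<Longrightarrow> L0 w \<in> W1" "w \<in> W2 \<Longrightarrow> L0 w \<in> W2"
          using stable[OF conf(1), of w 1] stableT[OF conf(1), of w 1] unfolding L0_act by blast+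
      next
        fix v assume "v \<in> V" then show "\<exists>u\<in>W1. \<exists>w\<in>W2. v = u + w" by (rule cover)
      qed (fact V(1) L0_lin W(1) W(3) WV d1 d2)+
      \<comment> \<open>On the summands moved by h, the conjugate g has the eigenvalues of \<sigma>,
        so its trace is computed directly.\<close>
      interpret dec: decomposition "J1 <+> J2" gs.UU "\<lambda>j u. h (gs.KK j u)" "eigenspace L0 V (of_nat n)"
        by (rule gs.decomposition_twisted[OF hV(1-3) hL])
      have ws: "weight_space Vnat (int n) = eigenspace L0 V (of_nat n)" by (simp add: L0_def V_def)
      \<comment> \<open>The finite-dimensional weight spaces of the VOA bound all graded pieces, the
        twisted ones included.\<close>
      obtain B where B: "finite B" "eigenspace L0 V (of_nat n) \<subseteq> cfun.span B"
        using V(5)[of "int n"] unfolding ws by blast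
      let ?s = "case_sum s1 s2"
      have UU: "gs.UU (Inl p) = ?U1 p" "gs.UU (Inr q) = ?U2 q" for p q
        by (simp_all only: gs.UU_def sum.case)
      have KK: "gs.KK (Inl p) = m1.K p" "gs.KK (Inr q) = m2.K q" for p q
        by (simp_all only: gs.KK_def sum.case)
      have "trace_on (eigenspace L0 V (of_nat n)) g = (\<Sum>j\<in>J1 <+> J2. ?s j * of_nat (cfun.dim (gs.UU j)))"
      proof (rule dec.trace_eq_sum[OF B])
        show "lin_on (eigenspace L0 V (of_nat n)) g" by (rule lin_on_subset[OF gl]) (auto simp: eigenspace_def)
        fix j u assume j: "j \<in> J1 <+> J2" and u: "u \<in> gs.UU j"
        have KV: "gs.KK j u \<in> V" and K\<sigma>: "\<sigma> (gs.KK j u) = cscale (?s j) (gs.KK j u)"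
        proof -
          have "gs.KK j u \<in> V \<and> \<sigma> (gs.KK j u) = cscale (?s j) (gs.KK j u)"
          proof (cases j)
            case (Inl l)
            have l: "l \<in> J1" using j by (auto simp: Inl)
            have "u \<in> ?U1 l" using u unfolding Inl UU .
            then have ul: "u \<in> D1 l" by (simp add: eigenspace_def)
            show ?thesis using s1[OF l ul] subsetD[OF WV(1) m1.K_W[OF l ul]] by (simp only: Inl KK sum.case simp_thms)
          next
            case (Inr l)
            have l: "l \<in> J2" using j by (auto simp: Inr)
            have "u \<in> ?U2 l" using u unfolding Inr UU .
            then have ul: "u \<in> D2 l" by (simp add: eigenspace_def)
            show ?thesis using s2[OF l ul] subsetD[OF WV(2) m2.K_W[OF l ul]] by (simp only: Inr KK sum.case simp_thms)
          qed
          then show "gs.KK j u \<in> V" "\<sigma> (gs.KK j u) = cscale (?s j) (gs.KK j u)" by blast+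
        qed
        show "g (h (gs.KK j u)) = cscale (?s j) (h (gs.KK j u))"
          using gh[OF KV] hV(1) KV unfolding K\<sigma> lin_on_def by simp
      qed
      also have "\<dots> = (\<Sum>j\<in>J1. s1 j * of_nat (cfun.dim (?U1 j))) + (\<Sum>j\<in>J2. s2 j * of_nat (cfun.dim (?U2 j)))"
        unfolding gs.sum_Plus UU by (simp only: sum.case)
      finally have tr: "trace_on (eigenspace L0 V (of_nat n)) g =
        (\<Sum>j\<in>J1. s1 j * of_nat (cfun.dim (?U1 j))) + (\<Sum>j\<in>J2. s2 j * of_nat (cfun.dim (?U2 j)))" .
      have t2: "(\<Sum>j\<in>J2. s2 j * of_nat (cfun.dim (?U2 j))) = 0"
        using twisted_trace_zero[where h = "\<lambda>c. cfun.dim (eigenspace L0t (MT_minus \<rho> c) (of_nat n))" and i = i,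
            OF tII assms(2) dim_MT_minus_flip, of "2 ^ (vec.dim (C2 k C) - 12)"]
        unfolding J2_def s2_def D2_def by (simp only: case_prod_unfold)
      have t1: "(\<Sum>j\<in>J1. s1 j * of_nat (cfun.dim (?U1 j))) =
          (\<Sum>d\<in>C2 k C. bsgn (d $ i) * of_nat (cfun.dim (eigenspace L0t (M_plus k \<rho> d) (of_nat n)))) +
          (\<Sum>c\<in>R. bsgn (tau i c) * of_nat (cfun.dim (eigenspace L0t (M_code k c) (of_nat n))))"
        using finJ(1) unfolding J1_def by (simp add: sum.Plus s1_def D1_def)
      show ?thesis unfolding ws tr t2 t1 untwisted_trace[OF tII assms(2,11), of i n] by (simp only: add_0_right)
    qed
    have "Abs_fps (\<lambda>n. trace_on (weight_space Vnat (int n)) g) =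
        fps_const (1 / 2) * (\<Sum>c\<in>C. fps_const (bsgn (tau i c)) * ch_M k \<rho> c) + fps_const (1 / 2) * b_series k \<rho> ^ 24"
      by (rule fps_ext) (simp only: fps_nth_Abs_fps coeff)
    then show "mckay_thompson Vnat g = fls_X_inv * fps_to_fls
        (fps_const (1 / 2) * (\<Sum>c\<in>C. fps_const (bsgn (tau i c)) * ch_M k \<rho> c) + fps_const (1 / 2) * b_series k \<rho> ^ 24)"
      unfolding mckay_thompson_def by (simp only:)
  qed
qed

end
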